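(* Let $(G,L)$ be a $(G,L)$-pair, $L=L_1\times\dots\times L_p$. There is a natural multiplication $(\mathfrak g,\mathfrak h)\mapsto \mathfrak g\circ\mathfrak h$, $$L^\gamma\setminus G/L^\beta\ \times\ L^\beta\setminus G/L^\alpha\ \to\ L^\gamma\setminus G/L^\alpha,$$ defined for all multi-indices $\alpha,\beta,\gamma\in\mathbb Z_{\ge 0}^p$, namely $\mathfrak g\circ\mathfrak h:=$ the eventual value, as $m\to\infty$, of $L^\gamma\, g\,\Theta^{[\beta]}_m h\, L^\alpha$, where $g\in\mathfrak g$, $h\in\mathfrak h$. Moreover, for any unitary representation $\rho$ of the pair $(G,L)$, all $\alpha,\beta,\gamma$, all $\mathfrak g\in L^\gamma\setminus G/L^\beta$ and all $\mathfrak h\in L^\beta\setminus G/L^\alpha$, $$\overline\rho_{\beta,\gamma}(\mathfrak g)\,\overline\rho_{\alpha,\beta}(\mathfrak h)=\overline\rho_{\alpha,\gamma}(\mathfrak g\circ\mathfrak h).$$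
   Context: Classical groups. A matrix $g$ over $\mathbb R,\mathbb C$ or $\mathbb H$ with rows and columns indexed by a countable basis is finite if $g-1$ has only finitely many nonzero entries. All groups below consist of finite invertible matrices satisfying the usual identities. The irreducible classical groups and their maximal heavy subgroups are: $\mathrm{GL}(\infty,\mathbb R)\supset \mathrm O(\infty)$; $\mathrm{GL}(\infty,\mathbb C)\supset \mathrm U(\infty)$; $\mathrm{GL}(\infty,\mathbb H)\supset\mathrm{Sp}(\infty)$; $\mathrm U(\infty,\infty)\supset \mathrm U(\infty)\times \mathrm U(\infty)$; $\mathrm{Sp}(2\infty,\mathbb R)\supset \mathrm U(\infty)$; $\mathrm{Sp}(2\infty,\mathbb C)\supset\mathrm{Sp}(\infty)$; $\mathrm{Sp}(\infty,\infty)\supset\mathrm{Sp}(\infty)\times\mathrm{Sp}(\infty)$; $\mathrm O(\infty,\infty)\supset\mathrm O(\infty)\times\mathrm O(\infty)$; $\mathrm O(\infty,\mathbb C)\supset\mathrm O(\infty)$; $\mathrm{SO}^*(2\infty)\supset\mathrm U(\infty)$; $\mathrm U(p,\infty)\supset\mathrm U(\infty)$; $\mathrm O(p,\infty)\supset\mathrm O(\infty)$; $\mathrm{Sp}(p,\infty)\supset\mathrm{Sp}(\infty)$ with $0\le p<\infty$ (for $p=0$: the groups $\mathrm U(\infty),\mathrm O(\infty),\mathrm{Sp}(\infty)$ themselves). Here $\mathrm{Sp}(\infty)$ is the quaternionic unitary group. A classical group is a finite product of irreducible ones; its maximal heavy subgroup $K$ is the product of the maximal heavy subgroups of the factors. A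 heavy group is a finite product of groups $\mathrm O(\infty),\mathrm U(\infty),\mathrm{Sp}(\infty)$ (called irreducible heavy groups). Straight homomorphisms. Trivial homomorphisms between irreducible heavy groups are: the identity maps, elementwise complex conjugation of $\mathrm U(\infty)$, and the obvious maps $\mathrm O(\infty)\to\mathrm U(\infty)$, $\mathrm O(\infty)\to\mathrm{Sp}(\infty)$, $\mathrm U(\infty)\to\mathrm{Sp}(\infty)$, $\mathrm U(\infty)\to\mathrm O(2\infty)$, $\mathrm{Sp}(\infty)\to\mathrm O(4\infty)$, $\mathrm{Sp}(\infty)\to\mathrm U(2\infty)$. For $L=L_1\times\dots\times L_p$ heavy and $K$ irreducible heavy, a homomorphism $L\to K$ is straight if it has the block diagonal form $(g_1,\dots,g_p)\mapsto\mathrm{diag}(1_a,\tau_1(g_{m_1}),\dots,\tau_N(g_{m_N}))$ with $\tau_j$ trivial, $0<N<\infty$, $a\in\{0,1,2,\dots,\infty\}$ (not required to be faithful). For $K=K_1\times\dots\times K_q$, a straight homomorphism $L\to K$ is a product of straight homomorphisms $L\to K_i$. A $(G,L)$-pair consists of a classical group $G$ with maximal heavy subgroup $K$ and a heavy group $L$ straightly embedded in $K$. For $L=L_1\times\dots\times L_p$ and a multi-index $\alpha=(\alpha_1,\dots,\alpha_p)$, $L^\alpha=L_1^{\alpha_1}\times\dots\times L_p^{\alpha_p}$, where $L_j^{\alpha_j}$ is the stabilizer in $L_j$ of the first $\alpha_j$ basis vectors of its $\ell_2$. For a multi-index $m$, $\Theta_m^{[\alpha]}=(\Theta_{m_1}^{[\alpha_1]},\dots,\Theta_{m_p}^{[\alpha_p]})\in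 L$, where $\Theta_{m_j}^{[\alpha_j]}\in L_j$ is the permutation matrix swapping the $(\alpha_j+i)$-th and $(\alpha_j+m_j+i)$-th basis vectors for $1\le i\le m_j$ and fixing all others. The double coset $L^\gamma g\Theta^{[\beta]}_mhL^\alpha$ is constant once all $m_j$ are large, and does not depend on the choice of $g\in\mathfrak g$, $h\in\mathfrak h$. A unitary representation of the pair $(G,L)$ (admissible representation) is a unitary representation $\rho$ of $G$ in a Hilbert space $H$ whose restriction to $L$ is continuous (with respect to the weak operator topology on $L$); equivalently, $\bigcup_\alpha H^{[\alpha]}$ is dense in $H$, where $H^{[\alpha]}$ is the space of $L^\alpha$-fixed vectors. $P^{[\alpha]}$ is the orthogonal projection onto $H^{[\alpha]}$, and $\overline\rho_{\alpha,\beta}(g)=P^{[\beta]}\rho(g):H^{[\alpha]}\to H^{[\beta]}$; it depends only on the double coset of $g$ in $L^\beta\setminus G/L^\alpha$. *)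

theory Defs
  imports "HOL-Analysis.Analysis" "HOL-Algebra.Product_Groups" "HOL-Library.Extended_Nat"
begin

section \<open>Quaternions\<close>

text \<open>
  \<open>Quat a b\<close> is the quaternion \<open>a + b j\<close> with complex \<open>a\<close>, \<open>b\<close>; multiplication is
  determined by \<open>j z = cnj z j\<close> and \<open>j j = -1\<close>.  The fields of real and of complex
  numbers are regarded as subsets of the quaternions, so that all matrix groups below consist
  of quaternionic matrices.
\<close>

datatype quat = Quat (qfst: complex) (qsnd: complex)

lemma quat_eq_iff: "p = q \<longleftrightarrow> qfst p = qfst q \<and> qsnd p = qsnd q"
  by (cases p; cases q) auto

instantiation quat :: ring_1
begin
definition "0 = Quat 0 0"
definition "1 = Quat 1 0"
definition "p + q = Quat (qfst p + qfst q) (qsnd p + qsnd q)" for p q :: quat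
definition "- p = Quat (- qfst p) (- qsnd p)" for p :: quat
definition "p - q = Quat (qfst p - qfst q) (qsnd p - qsnd q)" for p q :: quat
definition "p * q = Quat (qfst p * qfst q - qsnd p * cnj (qsnd q))
                         (qfst p * qsnd q + qsnd p * cnj (qfst q))" for p q :: quat
instance
  by standard
     (simp_all add: zero_quat_def one_quat_def plus_quat_def uminus_quat_def minus_quat_def
        times_quat_def algebra_simps)
end

lemma quat_sel [simp]:
  "qfst 0 = 0" "qsnd 0 = 0" "qfst 1 = 1" "qsnd 1 = 0"
  "qfst (p + q) = qfst p + qfst q" "qsnd (p + q) = qsnd p + qsnd q"
  "qfst (- p) = - qfst p" "qsnd (- p) = - qsnd p"
  "qfst (p - q) = qfst p - qfst q" "qsnd (p - q) = qsnd p - qsnd q"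
  "qfst (p * q) = qfst p * qfst q - qsnd p * cnj (qsnd q)"
  "qsnd (p * q) = qfst p * qsnd q + qsnd p * cnj (qfst q)"
  by (simp_all add: zero_quat_def one_quat_def plus_quat_def uminus_quat_def minus_quat_def
        times_quat_def)

instantiation quat :: real_algebra_1
begin
definition "r *\<^sub>R q = Quat (r *\<^sub>R qfst q) (r *\<^sub>R qsnd q)" for q :: quat
instance
  by standard (simp_all add: quat_eq_iff scaleR_quat_def algebra_simps)
end

lemma quat_scaleR_sel [simp]: "qfst (r *\<^sub>R q) = r *\<^sub>R qfst q" "qsnd (r *\<^sub>R q) = r *\<^sub>R qsnd q"
  by (simp_all add: scaleR_quat_def)

lemma quat_of_real_sel [simp]: "qfst (of_real r) = of_real r" "qsnd (of_real r) = 0"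
  by (simp_all add: of_real_def)

definition qcnj :: "quat \<Rightarrow> quat"
  where "qcnj q = Quat (cnj (qfst q)) (- qsnd q)"

instantiation quat :: real_inner
begin
definition "inner p q = inner (qfst p) (qfst q) + inner (qsnd p) (qsnd q)" for p q :: quat
definition "norm q = sqrt (inner q q)" for q :: quat
definition "sgn q = q /\<^sub>R norm q" for q :: quat
definition "dist p q = norm (p - q)" for p q :: quat
definition [code del]:
  "(uniformity :: (quat \<times> quat) filter) = (INF e\<in>{0 <..}. principal {(x, y). dist x y < e})"
definition [code del]:
  "open (U :: quat set) \<longleftrightarrow> (\<forall>x\<in>U. eventually (\<lambda>(x', y). x' = x \<longrightarrow> y \<in> U) uniformity)"
instance
proof
  fix x y z :: quat and r :: real
  show "inner x y = inner y x"
    by (simp add: inner_quat_def inner_commute)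
  show "inner (x + y) z = inner x z + inner y z"
    by (simp add: inner_quat_def inner_add_left)
  show "inner (r *\<^sub>R x) y = r * inner x y"
    by (simp add: inner_quat_def algebra_simps)
  show "0 \<le> inner x x"
    by (simp add: inner_quat_def)
  show "inner x x = 0 \<longleftrightarrow> x = 0"
    by (simp add: inner_quat_def quat_eq_iff add_nonneg_eq_0_iff)
qed (rule norm_quat_def sgn_quat_def dist_quat_def uniformity_quat_def open_quat_def)+
end

lemma norm_quat_eq: "norm q = sqrt ((norm (qfst q))\<^sup>2 + (norm (qsnd q))\<^sup>2)" for q :: quat
  by (simp add: norm_quat_def inner_quat_def power2_norm_eq_inner)

instantiation quat :: real_div_algebra
begin
definition "inverse q = qcnj q /\<^sub>R (norm q)\<^sup>2" for q :: quat
definition "p div q = p * inverse q" for p q :: quat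
instance
proof
  fix a b :: quat
  have nz: "(cmod (qfst a))\<^sup>2 + (cmod (qsnd a))\<^sup>2 \<noteq> 0" if "a \<noteq> 0"
    using that by (auto simp: quat_eq_iff add_nonneg_eq_0_iff)
  have nm: "(norm a)\<^sup>2 = (cmod (qfst a))\<^sup>2 + (cmod (qsnd a))\<^sup>2"
    by (simp add: norm_quat_eq)
  have c: "complex_of_real ((cmod z)\<^sup>2) = z * cnj z" for z
    by (rule complex_norm_square)
  show "inverse a * a = 1" if "a \<noteq> 0"
  proof -
    have "qcnj a * a = ((norm a)\<^sup>2) *\<^sub>R (1::quat)"
      unfolding nm by (simp add: quat_eq_iff qcnj_def scaleR_conv_of_real c
          complex_norm_square algebra_simps del: of_real_power)
    then show ?thesis
      using nz[OF that] by (simp add: inverse_quat_def nm)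
  qed
  show "a * inverse a = 1" if "a \<noteq> 0"
  proof -
    have "a * qcnj a = ((norm a)\<^sup>2) *\<^sub>R (1::quat)"
      unfolding nm by (simp add: quat_eq_iff qcnj_def scaleR_conv_of_real c
          complex_norm_square algebra_simps del: of_real_power)
    then show ?thesis
      using nz[OF that] by (simp add: inverse_quat_def nm)
  qed
  show "a div b = a * inverse b"
    by (rule divide_quat_def)
  show "inverse (0::quat) = 0"
    by (simp add: inverse_quat_def quat_eq_iff qcnj_def)
qed
end

instance quat :: real_normed_div_algebra
proof
  fix p q :: quat
  have "complex_of_real ((norm (p * q))\<^sup>2) = complex_of_real ((norm p)\<^sup>2 * (norm q)\<^sup>2)"
    by (simp add: norm_quat_eq complex_norm_square algebra_simps del: of_real_power)
  then have "(norm (p * q))\<^sup>2 = (norm p * norm q)\<^sup>2"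
    by (simp only: of_real_eq_iff power_mult_distrib)
  then show "norm (p * q) = norm p * norm q"
    by (metis norm_ge_zero mult_nonneg_nonneg power2_eq_iff_nonneg)
qed

instance quat :: banach
proof
  fix X :: "nat \<Rightarrow> quat"
  assume X: "Cauchy X"
  have le: "cmod (qfst q) \<le> norm q" "cmod (qsnd q) \<le> norm q" for q
    by (simp_all add: norm_quat_eq)
  have "Cauchy (\<lambda>n. qfst (X n))" "Cauchy (\<lambda>n. qsnd (X n))"
    using X le(1)[of "X _ - X _"] le(2)[of "X _ - X _"]
    unfolding Cauchy_iff by (simp_all, meson le_less_trans)+
  then obtain a b where ab: "(\<lambda>n. qfst (X n)) \<longlonglongrightarrow> a" "(\<lambda>n. qsnd (X n)) \<longlonglongrightarrow> b"
    by (meson Cauchy_convergent_iff convergent_def)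
  have "(\<lambda>n. sqrt ((cmod (qfst (X n) - a))\<^sup>2 + (cmod (qsnd (X n) - b))\<^sup>2))
          \<longlonglongrightarrow> sqrt ((cmod (a - a))\<^sup>2 + (cmod (b - b))\<^sup>2)"
    by (intro tendsto_intros ab)
  then have "(\<lambda>n. dist (X n) (Quat a b)) \<longlonglongrightarrow> 0"
    by (simp add: dist_quat_def norm_quat_eq)
  then show "convergent X"
    unfolding convergent_def using tendsto_dist_iff by blast
qed

definition quat_of_complex :: "complex \<Rightarrow> quat"
  where "quat_of_complex z = Quat z 0"

text \<open>Coordinates with respect to \<open>1, i, j, k = i j\<close>.\<close>

definition qcoord :: "nat \<Rightarrow> quat \<Rightarrow> real"
  where "qcoord r q = [Re (qfst q), Im (qfst q), Re (qsnd q), Im (qsnd q)] ! r"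

definition qbasis :: "nat \<Rightarrow> quat"
  where "qbasis r = [Quat 1 0, Quat \<i> 0, Quat 0 1, Quat 0 \<i>] ! r"


section \<open>Finite matrices\<close>

type_synonym 'i qmat = "'i \<Rightarrow> 'i \<Rightarrow> quat"

definition id_mat :: "'i qmat"
  where "id_mat i j = (if i = j then 1 else 0)"

definition finite_mat :: "'i qmat \<Rightarrow> bool"
  where "finite_mat g \<longleftrightarrow> finite {(i, j). g i j \<noteq> id_mat i j}"

text \<open>The product is only used when the rows of the left factor have finite support.\<close>

definition mat_mul :: "'i qmat \<Rightarrow> 'i qmat \<Rightarrow> 'i qmat"
  where "mat_mul g h i j = (\<Sum>k | g i k \<noteq> 0. g i k * h k j)"

definition mat_transpose :: "'i qmat \<Rightarrow> 'i qmat"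
  where "mat_transpose g i j = g j i"

definition mat_adjoint :: "'i qmat \<Rightarrow> 'i qmat"
  where "mat_adjoint g i j = qcnj (g j i)"

text \<open>
  Finite invertible matrices with entries in \<open>A\<close> and basis indexed by \<open>I\<close>, extended by the
  identity outside \<open>I\<close>.
\<close>

definition finite_mats :: "quat set \<Rightarrow> 'i set \<Rightarrow> 'i qmat set"
  where "finite_mats A I = {g. finite_mat g \<and> (\<forall>i j. g i j \<in> A) \<and>
           (\<forall>i j. i \<notin> I \<or> j \<notin> I \<longrightarrow> g i j = id_mat i j)}"

definition GL_mats :: "quat set \<Rightarrow> 'i set \<Rightarrow> 'i qmat set"
  where "GL_mats A I = {g \<in> finite_mats A I.
           \<exists>h \<in> finite_mats A I. mat_mul g h = id_mat \<and> mat_mul h g = id_mat}"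

definition mat_group :: "'i qmat set \<Rightarrow> 'i qmat monoid"
  where "mat_group S = \<lparr>carrier = S, monoid.mult = mat_mul, one = id_mat\<rparr>"


section \<open>Heavy groups\<close>

datatype heavy = O_inf | U_inf | Sp_inf

fun scalars :: "heavy \<Rightarrow> quat set" where
  "scalars O_inf = \<real>"
| "scalars U_inf = range quat_of_complex"
| "scalars Sp_inf = UNIV"

definition heavy_irr :: "heavy \<Rightarrow> nat qmat monoid"
  where "heavy_irr t = mat_group {g \<in> GL_mats (scalars t) UNIV. mat_mul (mat_adjoint g) g = id_mat}"

definition heavy_group :: "heavy list \<Rightarrow> (nat \<Rightarrow> nat qmat) monoid"
  where "heavy_group Ls = product_group {..<length Ls} (\<lambda>j. heavy_irr (Ls ! j))"

text \<open>
  The weak operator topology of the irreducible heavy groups acting on real, complex or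
  quaternionic \<open>\<ell>\<^sub>2\<close> (a right vector space over the quaternions in the last case), and of
  their products.
\<close>

definition ell2 :: "heavy \<Rightarrow> (nat \<Rightarrow> quat) set"
  where "ell2 t = {x. (\<forall>n. x n \<in> scalars t) \<and> summable (\<lambda>n. (norm (x n))\<^sup>2)}"

definition ell2_inner :: "(nat \<Rightarrow> quat) \<Rightarrow> (nat \<Rightarrow> quat) \<Rightarrow> quat"
  where "ell2_inner y x = (\<Sum>n. qcnj (y n) * x n)"

definition mat_apply :: "nat qmat \<Rightarrow> (nat \<Rightarrow> quat) \<Rightarrow> nat \<Rightarrow> quat"
  where "mat_apply g x i = (\<Sum>k | g i k \<noteq> 0. g i k * x k)"

definition weak_topology :: "heavy \<Rightarrow> nat qmat topology"
  where "weak_topology t = topology_generated_by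
           {{g \<in> carrier (heavy_irr t). ell2_inner y (mat_apply g x) \<in> U} | x y U.
              x \<in> ell2 t \<and> y \<in> ell2 t \<and> open U}"

definition heavy_topology :: "heavy list \<Rightarrow> (nat \<Rightarrow> nat qmat) topology"
  where "heavy_topology Ls = product_topology (\<lambda>j. weak_topology (Ls ! j)) {..<length Ls}"


section \<open>Classical groups\<close>

text \<open>
  The matrices have index type \<^typ>\<open>nat + nat\<close>.  The groups with a single infinite block
  of basis vectors use the indices \<open>Inl n\<close> only, and \<open>U(p,\<infinity>)\<close> etc. have the indices
  \<open>Inl n\<close> and the \<open>p\<close> indices \<open>Inr k\<close>, \<open>k < p\<close>.
\<close>

datatype classical =
    GL_R | GL_C | GL_H
  | U_inf_inf | Sp_R | Sp_C | Sp_inf_inf | O_inf_inf | O_C | SO_star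
  | U_fin nat | O_fin nat | Sp_fin nat

abbreviation Inl_inds :: "(nat + nat) set"
  where "Inl_inds \<equiv> range Inl"

abbreviation fin_inds :: "nat \<Rightarrow> (nat + nat) set"
  where "fin_inds p \<equiv> range Inl \<union> Inr ` {..<p}"

fun signature_mat :: "(nat + nat) qmat" where
  "signature_mat (Inl m) (Inl n) = id_mat m n"
| "signature_mat (Inr m) (Inr n) = - id_mat m n"
| "signature_mat _ _ = 0"

fun symplectic_mat :: "(nat + nat) qmat" where
  "symplectic_mat (Inl m) (Inr n) = id_mat m n"
| "symplectic_mat (Inr m) (Inl n) = - id_mat m n"
| "symplectic_mat _ _ = 0"

definition i_mat :: "'i qmat"
  where "i_mat m n = (if m = n then quat_of_complex \<i> else 0)"

definition pres_bilinear :: "'i qmat \<Rightarrow> 'i qmat \<Rightarrow> bool"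
  where "pres_bilinear B g \<longleftrightarrow> mat_mul (mat_mul (mat_transpose g) B) g = B"

definition pres_sesquilinear :: "'i qmat \<Rightarrow> 'i qmat \<Rightarrow> bool"
  where "pres_sesquilinear B g \<longleftrightarrow> mat_mul (mat_mul (mat_adjoint g) B) g = B"

text \<open>
  \<open>SO\<^sup>*(2\<infinity>)\<close> is the group of quaternionic matrices preserving the skew-Hermitian form
  \<open>\<Sum> cnj (x n) i (y n)\<close>; the unitary matrices it contains are exactly the complex ones.
\<close>

fun classical_mats :: "classical \<Rightarrow> (nat + nat) qmat set" where
  "classical_mats GL_R = GL_mats (scalars O_inf) Inl_inds"
| "classical_mats GL_C = GL_mats (scalars U_inf) Inl_inds"
| "classical_mats GL_H = GL_mats (scalars Sp_inf) Inl_inds"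
| "classical_mats U_inf_inf =
     {g \<in> GL_mats (scalars U_inf) UNIV. pres_sesquilinear signature_mat g}"
| "classical_mats Sp_R =
     {g \<in> GL_mats (scalars O_inf) UNIV. pres_bilinear symplectic_mat g}"
| "classical_mats Sp_C =
     {g \<in> GL_mats (scalars U_inf) UNIV. pres_bilinear symplectic_mat g}"
| "classical_mats Sp_inf_inf =
     {g \<in> GL_mats (scalars Sp_inf) UNIV. pres_sesquilinear signature_mat g}"
| "classical_mats O_inf_inf =
     {g \<in> GL_mats (scalars O_inf) UNIV. pres_bilinear signature_mat g}"
| "classical_mats O_C =
     {g \<in> GL_mats (scalars U_inf) Inl_inds. pres_bilinear id_mat g}"
| "classical_mats SO_star =
     {g \<in> GL_mats (scalars Sp_inf) Inl_inds. pres_sesquilinear i_mat g}"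
| "classical_mats (U_fin p) =
     {g \<in> GL_mats (scalars U_inf) (fin_inds p). pres_sesquilinear signature_mat g}"
| "classical_mats (O_fin p) =
     {g \<in> GL_mats (scalars O_inf) (fin_inds p). pres_bilinear signature_mat g}"
| "classical_mats (Sp_fin p) =
     {g \<in> GL_mats (scalars Sp_inf) (fin_inds p). pres_sesquilinear signature_mat g}"

definition classical_irr :: "classical \<Rightarrow> (nat + nat) qmat monoid"
  where "classical_irr X = mat_group (classical_mats X)"

definition classical_group :: "classical list \<Rightarrow> (nat \<Rightarrow> (nat + nat) qmat) monoid"
  where "classical_group Gs = product_group {..<length Gs} (\<lambda>i. classical_irr (Gs ! i))"


section \<open>Trivial and straight homomorphisms\<close>

datatype trivial_hom = Inclusion | Conjugation | Realification | Complexification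

text \<open>
  \<open>trivial_hom_type \<tau> s t\<close>: \<open>\<tau>\<close> is a trivial homomorphism from the group of kind \<open>s\<close>
  to the group of kind \<open>t\<close>.
\<close>

fun trivial_hom_type :: "trivial_hom \<Rightarrow> heavy \<Rightarrow> heavy \<Rightarrow> bool" where
  "trivial_hom_type Inclusion s t \<longleftrightarrow>
     s = t \<or> (s, t) \<in> {(O_inf, U_inf), (O_inf, Sp_inf), (U_inf, Sp_inf)}"
| "trivial_hom_type Conjugation s t \<longleftrightarrow> (s, t) = (U_inf, U_inf)"
| "trivial_hom_type Realification s t \<longleftrightarrow> (s, t) \<in> {(U_inf, O_inf), (Sp_inf, O_inf)}"
| "trivial_hom_type Complexification s t \<longleftrightarrow> (s, t) = (Sp_inf, U_inf)"

text \<open>Each matrix entry of the argument is replaced by a block of size \<open>block_dim \<tau> s\<close>.\<close>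

fun block_dim :: "trivial_hom \<Rightarrow> heavy \<Rightarrow> nat" where
  "block_dim Inclusion s = 1"
| "block_dim Conjugation s = 1"
| "block_dim Realification s = (if s = Sp_inf then 4 else 2)"
| "block_dim Complexification s = 2"

text \<open>
  Realification sends \<open>q\<close> to the real matrix of the left multiplication by \<open>q\<close> in the basis
  \<open>1, i\<close> or \<open>1, i, j, k\<close>; complexification sends \<open>a + b j\<close> to the matrix with rows
  \<open>(a, b)\<close> and \<open>(- cnj b, cnj a)\<close>.
\<close>

fun block_entry :: "trivial_hom \<Rightarrow> quat \<Rightarrow> nat \<Rightarrow> nat \<Rightarrow> quat" where
  "block_entry Inclusion q r s = q"
| "block_entry Conjugation q r s = quat_of_complex (cnj (qfst q))"
| "block_entry Realification q r s = of_real (qcoord r (q * qbasis s))"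
| "block_entry Complexification q r s = quat_of_complex
     ([[qfst q, qsnd q], [- cnj (qsnd q), cnj (qfst q)]] ! r ! s)"

text \<open>
  The block diagonal matrix \<open>diag (1\<^sub>a, \<tau>\<^sub>1 (g\<^bsub>m 1\<^esub>), \<dots>, \<tau>\<^sub>N (g\<^bsub>m N\<^esub>))\<close>, for the list of pairs
  \<open>(\<tau>\<^sub>j, m\<^sub>j)\<close>.  Its basis consists of the \<open>Inl k\<close> with \<open>k < a\<close> and of the
  \<open>Inr (j, n, r)\<close>, where \<open>j\<close> is the number of the block, \<open>n\<close> a basis index
  of \<open>L\<^bsub>m j\<^esub>\<close> and \<open>r\<close> an index inside the blocks of \<open>\<tau>\<^sub>j\<close>.
\<close>

definition straight_index ::
    "heavy list \<Rightarrow> enat \<Rightarrow> (trivial_hom \<times> nat) list \<Rightarrow> (nat + nat \<times> nat \<times> nat) set"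
  where "straight_index Ls a \<tau>s = {Inl k | k. enat k < a} \<union>
           {Inr (j, n, r) | j n r.
              j < length \<tau>s \<and> r < block_dim (fst (\<tau>s ! j)) (Ls ! snd (\<tau>s ! j))}"

fun straight_diag ::
    "(trivial_hom \<times> nat) list \<Rightarrow> (nat \<Rightarrow> nat qmat) \<Rightarrow> (nat + nat \<times> nat \<times> nat) qmat" where
  "straight_diag \<tau>s g (Inl k) (Inl k') = id_mat k k'"
| "straight_diag \<tau>s g (Inr (j, n, r)) (Inr (j', n', r')) =
     (if j = j' then block_entry (fst (\<tau>s ! j)) (g (snd (\<tau>s ! j)) n n') r r' else 0)"
| "straight_diag \<tau>s g _ _ = 0"

text \<open>
  Straightness of a homomorphism into an irreducible heavy group of kind \<open>t\<close>; the
  bijection \<open>e\<close> identifies the basis of \<open>\<ell>\<^sub>2\<close> with the union of the bases of the blocks.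
\<close>

definition straight_irr :: "heavy list \<Rightarrow> heavy \<Rightarrow> ((nat \<Rightarrow> nat qmat) \<Rightarrow> nat qmat) \<Rightarrow> bool"
  where "straight_irr Ls t f \<longleftrightarrow> f \<in> hom (heavy_group Ls) (heavy_irr t) \<and>
     (\<exists>a \<tau>s e. \<tau>s \<noteq> [] \<and>
        (\<forall>(\<tau>, m) \<in> set \<tau>s. m < length Ls \<and> trivial_hom_type \<tau> (Ls ! m) t) \<and>
        bij_betw e UNIV (straight_index Ls a \<tau>s) \<and>
        (\<forall>g \<in> carrier (heavy_group Ls). \<forall>i j. f g i j = straight_diag \<tau>s g (e i) (e j)))"

definition straight_hom ::
    "heavy list \<Rightarrow> 'k set \<Rightarrow> ('k \<Rightarrow> heavy) \<Rightarrow> ((nat \<Rightarrow> nat qmat) \<Rightarrow> 'k \<Rightarrow> nat qmat) \<Rightarrow> bool"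
  where "straight_hom Ls I Ks F \<longleftrightarrow>
     F \<in> hom (heavy_group Ls) (product_group I (\<lambda>c. heavy_irr (Ks c))) \<and>
     (\<forall>c \<in> I. straight_irr Ls (Ks c) (\<lambda>g. F g c))"


section \<open>Maximal heavy subgroups\<close>

fun heavy_factors :: "classical \<Rightarrow> heavy list" where
  "heavy_factors GL_R = [O_inf]"
| "heavy_factors GL_C = [U_inf]"
| "heavy_factors GL_H = [Sp_inf]"
| "heavy_factors U_inf_inf = [U_inf, U_inf]"
| "heavy_factors Sp_R = [U_inf]"
| "heavy_factors Sp_C = [Sp_inf]"
| "heavy_factors Sp_inf_inf = [Sp_inf, Sp_inf]"
| "heavy_factors O_inf_inf = [O_inf, O_inf]"
| "heavy_factors O_C = [O_inf]"
| "heavy_factors SO_star = [U_inf]"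
| "heavy_factors (U_fin p) = [U_inf]"
| "heavy_factors (O_fin p) = [O_inf]"
| "heavy_factors (Sp_fin p) = [Sp_inf]"

fun block_mat :: "nat qmat \<Rightarrow> nat qmat \<Rightarrow> (nat + nat) qmat" where
  "block_mat x y (Inl m) (Inl n) = x m n"
| "block_mat x y (Inr m) (Inr n) = y m n"
| "block_mat x y _ _ = 0"

fun double_index :: "nat + nat \<Rightarrow> nat \<times> nat" where
  "double_index (Inl n) = (n, 0)"
| "double_index (Inr n) = (n, 1)"

definition doubled_mat :: "trivial_hom \<Rightarrow> nat qmat \<Rightarrow> (nat + nat) qmat"
  where "doubled_mat \<tau> x i j = (let (m, r) = double_index i; (n, s) = double_index j
           in block_entry \<tau> (x m n) r s)"

text \<open>
  The embedding of the maximal heavy subgroup into an irreducible classical group; the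
  argument is the family of its one or two components.  \<open>U(\<infinity>)\<close> and \<open>Sp(\<infinity>)\<close> are contained
  in \<open>Sp(2\<infinity>,R)\<close> and \<open>Sp(2\<infinity>,C)\<close> as 2 by 2 block matrices.
\<close>

fun heavy_embed_irr :: "classical \<Rightarrow> (nat \<Rightarrow> nat qmat) \<Rightarrow> (nat + nat) qmat" where
  "heavy_embed_irr U_inf_inf k = block_mat (k 0) (k 1)"
| "heavy_embed_irr Sp_inf_inf k = block_mat (k 0) (k 1)"
| "heavy_embed_irr O_inf_inf k = block_mat (k 0) (k 1)"
| "heavy_embed_irr Sp_R k = doubled_mat Realification (k 0)"
| "heavy_embed_irr Sp_C k = doubled_mat Complexification (k 0)"
| "heavy_embed_irr _ k = block_mat (k 0) id_mat"

text \<open>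
  The factors of the maximal heavy subgroup \<open>K\<close> of a product of irreducible classical groups
  are indexed by pairs \<open>(i, c)\<close>: the \<open>c\<close>-th factor of the maximal heavy subgroup of \<open>G\<^sub>i\<close>.
\<close>

definition max_heavy_index :: "classical list \<Rightarrow> (nat \<times> nat) set"
  where "max_heavy_index Gs = {(i, c). i < length Gs \<and> c < length (heavy_factors (Gs ! i))}"

definition max_heavy_kind :: "classical list \<Rightarrow> nat \<times> nat \<Rightarrow> heavy"
  where "max_heavy_kind Gs = (\<lambda>(i, c). heavy_factors (Gs ! i) ! c)"

definition heavy_embed ::
    "classical list \<Rightarrow> (nat \<times> nat \<Rightarrow> nat qmat) \<Rightarrow> nat \<Rightarrow> (nat + nat) qmat"
  where "heavy_embed Gs k = (\<lambda>i\<in>{..<length Gs}. heavy_embed_irr (Gs ! i) (\<lambda>c. k (i, c)))"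


section \<open>Pairs and double cosets\<close>

text \<open>\<open>F\<close> is the straight embedding of \<open>L\<close> into the maximal heavy subgroup of \<open>G\<close>.\<close>

definition GL_pair ::
    "classical list \<Rightarrow> heavy list \<Rightarrow> ((nat \<Rightarrow> nat qmat) \<Rightarrow> nat \<times> nat \<Rightarrow> nat qmat) \<Rightarrow> bool"
  where "GL_pair Gs Ls F \<longleftrightarrow>
     straight_hom Ls (max_heavy_index Gs) (max_heavy_kind Gs) F \<and>
     inj_on F (carrier (heavy_group Ls))"

text \<open>Multi-indices are functions \<^typ>\<open>nat \<Rightarrow> nat\<close>, of which only the values at \<open>j < p\<close> matter.\<close>

definition stabilizer :: "heavy list \<Rightarrow> (nat \<Rightarrow> nat) \<Rightarrow> (nat \<Rightarrow> nat qmat) set"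
  where "stabilizer Ls \<alpha> = {l \<in> carrier (heavy_group Ls).
           \<forall>j < length Ls. \<forall>k < \<alpha> j. \<forall>i. l j i k = id_mat i k}"

definition swap_index :: "nat \<Rightarrow> nat \<Rightarrow> nat \<Rightarrow> nat"
  where "swap_index a m i = (if a \<le> i \<and> i < a + m then i + m
           else if a + m \<le> i \<and> i < a + 2 * m then i - m else i)"

definition Theta :: "heavy list \<Rightarrow> (nat \<Rightarrow> nat) \<Rightarrow> (nat \<Rightarrow> nat) \<Rightarrow> nat \<Rightarrow> nat qmat"
  where "Theta Ls \<beta> m = (\<lambda>j\<in>{..<length Ls}. \<lambda>i k. id_mat i (swap_index (\<beta> j) (m j) k))"

context
  fixes Gs :: "classical list" and Ls :: "heavy list"
    and F :: "(nat \<Rightarrow> nat qmat) \<Rightarrow> nat \<times> nat \<Rightarrow> nat qmat"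
begin

definition L_embed :: "(nat \<Rightarrow> nat qmat) \<Rightarrow> nat \<Rightarrow> (nat + nat) qmat"
  where "L_embed l = heavy_embed Gs (F l)"

definition dcoset ::
    "(nat \<Rightarrow> nat) \<Rightarrow> (nat \<Rightarrow> (nat + nat) qmat) \<Rightarrow> (nat \<Rightarrow> nat) \<Rightarrow> (nat \<Rightarrow> (nat + nat) qmat) set"
  where "dcoset \<gamma> g \<alpha> =
     (L_embed ` stabilizer Ls \<gamma>) <#>\<^bsub>classical_group Gs\<^esub> {g}
        <#>\<^bsub>classical_group Gs\<^esub> (L_embed ` stabilizer Ls \<alpha>)"

definition dcosets :: "(nat \<Rightarrow> nat) \<Rightarrow> (nat \<Rightarrow> nat) \<Rightarrow> (nat \<Rightarrow> (nat + nat) qmat) set set"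
  where "dcosets \<gamma> \<alpha> = {dcoset \<gamma> g \<alpha> | g. g \<in> carrier (classical_group Gs)}"

text \<open>The double coset \<open>L\<^sup>\<gamma> g \<Theta> h L\<^sup>\<alpha>\<close>, where \<open>\<Theta>\<close> depends on \<open>\<beta>\<close> and on the multi-index \<open>m\<close>.\<close>

definition Theta_dcoset ::
    "(nat \<Rightarrow> nat) \<Rightarrow> (nat \<Rightarrow> nat) \<Rightarrow> (nat \<Rightarrow> nat) \<Rightarrow> (nat \<Rightarrow> nat) \<Rightarrow>
     (nat \<Rightarrow> (nat + nat) qmat) \<Rightarrow> (nat \<Rightarrow> (nat + nat) qmat) \<Rightarrow> (nat \<Rightarrow> (nat + nat) qmat) set"
  where "Theta_dcoset \<gamma> \<beta> \<alpha> m g h =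
     dcoset \<gamma> (g \<otimes>\<^bsub>classical_group Gs\<^esub> L_embed (Theta Ls \<beta> m) \<otimes>\<^bsub>classical_group Gs\<^esub> h) \<alpha>"

definition eventual_dcoset ::
    "(nat \<Rightarrow> nat) \<Rightarrow> (nat \<Rightarrow> nat) \<Rightarrow> (nat \<Rightarrow> nat) \<Rightarrow>
     (nat \<Rightarrow> (nat + nat) qmat) \<Rightarrow> (nat \<Rightarrow> (nat + nat) qmat) \<Rightarrow> (nat \<Rightarrow> (nat + nat) qmat) set \<Rightarrow> bool"
  where "eventual_dcoset \<gamma> \<beta> \<alpha> g h D \<longleftrightarrow>
     (\<exists>M. \<forall>m. (\<forall>j < length Ls. M \<le> m j) \<longrightarrow> Theta_dcoset \<gamma> \<beta> \<alpha> m g h = D)"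

definition dcoset_mult ::
    "(nat \<Rightarrow> nat) \<Rightarrow> (nat \<Rightarrow> nat) \<Rightarrow> (nat \<Rightarrow> nat) \<Rightarrow> (nat \<Rightarrow> (nat + nat) qmat) set \<Rightarrow>
     (nat \<Rightarrow> (nat + nat) qmat) set \<Rightarrow> (nat \<Rightarrow> (nat + nat) qmat) set"
  where "dcoset_mult \<gamma> \<beta> \<alpha> \<gg> \<hh> =
     (THE D. \<forall>g \<in> \<gg>. \<forall>h \<in> \<hh>. eventual_dcoset \<gamma> \<beta> \<alpha> g h D)"

end


section \<open>Unitary representations\<close>

text \<open>Complex Hilbert spaces; the inner product is linear in the second argument.\<close>

class complex_hilbert_space = banach +
  fixes scaleC :: "complex \<Rightarrow> 'a \<Rightarrow> 'a"
    and cinner :: "'a \<Rightarrow> 'a \<Rightarrow> complex"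
  assumes scaleC_add_right: "scaleC a (x + y) = scaleC a x + scaleC a y"
    and scaleC_add_left: "scaleC (a + b) x = scaleC a x + scaleC b x"
    and scaleC_scaleC: "scaleC a (scaleC b x) = scaleC (a * b) x"
    and scaleC_of_real: "scaleC (complex_of_real r) x = scaleR r x"
    and cinner_commute: "cinner x y = cnj (cinner y x)"
    and cinner_add_right: "cinner x (y + z) = cinner x y + cinner x z"
    and cinner_scaleC_right: "cinner x (scaleC a y) = a * cinner x y"
    and cinner_self: "cinner x x = complex_of_real ((norm x)\<^sup>2)"

instantiation complex :: complex_hilbert_space
begin
definition "scaleC a x = a * x" for a x :: complex
definition "cinner x y = cnj x * y" for x y :: complex
instance
  by standard
     (simp_all add: scaleC_complex_def cinner_complex_def algebra_simps scaleR_conv_of_real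
        complex_norm_square del: of_real_power)
end

definition unitary_operator :: "('h::complex_hilbert_space \<Rightarrow> 'h) \<Rightarrow> bool"
  where "unitary_operator U \<longleftrightarrow>
     (\<forall>x y. U (x + y) = U x + U y) \<and> (\<forall>a x. U (scaleC a x) = scaleC a (U x)) \<and>
     (\<forall>x y. cinner (U x) (U y) = cinner x y) \<and> surj U"

definition unitary_group :: "('h::complex_hilbert_space \<Rightarrow> 'h) monoid"
  where "unitary_group = \<lparr>carrier = {U. unitary_operator U}, monoid.mult = (\<circ>), one = id\<rparr>"

definition orthogonal_projection :: "'h::complex_hilbert_space set \<Rightarrow> 'h \<Rightarrow> 'h"
  where "orthogonal_projection S v = (THE w. w \<in> S \<and> (\<forall>s \<in> S. cinner s (v - w) = 0))"

context
  fixes Gs :: "classical list" and Ls :: "heavy list"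
    and F :: "(nat \<Rightarrow> nat qmat) \<Rightarrow> nat \<times> nat \<Rightarrow> nat qmat"
    and \<rho> :: "(nat \<Rightarrow> (nat + nat) qmat) \<Rightarrow> 'h::complex_hilbert_space \<Rightarrow> 'h"
begin

definition unitary_rep :: bool
  where "unitary_rep \<longleftrightarrow> \<rho> \<in> hom (classical_group Gs) unitary_group \<and>
     (\<forall>v. continuous_map (heavy_topology Ls) euclidean (\<lambda>l. \<rho> (L_embed Gs F l) v))"

definition fixed_space :: "(nat \<Rightarrow> nat) \<Rightarrow> 'h set"
  where "fixed_space \<alpha> = {v. \<forall>l \<in> stabilizer Ls \<alpha>. \<rho> (L_embed Gs F l) v = v}"

definition rho_bar_elt :: "(nat \<Rightarrow> nat) \<Rightarrow> (nat \<Rightarrow> nat) \<Rightarrow> (nat \<Rightarrow> (nat + nat) qmat) \<Rightarrow> 'h \<Rightarrow> 'h"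
  where "rho_bar_elt \<alpha> \<beta> g =
     (\<lambda>v\<in>fixed_space \<alpha>. orthogonal_projection (fixed_space \<beta>) (\<rho> g v))"

definition rho_bar ::
    "(nat \<Rightarrow> nat) \<Rightarrow> (nat \<Rightarrow> nat) \<Rightarrow> (nat \<Rightarrow> (nat + nat) qmat) set \<Rightarrow> 'h \<Rightarrow> 'h"
  where "rho_bar \<alpha> \<beta> \<gg> = rho_bar_elt \<alpha> \<beta> (SOME g. g \<in> \<gg>)"

end

end

theory Submission
  imports Defs
begin

text \<open>
  The proof rests on two facts.  First, an element \<open>g\<close> of \<open>G\<close> is a finite matrix, and by
  straightness an element of \<open>L\<close> that fixes the first \<open>N\<close> basis vectors moves only far basis
  vectors of \<open>G\<close>.  Hence for large \<open>N\<close> the group \<open>L\<^sup>N\<close> commutes with \<open>g\<close> (\<open>St_commute\<close>).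
  Secondly, \<open>\<Theta>\<^sub>m\<close> shifts everything in \<open>L\<^sup>\<beta>\<close> far away: for \<open>b \<in> L\<^sup>\<beta>\<close> and large \<open>m\<close> one has
  \<open>\<Theta>\<^sub>m b \<Theta>\<^sub>m \<in> L\<^sup>N\<close> (\<open>Theta_conj_stabilizer\<close>), and the double coset \<open>L\<^sup>N \<Theta>\<^sub>m L\<^sup>N\<close> does not depend on
  \<open>m \<ge> N\<close> if \<open>N \<ge> \<beta>\<close> (\<open>Theta_shift\<close>).

  For the multiplication of double cosets, write \<open>\<Theta>\<^sub>n = s \<Theta>\<^sub>m t\<close> with \<open>s, t \<in> L\<^sup>N\<close>; then
  \<open>g \<Theta>\<^sub>n h = s (g \<Theta>\<^sub>m h) t\<close>, so the double coset is eventually constant.  Another representative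
  \<open>g b\<close> gives \<open>g b \<Theta>\<^sub>m h = g \<Theta>\<^sub>m h (\<Theta>\<^sub>m b \<Theta>\<^sub>m)\<close>, which is in the same double coset.

  For the representations, let \<open>u\<close> and \<open>w\<close> be fixed by \<open>L\<^sup>N\<close>.  Then \<open>\<langle>w, \<rho>(\<Theta>\<^sub>m) u\<rangle>\<close> does not
  depend on \<open>m \<ge> N\<close>, and it equals \<open>\<langle>w, P\<^sup>\<beta> u\<rangle>\<close> (\<open>Theta_coefficient\<close>).  Since \<open>\<Theta>\<^sub>m\<close> fixes
  \<open>P\<^sup>\<beta> u\<close>, it is enough to see that it vanishes if \<open>u\<close> is orthogonal to \<open>H\<^sup>\<beta>\<close>.  For a sparse
  sequence of \<open>m\<close> the vectors \<open>\<rho>(\<Theta>\<^sub>m) u\<close> have equal norms and equal pairwise inner products;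
  hence their averages converge.  The limit is fixed by \<open>L\<^sup>\<beta>\<close> and orthogonal to \<open>H\<^sup>\<beta>\<close>, so it is
  zero, whereas its inner product with \<open>w\<close> is \<open>\<langle>w, \<rho>(\<Theta>\<^sub>m) u\<rangle>\<close>.  Applying this to \<open>u = \<rho>(h) v\<close> and
  \<open>w = \<rho>(g)\<inverse> s\<close>, both of which are fixed by some \<open>L\<^sup>N\<close>, gives the multiplicativity.
\<close>

section \<open>Row-finite and finite matrices\<close>

definition row_finite :: "'i qmat \<Rightarrow> bool"
  where "row_finite g \<longleftrightarrow> (\<forall>i. finite {k. g i k \<noteq> 0})"

lemma mat_mul_eq_sum:
  assumes "finite S" "{k. g i k \<noteq> 0} \<subseteq> S"
  shows "mat_mul g h i j = (\<Sum>k\<in>S. g i k * h k j)"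
  unfolding mat_mul_def using assms by (intro sum.mono_neutral_left) auto

lemma row_finite_id [simp]: "row_finite id_mat"
  by (simp add: row_finite_def id_mat_def)

lemma mat_mul_nonzero:
  assumes "mat_mul g h i j \<noteq> 0"
  shows "\<exists>k. g i k \<noteq> 0 \<and> h k j \<noteq> 0"
proof (rule ccontr)
  assume "\<not> ?thesis"
  then have "mat_mul g h i j = 0"
    unfolding mat_mul_def by (intro sum.neutral) auto
  with assms show False
    by simp
qed

lemma row_finite_mul:
  assumes "row_finite g" "row_finite h"
  shows "row_finite (mat_mul g h)"
  unfolding row_finite_def
proof
  fix i
  have "{j. mat_mul g h i j \<noteq> 0} \<subseteq> (\<Union>k\<in>{k. g i k \<noteq> 0}. {j. h k j \<noteq> 0})"
    using mat_mul_nonzero by fast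
  moreover have "finite (\<Union>k\<in>{k. g i k \<noteq> 0}. {j. h k j \<noteq> 0})"
    using assms by (auto simp: row_finite_def)
  ultimately show "finite {j. mat_mul g h i j \<noteq> 0}"
    by (rule finite_subset)
qed

lemma mat_mul_assoc:
  assumes "row_finite g" "row_finite h"
  shows "mat_mul (mat_mul g h) k = mat_mul g (mat_mul h k)"
proof (intro ext)
  fix i j
  let ?S = "{p. g i p \<noteq> 0}"
  let ?T = "\<Union>p\<in>?S. {q. h p q \<noteq> 0}"
  have S: "finite ?S" and T: "finite ?T"
    using assms by (auto simp: row_finite_def)
  have sub: "{q. mat_mul g h i q \<noteq> 0} \<subseteq> ?T"
    using mat_mul_nonzero by fast
  have "mat_mul (mat_mul g h) k i j = (\<Sum>q\<in>?T. mat_mul g h i q * k q j)"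
    by (rule mat_mul_eq_sum[of ?T "mat_mul g h" i k j, OF T sub])
  also have "\<dots> = (\<Sum>q\<in>?T. \<Sum>p\<in>?S. g i p * h p q * k q j)"
    by (simp add: mat_mul_def sum_distrib_right)
  also have "\<dots> = (\<Sum>p\<in>?S. \<Sum>q\<in>?T. g i p * h p q * k q j)"
    by (rule sum.swap)
  also have "\<dots> = (\<Sum>p\<in>?S. g i p * mat_mul h k p j)"
  proof (rule sum.cong)
    fix p assume "p \<in> ?S"
    then have "mat_mul h k p j = (\<Sum>q\<in>?T. h p q * k q j)"
      using T by (intro mat_mul_eq_sum) auto
    then show "(\<Sum>q\<in>?T. g i p * h p q * k q j) = g i p * mat_mul h k p j"
      by (simp add: sum_distrib_left mult.assoc)
  qed simp
  also have "\<dots> = mat_mul g (mat_mul h k) i j"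
    by (simp add: mat_mul_def)
  finally show "mat_mul (mat_mul g h) k i j = mat_mul g (mat_mul h k) i j" .
qed

lemma mat_mul_id_left [simp]: "mat_mul id_mat g = g"
  by (intro ext) (simp add: mat_mul_def id_mat_def)

text \<open>
  Entry \<open>(i, j)\<close> of a product only sees those rows of the right factor that belong to the
  support of row \<open>i\<close> of the left one; column \<open>j\<close> of \<open>h\<close> need not be a basis vector elsewhere.
\<close>

lemma mat_mul_entry_col:
  assumes "row_finite g" "\<And>k. g i k \<noteq> 0 \<Longrightarrow> h k j = id_mat k j"
  shows "mat_mul g h i j = g i j"
proof -
  have "mat_mul g h i j = (\<Sum>k | g i k \<noteq> 0. if k = j then g i k else 0)"
    unfolding mat_mul_def using assms(2) by (intro sum.cong) (auto simp: id_mat_def)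
  also have "\<dots> = g i j"
    using assms(1) by (auto simp: row_finite_def)
  finally show ?thesis .
qed

lemma mat_mul_id_right: "row_finite g \<Longrightarrow> mat_mul g id_mat = g"
  by (intro ext mat_mul_entry_col) auto

lemma mat_mul_entry_row:
  assumes "\<And>k. g i k = id_mat i k"
  shows "mat_mul g h i j = h i j"
proof -
  have "mat_mul g h i j = mat_mul id_mat h i j"
    unfolding mat_mul_def using assms by simp
  then show ?thesis by simp
qed

lemma mat_mul_perm_right:
  assumes "row_finite g"
  shows "mat_mul g (\<lambda>i k. id_mat i (s k)) i k = g i (s k)"
proof -
  have "mat_mul g (\<lambda>i k. id_mat i (s k)) i k = mat_mul g id_mat i (s k)"
    by (simp add: mat_mul_def)
  then show ?thesis
    by (simp add: mat_mul_id_right assms)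
qed

lemma mat_mul_perm_left:
  assumes "\<And>k. s (s k) = k"
  shows "mat_mul (\<lambda>i k. id_mat i (s k)) h i j = h (s i) j"
proof -
  have row: "(\<lambda>k. id_mat i (s k)) = id_mat (s i)"
    using assms by (auto simp: id_mat_def fun_eq_iff)
  have "mat_mul (\<lambda>i k. id_mat i (s k)) h i j = mat_mul id_mat h (s i) j"
    unfolding mat_mul_def using fun_cong[OF row] by simp
  then show ?thesis
    by simp
qed

lemma finite_mat_iff:
  "finite_mat g \<longleftrightarrow> (\<exists>X. finite X \<and> (\<forall>i j. i \<notin> X \<or> j \<notin> X \<longrightarrow> g i j = id_mat i j))"
proof
  assume "finite_mat g"
  then have fin: "finite {(i, j). g i j \<noteq> id_mat i j}"
    by (simp add: finite_mat_def)
  let ?X = "fst ` {(i, j). g i j \<noteq> id_mat i j} \<union> snd ` {(i, j). g i j \<noteq> id_mat i j}"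
  have "finite ?X"
    using fin by blast
  moreover have "\<forall>i j. i \<notin> ?X \<or> j \<notin> ?X \<longrightarrow> g i j = id_mat i j"
    by force
  ultimately show "\<exists>X. finite X \<and> (\<forall>i j. i \<notin> X \<or> j \<notin> X \<longrightarrow> g i j = id_mat i j)"
    by blast
next
  assume "\<exists>X. finite X \<and> (\<forall>i j. i \<notin> X \<or> j \<notin> X \<longrightarrow> g i j = id_mat i j)"
  then obtain X where X: "finite X" "\<forall>i j. i \<notin> X \<or> j \<notin> X \<longrightarrow> g i j = id_mat i j"
    by blast
  then have "{(i, j). g i j \<noteq> id_mat i j} \<subseteq> X \<times> X"
    by auto
  then show "finite_mat g"
    unfolding finite_mat_def using X(1) finite_subset by blast
qed

lemma finite_mat_finite_row:
  assumes "finite_mat g"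
  shows "finite {k. g i k \<noteq> 0}" "finite {k. g k i \<noteq> 0}"
proof -
  obtain X where X: "finite X" "\<forall>i j. i \<notin> X \<or> j \<notin> X \<longrightarrow> g i j = id_mat i j"
    using assms by (auto simp: finite_mat_iff)
  have "{k. g i k \<noteq> 0} \<subseteq> insert i X" "{k. g k i \<noteq> 0} \<subseteq> insert i X"
    using X(2) by (auto simp: id_mat_def split: if_splits)
  then show "finite {k. g i k \<noteq> 0}" "finite {k. g k i \<noteq> 0}"
    using X(1) finite_subset by blast+
qed

lemma finite_mat_row_finite: "finite_mat g \<Longrightarrow> row_finite g"
  by (simp add: row_finite_def finite_mat_finite_row)

lemma finite_mat_mul:
  assumes "finite_mat g" "finite_mat h"
  shows "finite_mat (mat_mul g h)"
proof -
  obtain X Y where X: "finite X" "\<And>i j. i \<notin> X \<or> j \<notin> X \<Longrightarrow> g i j = id_mat i j"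
    and Y: "finite Y" "\<And>i j. i \<notin> Y \<or> j \<notin> Y \<Longrightarrow> h i j = id_mat i j"
    using assms unfolding finite_mat_iff by metis
  have "mat_mul g h i j = id_mat i j" if "i \<notin> X \<union> Y \<or> j \<notin> X \<union> Y" for i j
    using that mat_mul_entry_row[of g i h j] mat_mul_entry_col[of g i h j]
      X(2) Y(2) finite_mat_row_finite[OF assms(1)] by auto
  then show ?thesis
    unfolding finite_mat_iff using X(1) Y(1) by (intro exI[of _ "X \<union> Y"]) auto
qed

text \<open>
  Matrices that differ from the identity in disjoint sets of basis vectors commute: in either
  order the product has the rows of \<open>g\<close> in \<open>X\<close> and the rows of \<open>A\<close> outside \<open>X\<close>.
\<close>

lemma disjoint_mats_commute:
  assumes "row_finite A" "row_finite g"
    and g: "\<And>x y. x \<notin> X \<or> y \<notin> X \<Longrightarrow> g x y = id_mat x y"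
    and A: "\<And>x y. x \<in> X \<or> y \<in> X \<Longrightarrow> A x y = id_mat x y"
  shows "mat_mul A g = mat_mul g A"
proof (intro ext)
  fix x y
  show "mat_mul A g x y = mat_mul g A x y"
  proof (cases "x \<in> X")
    case True
    have "mat_mul A g x y = g x y"
      using True A by (intro mat_mul_entry_row) auto
    moreover have "mat_mul g A x y = g x y"
    proof (rule mat_mul_entry_col)
      show "A k y = id_mat k y" if "g x k \<noteq> 0" for k
        using that True A g[of x k] by (cases "k \<in> X") (auto simp: id_mat_def split: if_splits)
    qed fact
    ultimately show ?thesis by simp
  next
    case False
    have "mat_mul g A x y = A x y"
      using False g by (intro mat_mul_entry_row) auto
    moreover have "mat_mul A g x y = A x y"
    proof (rule mat_mul_entry_col)
      show "g k y = id_mat k y" if "A x k \<noteq> 0" for k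
        using that False g A[of x k] by (cases "k \<in> X") (auto simp: id_mat_def split: if_splits)
    qed fact
    ultimately show ?thesis by simp
  qed
qed


section \<open>Scalars and forms\<close>

lemma qcnj_sel [simp]: "qfst (qcnj q) = cnj (qfst q)" "qsnd (qcnj q) = - qsnd q"
  by (simp_all add: qcnj_def)

lemma qcnj_mult: "qcnj (p * q) = qcnj q * qcnj p"
  by (simp add: quat_eq_iff algebra_simps)

lemma qcnj_simps [simp]: "qcnj 0 = 0" "qcnj 1 = 1" "qcnj (p + q) = qcnj p + qcnj q"
  "qcnj (qcnj q) = q" "qcnj (- q) = - qcnj q"
  by (simp_all add: quat_eq_iff)

lemma quat_of_complex_sel [simp]: "qfst (quat_of_complex z) = z" "qsnd (quat_of_complex z) = 0"
  by (simp_all add: quat_of_complex_def)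

lemma quat_complex_iff: "q \<in> range quat_of_complex \<longleftrightarrow> qsnd q = 0"
  by (auto simp: image_iff quat_eq_iff)

lemma quat_real_iff: "q \<in> \<real> \<longleftrightarrow> qsnd q = 0 \<and> Im (qfst q) = 0"
proof
  assume "qsnd q = 0 \<and> Im (qfst q) = 0"
  then have "q = of_real (Re (qfst q))"
    by (simp add: quat_eq_iff complex_eq_iff)
  then show "q \<in> \<real>"
    by (metis Reals_of_real)
qed (auto simp: Reals_def)

lemma scalars_closed [simp]:
  "0 \<in> scalars t" "1 \<in> scalars t"
  "p \<in> scalars t \<Longrightarrow> q \<in> scalars t \<Longrightarrow> p + q \<in> scalars t"
  "p \<in> scalars t \<Longrightarrow> q \<in> scalars t \<Longrightarrow> p * q \<in> scalars t"
  "p \<in> scalars t \<Longrightarrow> qcnj p \<in> scalars t"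
  by (cases t; simp add: quat_complex_iff quat_real_iff)+

lemma scalars_sum: "(\<And>k. k \<in> S \<Longrightarrow> f k \<in> scalars t) \<Longrightarrow> sum f S \<in> scalars t"
  by (induction S rule: infinite_finite_induct) auto

lemma id_mat_scalars [simp]: "id_mat i j \<in> scalars t"
  by (simp add: id_mat_def)

lemma mat_mul_scalars:
  "(\<And>i j. g i j \<in> scalars t) \<Longrightarrow> (\<And>i j. h i j \<in> scalars t) \<Longrightarrow> mat_mul g h i j \<in> scalars t"
  unfolding mat_mul_def by (intro scalars_sum) auto

text \<open>
  Transpose and adjoint are treated together, as \<open>star_mat \<phi>\<close> for an additive \<open>\<phi>\<close> that
  reverses the products of the scalars in question.
\<close>

definition star_mat :: "(quat \<Rightarrow> quat) \<Rightarrow> 'i qmat \<Rightarrow> 'i qmat"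
  where "star_mat \<phi> g i j = \<phi> (g j i)"

definition anti_automorphism :: "heavy \<Rightarrow> (quat \<Rightarrow> quat) \<Rightarrow> bool"
  where "anti_automorphism t \<phi> \<longleftrightarrow> \<phi> 0 = 0 \<and> \<phi> 1 = 1 \<and> (\<forall>p q. \<phi> (p + q) = \<phi> p + \<phi> q) \<and>
     (\<forall>p\<in>scalars t. \<forall>q\<in>scalars t. \<phi> (p * q) = \<phi> q * \<phi> p)"

lemma anti_automorphism_qcnj: "anti_automorphism t qcnj"
  by (simp add: anti_automorphism_def qcnj_mult)

lemma anti_automorphism_id: "t \<noteq> Sp_inf \<Longrightarrow> anti_automorphism t (\<lambda>q. q)"
  by (cases t) (auto simp: anti_automorphism_def quat_eq_iff quat_complex_iff quat_real_iff)

lemma adjoint_star: "mat_adjoint = star_mat qcnj"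
  by (intro ext) (simp add: mat_adjoint_def star_mat_def)

lemma transpose_star: "mat_transpose = star_mat (\<lambda>q. q)"
  by (intro ext) (simp add: mat_transpose_def star_mat_def)

lemma star_mat_id: "anti_automorphism t \<phi> \<Longrightarrow> star_mat \<phi> id_mat = id_mat"
  by (intro ext) (auto simp: anti_automorphism_def star_mat_def id_mat_def)

lemma row_finite_star:
  assumes "anti_automorphism t \<phi>" "finite_mat g"
  shows "row_finite (star_mat \<phi> g)"
  unfolding row_finite_def
proof
  fix i
  have "\<phi> 0 = 0"
    using assms(1) unfolding anti_automorphism_def by blast
  then have "{k. star_mat \<phi> g i k \<noteq> 0} \<subseteq> {k. g k i \<noteq> 0}"
    unfolding star_mat_def by auto
  then show "finite {k. star_mat \<phi> g i k \<noteq> 0}"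
    using finite_mat_finite_row(2)[OF assms(2)] by (rule finite_subset)
qed

lemma star_mat_mul:
  assumes \<phi>: "anti_automorphism t \<phi>"
    and g: "finite_mat g" "\<And>i j. g i j \<in> scalars t"
    and h: "finite_mat h" "\<And>i j. h i j \<in> scalars t"
  shows "star_mat \<phi> (mat_mul g h) = mat_mul (star_mat \<phi> h) (star_mat \<phi> g)"
proof (intro ext)
  fix i j
  let ?S = "{k. g j k \<noteq> 0} \<union> {k. h k i \<noteq> 0}"
  have S: "finite ?S"
    by (simp add: finite_mat_finite_row g(1) h(1))
  have \<phi>0: "\<phi> 0 = 0" and \<phi>_add: "\<And>p q. \<phi> (p + q) = \<phi> p + \<phi> q"
    and \<phi>_mult: "\<And>p q. p \<in> scalars t \<Longrightarrow> q \<in> scalars t \<Longrightarrow> \<phi> (p * q) = \<phi> q * \<phi> p"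
    using \<phi> unfolding anti_automorphism_def by blast+
  have \<phi>_sum: "\<phi> (sum f A) = (\<Sum>k\<in>A. \<phi> (f k))" for f and A :: "'a set"
    by (induction A rule: infinite_finite_induct) (simp_all add: \<phi>0 \<phi>_add)
  have "star_mat \<phi> (mat_mul g h) i j = \<phi> (\<Sum>k\<in>?S. g j k * h k i)"
    unfolding star_mat_def using mat_mul_eq_sum[OF S, of g j h i] by auto
  also have "\<dots> = (\<Sum>k\<in>?S. \<phi> (h k i) * \<phi> (g j k))"
    unfolding \<phi>_sum by (intro sum.cong \<phi>_mult g(2) h(2) refl)
  also have "\<dots> = mat_mul (star_mat \<phi> h) (star_mat \<phi> g) i j"
  proof -
    have "{k. star_mat \<phi> h i k \<noteq> 0} \<subseteq> ?S"
      using \<phi>0 unfolding star_mat_def by auto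
    then show ?thesis
      using mat_mul_eq_sum[OF S, of "star_mat \<phi> h" i "star_mat \<phi> g" j] by (simp add: star_mat_def)
  qed
  finally show "star_mat \<phi> (mat_mul g h) i j = mat_mul (star_mat \<phi> h) (star_mat \<phi> g) i j" .
qed

definition pres_form :: "(quat \<Rightarrow> quat) \<Rightarrow> 'i qmat \<Rightarrow> 'i qmat \<Rightarrow> bool"
  where "pres_form \<phi> B g \<longleftrightarrow> mat_mul (mat_mul (star_mat \<phi> g) B) g = B"

lemma pres_bilinear_form: "pres_bilinear B g = pres_form (\<lambda>q. q) B g"
  by (simp add: pres_bilinear_def pres_form_def transpose_star)

lemma pres_sesquilinear_form: "pres_sesquilinear B g = pres_form qcnj B g"
  by (simp add: pres_sesquilinear_def pres_form_def adjoint_star)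


section \<open>The groups of matrices\<close>

lemma GL_matsD:
  assumes "g \<in> GL_mats A I"
  shows "finite_mat g" "row_finite g" "g i j \<in> A" "i \<notin> I \<or> j \<notin> I \<Longrightarrow> g i j = id_mat i j"
  using assms by (auto simp: GL_mats_def finite_mats_def intro: finite_mat_row_finite)

lemma finite_mats_mul:
  assumes "g \<in> finite_mats (scalars t) I" "h \<in> finite_mats (scalars t) I"
  shows "mat_mul g h \<in> finite_mats (scalars t) I"
proof -
  have g: "finite_mat g" "\<And>i j. g i j \<in> scalars t" "\<And>i j. i \<notin> I \<or> j \<notin> I \<Longrightarrow> g i j = id_mat i j"
    and h: "finite_mat h" "\<And>i j. h i j \<in> scalars t" "\<And>i j. i \<notin> I \<or> j \<notin> I \<Longrightarrow> h i j = id_mat i j"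
    using assms unfolding finite_mats_def by blast+
  have "mat_mul g h i j = id_mat i j" if "i \<notin> I" for i j
    using mat_mul_entry_row[of g i h j] g(3) h(3) that by metis
  moreover have "mat_mul g h i j = id_mat i j" if "j \<notin> I" for i j
    using mat_mul_entry_col[OF finite_mat_row_finite[OF g(1)], of i h j] g(3) h(3) that by metis
  moreover have "mat_mul g h i j \<in> scalars t" for i j
    by (intro mat_mul_scalars g(2) h(2))
  ultimately show ?thesis
    unfolding finite_mats_def using finite_mat_mul[OF g(1) h(1)] by blast
qed

lemma GL_mats_mul:
  assumes "g \<in> GL_mats (scalars t) I" "h \<in> GL_mats (scalars t) I"
  shows "mat_mul g h \<in> GL_mats (scalars t) I"
proof -
  have g: "g \<in> finite_mats (scalars t) I" and h: "h \<in> finite_mats (scalars t) I"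
    using assms unfolding GL_mats_def by blast+
  obtain g' where g': "g' \<in> finite_mats (scalars t) I" "mat_mul g g' = id_mat" "mat_mul g' g = id_mat"
    using assms(1) unfolding GL_mats_def by blast
  obtain h' where h': "h' \<in> finite_mats (scalars t) I" "mat_mul h h' = id_mat" "mat_mul h' h = id_mat"
    using assms(2) unfolding GL_mats_def by blast
  have fin: "row_finite g" "row_finite h" "row_finite g'" "row_finite h'"
    using g h g'(1) h'(1) by (simp_all add: finite_mats_def finite_mat_row_finite)
  have "mat_mul (mat_mul g h) (mat_mul h' g') = mat_mul g (mat_mul (mat_mul h h') g')"
    by (simp add: mat_mul_assoc fin row_finite_mul)
  then have 1: "mat_mul (mat_mul g h) (mat_mul h' g') = id_mat"
    by (simp add: g'(2) h'(2))
  have "mat_mul (mat_mul h' g') (mat_mul g h) = mat_mul h' (mat_mul (mat_mul g' g) h)"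
    by (simp add: mat_mul_assoc fin row_finite_mul)
  then have 2: "mat_mul (mat_mul h' g') (mat_mul g h) = id_mat"
    by (simp add: g'(3) h'(3))
  show ?thesis
    unfolding GL_mats_def
    using 1 2 finite_mats_mul[OF g h] finite_mats_mul[OF h'(1) g'(1)] by blast
qed

lemma id_mat_GL [simp]: "id_mat \<in> GL_mats (scalars t) I"
proof -
  have "id_mat \<in> finite_mats (scalars t) I"
    by (simp add: finite_mats_def finite_mat_def)
  then show ?thesis
    by (auto simp: GL_mats_def)
qed

lemma GL_mats_inverse:
  assumes "g \<in> GL_mats A I"
  obtains h where "h \<in> GL_mats A I" "mat_mul g h = id_mat" "mat_mul h g = id_mat"
  using assms by (auto simp: GL_mats_def)

definition form_group :: "heavy \<Rightarrow> 'i set \<Rightarrow> (quat \<Rightarrow> quat) \<Rightarrow> 'i qmat \<Rightarrow> 'i qmat set"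
  where "form_group t I \<phi> B = {g \<in> GL_mats (scalars t) I. pres_form \<phi> B g}"

lemma pres_form_mul:
  assumes \<phi>: "anti_automorphism t \<phi>" and B: "row_finite B"
    and g: "g \<in> GL_mats (scalars t) I" "pres_form \<phi> B g"
    and h: "h \<in> GL_mats (scalars t) I" 
  shows "pres_form \<phi> B (mat_mul g h) \<longleftrightarrow> pres_form \<phi> B h"
proof -
  have fin: "row_finite g" "row_finite h" "row_finite (star_mat \<phi> g)" "row_finite (star_mat \<phi> h)"
    using GL_matsD(1,2)[OF g(1)] GL_matsD(1,2)[OF h(1)] row_finite_star[OF \<phi>] by auto
  have "mat_mul (mat_mul (star_mat \<phi> (mat_mul g h)) B) (mat_mul g h) =
        mat_mul (mat_mul (mat_mul (star_mat \<phi> h) (star_mat \<phi> g)) B) (mat_mul g h)"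
    using GL_matsD[OF g(1)] GL_matsD[OF h(1)] by (simp add: star_mat_mul[OF \<phi>])
  also have "\<dots> = mat_mul (mat_mul (star_mat \<phi> h) (mat_mul (mat_mul (star_mat \<phi> g) B) g)) h"
    by (simp add: mat_mul_assoc fin B row_finite_mul)
  also have "\<dots> = mat_mul (mat_mul (star_mat \<phi> h) B) h"
    using g(2) by (simp add: pres_form_def)
  finally show ?thesis
    by (simp add: pres_form_def)
qed

lemma pres_form_id:
  "anti_automorphism t \<phi> \<Longrightarrow> row_finite B \<Longrightarrow> pres_form \<phi> B id_mat"
  by (simp add: pres_form_def star_mat_id mat_mul_id_right)

lemma group_form_group:
  assumes \<phi>: "anti_automorphism t \<phi>" and B: "row_finite B"
  shows "group (mat_group (form_group t I \<phi> B))"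
proof -
  let ?S = "form_group t I \<phi> B"
  have id: "id_mat \<in> ?S"
    using pres_form_id[OF assms] by (simp add: form_group_def)
  have mul: "mat_mul x y \<in> ?S" if "x \<in> ?S" "y \<in> ?S" for x y
    using that GL_mats_mul[of x t I y] pres_form_mul[OF \<phi> B, of x I y]
    unfolding form_group_def mem_Collect_eq by blast
  have inv: "\<exists>y\<in>?S. mat_mul y x = id_mat" if "x \<in> ?S" for x
  proof -
    have x: "x \<in> GL_mats (scalars t) I" "pres_form \<phi> B x"
      using that unfolding form_group_def by blast+
    obtain y where y: "y \<in> GL_mats (scalars t) I" "mat_mul x y = id_mat" "mat_mul y x = id_mat"
      using x(1) by (rule GL_mats_inverse)
    have "pres_form \<phi> B y"
      using pres_form_mul[OF \<phi> B x y(1)] pres_form_id[OF assms] y(2) by simp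
    then show ?thesis
      using y unfolding form_group_def by blast
  qed
  have assoc: "mat_mul (mat_mul x y) z = mat_mul x (mat_mul y z)" if "x \<in> ?S" "y \<in> ?S" for x y z
    using that GL_matsD(2)[of x "scalars t" I] GL_matsD(2)[of y "scalars t" I]
    unfolding form_group_def mem_Collect_eq by (blast intro: mat_mul_assoc)
  show ?thesis
    unfolding mat_group_def
    by (rule groupI; unfold monoid.simps partial_object.simps)
      (rule mul id assoc mat_mul_id_left inv; assumption?)+
qed

lemma heavy_irr_form_group: "heavy_irr t = mat_group (form_group t UNIV qcnj id_mat)"
proof -
  have "mat_mul (mat_mul (mat_adjoint g) id_mat) g = mat_mul (mat_adjoint g) g"
    if "g \<in> GL_mats (scalars t) UNIV" for g :: "nat qmat"
    using row_finite_star[OF anti_automorphism_qcnj GL_matsD(1)[OF that]]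
    by (simp add: mat_mul_id_right adjoint_star)
  then show ?thesis
    unfolding heavy_irr_def form_group_def pres_form_def adjoint_star[symmetric]
    by (intro arg_cong[of _ _ mat_group]) auto
qed

lemma group_heavy_irr: "group (heavy_irr t)"
  unfolding heavy_irr_form_group by (rule group_form_group[OF anti_automorphism_qcnj]) simp

lemma heavy_irrD:
  assumes "g \<in> carrier (heavy_irr t)"
  shows "finite_mat g" "row_finite g" "g i j \<in> scalars t" "mat_mul (mat_adjoint g) g = id_mat"
  using assms GL_matsD[of g "scalars t" UNIV] by (auto simp: heavy_irr_def mat_group_def)

lemma heavy_irr_one [simp]: "\<one>\<^bsub>heavy_irr t\<^esub> = id_mat"
  and heavy_irr_mult [simp]: "g \<otimes>\<^bsub>heavy_irr t\<^esub> h = mat_mul g h"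
  by (simp_all add: heavy_irr_def mat_group_def)

lemma classical_irr_one [simp]: "\<one>\<^bsub>classical_irr X\<^esub> = id_mat"
  and classical_irr_mult [simp]: "g \<otimes>\<^bsub>classical_irr X\<^esub> h = mat_mul g h"
  and classical_irr_carrier [simp]: "carrier (classical_irr X) = classical_mats X"
  by (simp_all add: classical_irr_def mat_group_def)

lemma row_finite_signature: "row_finite signature_mat"
  unfolding row_finite_def
proof
  fix i
  have "k = i" if "signature_mat i k \<noteq> 0" for k
    using that by (cases i; cases k) (auto simp: id_mat_def split: if_splits)
  then have "{k. signature_mat i k \<noteq> 0} \<subseteq> {i}"
    by blast
  then show "finite {k. signature_mat i k \<noteq> 0}"
    using finite_subset by blast
qed

lemma row_finite_symplectic: "row_finite symplectic_mat"
  unfolding row_finite_def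
proof
  fix i
  have "k = (case i of Inl m \<Rightarrow> Inr m | Inr m \<Rightarrow> Inl m)" if "symplectic_mat i k \<noteq> 0" for k
    using that by (cases i; cases k) (auto simp: id_mat_def split: if_splits)
  then have "{k. symplectic_mat i k \<noteq> 0} \<subseteq> {case i of Inl m \<Rightarrow> Inr m | Inr m \<Rightarrow> Inl m}"
    by blast
  then show "finite {k. symplectic_mat i k \<noteq> 0}"
    using finite_subset by blast
qed

text \<open>
  All classical groups are handled at once, the general linear groups as the groups that
  preserve the zero form.
\<close>

lemma classical_mats_form_group:
  "\<exists>t I \<phi> B. anti_automorphism t \<phi> \<and> row_finite B \<and> classical_mats X = form_group t I \<phi> B"
proof -
  let ?P = "\<lambda>S. \<exists>t I \<phi> (B :: (nat + nat) qmat).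
    anti_automorphism t \<phi> \<and> row_finite B \<and> S = form_group t I \<phi> B"
  have GL: "?P (GL_mats (scalars t) I)" for t I
  proof (intro exI conjI)
    show "anti_automorphism t qcnj" "row_finite (\<lambda>i j. 0)"
      by (simp_all add: anti_automorphism_qcnj row_finite_def)
    show "GL_mats (scalars t) I = form_group t I qcnj (\<lambda>i j. 0)"
      by (simp add: form_group_def pres_form_def mat_mul_def fun_eq_iff)
  qed
  have sesq: "?P {g \<in> GL_mats (scalars t) I. pres_sesquilinear B g}" if "row_finite B" for t I B
    unfolding form_group_def pres_sesquilinear_form
    using that anti_automorphism_qcnj[of t] by (intro exI[of _ t] exI[of _ I] exI[of _ qcnj] exI[of _ B]) simp
  have bil: "?P {g \<in> GL_mats (scalars t) I. pres_bilinear B g}"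
    if "row_finite B" "t \<noteq> Sp_inf" for t I B
    unfolding form_group_def pres_bilinear_form
    using that anti_automorphism_id[of t]
    by (intro exI[of _ t] exI[of _ I] exI[of _ "\<lambda>q. q"] exI[of _ B]) simp
  have i: "row_finite i_mat"
    by (simp add: row_finite_def i_mat_def)
  note B = i row_finite_id row_finite_signature row_finite_symplectic
  show ?thesis
    by (cases X; simp only: classical_mats.simps;
        intro GL sesq bil B; simp)
qed

lemma group_classical_irr: "group (classical_irr X)"
  unfolding classical_irr_def using classical_mats_form_group[of X] by (auto intro: group_form_group)

lemma group_classical_group: "group (classical_group Gs)"
  unfolding classical_group_def by (simp add: group_classical_irr)

lemma group_heavy_group: "group (heavy_group Ls)"
  unfolding heavy_group_def by (simp add: group_heavy_irr)

lemma classical_mats_finite: "g \<in> classical_mats X \<Longrightarrow> finite_mat g"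
  using classical_mats_form_group[of X] by (auto simp: form_group_def dest: GL_matsD(1))


section \<open>The maximal heavy subgroup of a classical group\<close>

lemma GL_mats_mono:
  assumes "A \<subseteq> B" "I \<subseteq> J"
  shows "GL_mats A I \<subseteq> GL_mats B J"
proof -
  have "finite_mats A I \<subseteq> finite_mats B J"
    using assms unfolding finite_mats_def by blast
  then show ?thesis
    unfolding GL_mats_def by blast
qed

lemma heavy_irr_adjointD:
  assumes "x \<in> carrier (heavy_irr t)"
  shows "x \<in> GL_mats (scalars t) UNIV" "mat_mul (star_mat qcnj x) x = id_mat"
    "row_finite (star_mat qcnj x)" "star_mat qcnj x i j \<in> scalars t"
  using assms heavy_irrD[OF assms] row_finite_star[OF anti_automorphism_qcnj]
  by (auto simp: heavy_irr_def mat_group_def adjoint_star[symmetric] mat_adjoint_def)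

definition scalar_mat :: "quat \<Rightarrow> 'i qmat"
  where "scalar_mat c i j = (if i = j then c else 0)"

lemma scalar_mat_one: "scalar_mat 1 = id_mat"
  by (intro ext) (simp add: scalar_mat_def id_mat_def)

lemma scalar_mat_mul: "mat_mul (scalar_mat c) g i j = c * g i j"
proof -
  have "mat_mul (scalar_mat c) g i j = (\<Sum>k\<in>{i}. scalar_mat c i k * g k j)"
    by (rule mat_mul_eq_sum) (auto simp: scalar_mat_def)
  then show ?thesis
    by (simp add: scalar_mat_def)
qed

lemma mul_scalar_mat:
  assumes "row_finite g"
  shows "mat_mul g (scalar_mat c) i j = g i j * c"
proof -
  have "mat_mul g (scalar_mat c) i j = (\<Sum>k | g i k \<noteq> 0. if k = j then g i j * c else 0)"
    unfolding mat_mul_def scalar_mat_def by (intro sum.cong) auto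
  also have "\<dots> = g i j * c"
    using assms by (auto simp: row_finite_def)
  finally show ?thesis .
qed

lemma row_finite_scalar: "row_finite (scalar_mat c)"
  by (simp add: row_finite_def scalar_mat_def)

text \<open>
  All nonzero invariant forms of the classical groups arise from scalar matrices, which is why
  unitary matrices preserve them.  The matrix \<open>y\<close> will be the adjoint of \<open>x\<close>.
\<close>

lemma unitary_pres_scalar:
  assumes y: "row_finite y" and yx: "mat_mul y x = id_mat" and comm: "\<And>i j. y i j * c = c * y i j"
  shows "mat_mul (mat_mul y (scalar_mat c)) x = scalar_mat c"
proof -
  have "mat_mul y (scalar_mat c) = mat_mul (scalar_mat c) y"
    by (intro ext) (simp add: mul_scalar_mat y scalar_mat_mul comm)
  then have "mat_mul (mat_mul y (scalar_mat c)) x = mat_mul (scalar_mat c) (mat_mul y x)"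
    by (simp add: mat_mul_assoc row_finite_scalar y)
  then show ?thesis
    by (simp add: yx mat_mul_id_right row_finite_scalar)
qed


subsection \<open>Two diagonal blocks\<close>

lemma block_mat_mul:
  "mat_mul (block_mat x y) (block_mat x' y') = block_mat (mat_mul x x') (mat_mul y y')"
proof (intro ext)
  fix i j :: "nat + nat"
  show "mat_mul (block_mat x y) (block_mat x' y') i j = block_mat (mat_mul x x') (mat_mul y y') i j"
  proof (cases i)
    case (Inl m)
    have *: "{k. block_mat x y (Inl m) k \<noteq> 0} = Inl ` {k. x m k \<noteq> 0}"
    proof -
      have "block_mat x y (Inl m) k \<noteq> 0 \<longleftrightarrow> k \<in> Inl ` {k. x m k \<noteq> 0}" for k
        by (cases k) auto
      then show ?thesis
        by blast
    qed
    show ?thesis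
      unfolding mat_mul_def Inl * by (cases j) (simp_all add: sum.reindex mat_mul_def)
  next
    case (Inr m)
    have *: "{k. block_mat x y (Inr m) k \<noteq> 0} = Inr ` {k. y m k \<noteq> 0}"
    proof -
      have "block_mat x y (Inr m) k \<noteq> 0 \<longleftrightarrow> k \<in> Inr ` {k. y m k \<noteq> 0}" for k
        by (cases k) auto
      then show ?thesis
        by blast
    qed
    show ?thesis
      unfolding mat_mul_def Inr * by (cases j) (simp_all add: sum.reindex mat_mul_def)
  qed
qed

lemma block_mat_id: "block_mat id_mat id_mat = id_mat"
proof (intro ext)
  show "block_mat id_mat id_mat i j = id_mat i j" for i j
    by (cases i; cases j) (auto simp: id_mat_def)
qed

lemma block_finite_mats:
  assumes "x \<in> finite_mats A UNIV" "y \<in> finite_mats A UNIV" "0 \<in> A"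
    and I: "range Inl \<subseteq> I" "y = id_mat \<or> range Inr \<subseteq> I"
  shows "block_mat x y \<in> finite_mats A I"
proof -
  obtain X where X: "finite X" "\<And>i j. i \<notin> X \<or> j \<notin> X \<Longrightarrow> x i j = id_mat i j"
    using assms(1) unfolding finite_mats_def finite_mat_iff by blast
  obtain Y where Y: "finite Y" "\<And>i j. i \<notin> Y \<or> j \<notin> Y \<Longrightarrow> y i j = id_mat i j"
    using assms(2) unfolding finite_mats_def finite_mat_iff by blast
  have "block_mat x y i j = id_mat i j" if "i \<notin> X <+> Y \<or> j \<notin> X <+> Y" for i j
    using that X(2) Y(2) by (cases i; cases j) (auto simp: id_mat_def)
  then have "finite_mat (block_mat x y)"
    unfolding finite_mat_iff using X(1) Y(1) by (intro exI[of _ "X <+> Y"]) auto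
  moreover have "block_mat x y i j \<in> A" for i j
    using assms(1-3) by (cases i; cases j) (auto simp: finite_mats_def)
  moreover have "block_mat x y i j = id_mat i j" if "i \<notin> I \<or> j \<notin> I" for i j
    using that I by (cases i; cases j) (auto simp: id_mat_def)
  ultimately show ?thesis
    unfolding finite_mats_def by blast
qed

lemma block_GL_mats:
  assumes "x \<in> GL_mats (scalars t) UNIV" "y \<in> GL_mats (scalars t) UNIV"
    and I: "range Inl \<subseteq> I" "y = id_mat \<or> range Inr \<subseteq> I"
  shows "block_mat x y \<in> GL_mats (scalars t) I"
proof -
  obtain x' where x': "x' \<in> finite_mats (scalars t) UNIV" "mat_mul x x' = id_mat" "mat_mul x' x = id_mat"
    using assms(1) unfolding GL_mats_def by blast
  obtain y' where y': "y' \<in> finite_mats (scalars t) UNIV" "mat_mul y y' = id_mat" "mat_mul y' y = id_mat"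
    using assms(2) unfolding GL_mats_def by blast
  have xy: "x \<in> finite_mats (scalars t) UNIV" "y \<in> finite_mats (scalars t) UNIV"
    using assms(1,2) unfolding GL_mats_def by blast+
  have "y' = id_mat \<or> range Inr \<subseteq> I"
    using I(2) y'(2) by auto
  then have "block_mat x' y' \<in> finite_mats (scalars t) I"
    using x'(1) y'(1) I(1) by (intro block_finite_mats) auto
  moreover have "block_mat x y \<in> finite_mats (scalars t) I"
    using xy I by (intro block_finite_mats) auto
  moreover have "mat_mul (block_mat x y) (block_mat x' y') = id_mat"
    "mat_mul (block_mat x' y') (block_mat x y) = id_mat"
    by (simp_all add: block_mat_mul block_mat_id x'(2,3) y'(2,3))
  ultimately show ?thesis
    unfolding GL_mats_def by blast
qed

lemma star_block_mat:
  assumes "\<phi> 0 = 0"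
  shows "star_mat \<phi> (block_mat x y) = block_mat (star_mat \<phi> x) (star_mat \<phi> y)"
proof (intro ext)
  show "star_mat \<phi> (block_mat x y) i j = block_mat (star_mat \<phi> x) (star_mat \<phi> y) i j" for i j
    by (cases i; cases j) (auto simp: star_mat_def assms)
qed

lemma signature_block: "signature_mat = block_mat (scalar_mat 1) (scalar_mat (-1))"
proof (intro ext)
  show "signature_mat i j = block_mat (scalar_mat 1) (scalar_mat (-1)) i j" for i j
    by (cases i; cases j) (auto simp: scalar_mat_def id_mat_def)
qed

lemma scalar_block: "(scalar_mat c :: (nat + nat) qmat) = block_mat (scalar_mat c) (scalar_mat c)"
proof (intro ext)
  show "scalar_mat c i j = block_mat (scalar_mat c) (scalar_mat c) i j" for i j
    by (cases i; cases j) (auto simp: scalar_mat_def)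
qed

lemma i_mat_scalar: "i_mat = scalar_mat (quat_of_complex \<i>)"
  by (intro ext) (simp add: i_mat_def scalar_mat_def)

lemma pres_form_block:
  assumes "\<phi> 0 = 0"
    and "row_finite (star_mat \<phi> x)" "mat_mul (star_mat \<phi> x) x = id_mat"
      "\<And>i j. star_mat \<phi> x i j * c = c * star_mat \<phi> x i j"
    and "row_finite (star_mat \<phi> y)" "mat_mul (star_mat \<phi> y) y = id_mat"
      "\<And>i j. star_mat \<phi> y i j * d = d * star_mat \<phi> y i j"
  shows "pres_form \<phi> (block_mat (scalar_mat c) (scalar_mat d)) (block_mat x y)"
  using assms by (simp add: pres_form_def star_block_mat block_mat_mul unitary_pres_scalar)


subsection \<open>Matrices with entries replaced by blocks of size two\<close>

definition doubling :: "trivial_hom \<Rightarrow> heavy \<Rightarrow> heavy \<Rightarrow> bool"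
  where "doubling \<tau> s t \<longleftrightarrow> (\<tau>, s, t) \<in> {(Realification, U_inf, O_inf), (Complexification, Sp_inf, U_inf)}"

lemma less_two_cases: "r < (2::nat) \<longleftrightarrow> r = 0 \<or> r = 1"
  by auto

lemma block_entry_one:
  assumes "trivial_hom_type \<tau> u t" "r < block_dim \<tau> u" "s < block_dim \<tau> u"
  shows "block_entry \<tau> 1 r s = (if r = s then 1 else 0)" "block_entry \<tau> 0 r s = 0"
  using assms
  by (cases \<tau>; auto simp: qcoord_def qbasis_def less_Suc_eq numeral_eq_Suc quat_eq_iff split: if_splits)+

lemma doubling_block_entry:
  assumes "doubling \<tau> u t" "r < 2" "s < 2" 
  shows "block_entry \<tau> (p + q) r s = block_entry \<tau> p r s + block_entry \<tau> q r s"
    "block_entry \<tau> 0 r s = 0" "block_entry \<tau> 1 r s = (if r = s then 1 else 0)"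
    "p \<in> scalars u \<Longrightarrow> block_entry \<tau> p r s \<in> scalars t"
    "p \<in> scalars u \<Longrightarrow> q \<in> scalars u \<Longrightarrow>
      block_entry \<tau> (p * q) r s = block_entry \<tau> p r 0 * block_entry \<tau> q 0 s + block_entry \<tau> p r 1 * block_entry \<tau> q 1 s"
  using assms 
  by (auto simp: doubling_def qcoord_def qbasis_def quat_complex_iff less_two_cases quat_eq_iff algebra_simps)

lemma double_index_less: "snd (double_index i) < 2"
  by (cases i) auto

lemma doubled_mat_eq:
  "doubled_mat \<tau> x i j = block_entry \<tau> (x (fst (double_index i)) (fst (double_index j)))
     (snd (double_index i)) (snd (double_index j))"
  by (simp add: doubled_mat_def split_def Let_def)

lemma doubled_mat_mul:
  assumes d: "doubling \<tau> u t" and x: "row_finite x" "\<And>i j. x i j \<in> scalars u"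
    and y: "\<And>i j. y i j \<in> scalars u"
  shows "mat_mul (doubled_mat \<tau> x) (doubled_mat \<tau> y) = doubled_mat \<tau> (mat_mul x y)"
proof (intro ext)
  fix i j
  obtain m r where i: "double_index i = (m, r)" "r < 2"
    using double_index_less[of i] by (cases "double_index i") auto
  obtain n s where j: "double_index j = (n, s)" "s < 2"
    using double_index_less[of j] by (cases "double_index j") auto
  let ?S = "{k. x m k \<noteq> 0}"
  have S: "finite ?S"
    using x(1) by (simp add: row_finite_def)
  note be = doubling_block_entry[OF d]
  have sub: "{k. doubled_mat \<tau> x i k \<noteq> 0} \<subseteq> ?S <+> ?S"
  proof
    fix k assume "k \<in> {k. doubled_mat \<tau> x i k \<noteq> 0}"
    then have "block_entry \<tau> (x m (fst (double_index k))) r (snd (double_index k)) \<noteq> 0"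
      by (simp add: doubled_mat_eq i(1))
    then have "x m (fst (double_index k)) \<noteq> 0"
      using be(2)[OF i(2) double_index_less] by metis
    then show "k \<in> ?S <+> ?S"
      by (cases k) auto
  qed
  have be_sum: "block_entry \<tau> (\<Sum>k\<in>A. f k) r s = (\<Sum>k\<in>A. block_entry \<tau> (f k) r s)" for f and A :: "nat set"
    by (induction A rule: infinite_finite_induct) (simp_all add: be(1,2) i(2) j(2))
  have "mat_mul (doubled_mat \<tau> x) (doubled_mat \<tau> y) i j =
      (\<Sum>k\<in>?S <+> ?S. doubled_mat \<tau> x i k * doubled_mat \<tau> y k j)"
    by (rule mat_mul_eq_sum[of "?S <+> ?S" "doubled_mat \<tau> x" i, OF _ sub]) (use S in auto)
  also have "\<dots> = (\<Sum>k\<in>?S. block_entry \<tau> (x m k) r 0 * block_entry \<tau> (y k n) 0 s +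
      block_entry \<tau> (x m k) r 1 * block_entry \<tau> (y k n) 1 s)"
    using S by (simp add: sum.Plus doubled_mat_eq i(1) j(1) sum.distrib)
  also have "\<dots> = (\<Sum>k\<in>?S. block_entry \<tau> (x m k * y k n) r s)"
    by (simp add: be(5)[OF i(2) j(2) x(2) y])
  also have "\<dots> = doubled_mat \<tau> (mat_mul x y) i j"
    by (simp add: doubled_mat_eq i(1) j(1) mat_mul_def be_sum)
  finally show "mat_mul (doubled_mat \<tau> x) (doubled_mat \<tau> y) i j = doubled_mat \<tau> (mat_mul x y) i j" .
qed

lemma doubled_entry_id:
  assumes "doubling \<tau> u t"
    and "x (fst (double_index i)) (fst (double_index j)) = id_mat (fst (double_index i)) (fst (double_index j))"
  shows "doubled_mat \<tau> x i j = id_mat i j"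
  using doubling_block_entry(2,3)[OF assms(1)] assms(2)
  by (cases i; cases j) (auto simp: doubled_mat_eq id_mat_def)

lemma doubled_mat_id: "doubling \<tau> u t \<Longrightarrow> doubled_mat \<tau> id_mat = id_mat"
  by (intro ext doubled_entry_id) auto

lemma doubled_finite_mats:
  assumes d: "doubling \<tau> u t" and x: "x \<in> finite_mats (scalars u) UNIV"
  shows "doubled_mat \<tau> x \<in> finite_mats (scalars t) UNIV"
proof -
  obtain X where X: "finite X" "\<And>i j. i \<notin> X \<or> j \<notin> X \<Longrightarrow> x i j = id_mat i j"
    using x unfolding finite_mats_def finite_mat_iff by blast
  have "doubled_mat \<tau> x i j = id_mat i j" if "i \<notin> X <+> X \<or> j \<notin> X <+> X" for i j
    using that by (intro doubled_entry_id[OF d] X(2)) (cases i; cases j; auto)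
  then have "finite_mat (doubled_mat \<tau> x)"
    unfolding finite_mat_iff using X(1) by (intro exI[of _ "X <+> X"]) auto
  then show ?thesis
    using x doubling_block_entry(4)[OF d double_index_less double_index_less]
    by (auto simp: finite_mats_def doubled_mat_eq)
qed

lemma doubled_GL_mats:
  assumes d: "doubling \<tau> u t" and x: "x \<in> GL_mats (scalars u) UNIV"
  shows "doubled_mat \<tau> x \<in> GL_mats (scalars t) UNIV"
proof -
  obtain x' where x': "x' \<in> finite_mats (scalars u) UNIV" "mat_mul x x' = id_mat" "mat_mul x' x = id_mat"
    using x unfolding GL_mats_def by blast
  have fx: "x \<in> finite_mats (scalars u) UNIV"
    using x unfolding GL_mats_def by blast
  have D: "row_finite x" "\<And>i j. x i j \<in> scalars u" "row_finite x'" "\<And>i j. x' i j \<in> scalars u"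
    using fx x'(1) by (auto simp: finite_mats_def finite_mat_row_finite)
  have "mat_mul (doubled_mat \<tau> x) (doubled_mat \<tau> x') = id_mat"
    "mat_mul (doubled_mat \<tau> x') (doubled_mat \<tau> x) = id_mat"
    by (simp_all add: doubled_mat_mul[OF d] D x'(2,3) doubled_mat_id[OF d])
  then show ?thesis
    unfolding GL_mats_def using doubled_finite_mats[OF d fx] doubled_finite_mats[OF d x'(1)] by blast
qed

text \<open>
  In this guise the invariance of the symplectic form under the doubled unitary matrices
  becomes that of a scalar under the unitary matrices themselves.
\<close>

lemma symplectic_doubled:
  "symplectic_mat = doubled_mat Realification (scalar_mat (quat_of_complex (- \<i>)))"
  "symplectic_mat = doubled_mat Complexification (scalar_mat (Quat 0 1))"
proof -
  show "symplectic_mat = doubled_mat Realification (scalar_mat (quat_of_complex (- \<i>)))"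
  proof (intro ext)
    show "symplectic_mat i j = doubled_mat Realification (scalar_mat (quat_of_complex (- \<i>))) i j" for i j
      by (cases i; cases j) (auto simp: doubled_mat_eq scalar_mat_def id_mat_def qcoord_def qbasis_def)
  qed
  show "symplectic_mat = doubled_mat Complexification (scalar_mat (Quat 0 1))"
  proof (intro ext)
    show "symplectic_mat i j = doubled_mat Complexification (scalar_mat (Quat 0 1)) i j" for i j
      by (cases i; cases j) (auto simp: doubled_mat_eq scalar_mat_def id_mat_def quat_eq_iff)
  qed
qed

lemma pres_symplectic_real:
  assumes x: "x \<in> carrier (heavy_irr U_inf)"
  shows "pres_form (\<lambda>q. q) symplectic_mat (doubled_mat Realification x)"
proof -
  let ?y = "star_mat qcnj x" and ?c = "quat_of_complex (- \<i>)"
  note hx = heavy_irrD[OF x] heavy_irr_adjointD[OF x]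
  have d: "doubling Realification U_inf O_inf"
    by (simp add: doubling_def)
  have cx: "qsnd (x i j) = 0" for i j
    using hx(3) by (simp add: quat_complex_iff)
  have star: "star_mat (\<lambda>q. q) (doubled_mat Realification x) = doubled_mat Realification ?y"
  proof (intro ext)
    show "star_mat (\<lambda>q. q) (doubled_mat Realification x) i j = doubled_mat Realification ?y i j" for i j
      by (cases i; cases j) (auto simp: doubled_mat_eq star_mat_def qcoord_def qbasis_def cx)
  qed
  have sc: "scalar_mat ?c i j \<in> scalars U_inf" for i j :: nat
    by (auto simp: scalar_mat_def quat_complex_iff)
  have yc: "mat_mul ?y (scalar_mat ?c) i j \<in> scalars U_inf" for i j
    by (intro mat_mul_scalars sc hx)
  have "mat_mul (mat_mul ?y (scalar_mat ?c)) x = scalar_mat ?c"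
    by (intro unitary_pres_scalar hx) (simp add: star_mat_def quat_eq_iff cx)
  then show ?thesis
    unfolding pres_form_def symplectic_doubled(1) star
    by (simp add: doubled_mat_mul[OF d] hx sc yc row_finite_mul row_finite_scalar del: scalars.simps)
qed

text \<open>
  The transpose of the complexification of \<open>q\<close> is the complexification of \<open>j cnj q j\<^sup>-\<^sup>1\<close>, where
  \<open>cnj\<close> is quaternionic conjugation.
\<close>

lemma pres_symplectic_complex:
  assumes x: "x \<in> carrier (heavy_irr Sp_inf)"
  shows "pres_form (\<lambda>q. q) symplectic_mat (doubled_mat Complexification x)"
proof -
  let ?j = "Quat 0 1" and ?z = "star_mat (\<lambda>q. Quat (qfst q) (- cnj (qsnd q))) x"
  note hx = heavy_irrD[OF x] heavy_irr_adjointD[OF x]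
  have d: "doubling Complexification Sp_inf U_inf"
    by (simp add: doubling_def)
  have star: "star_mat (\<lambda>q. q) (doubled_mat Complexification x) = doubled_mat Complexification ?z"
  proof (intro ext)
    show "star_mat (\<lambda>q. q) (doubled_mat Complexification x) i j = doubled_mat Complexification ?z i j" for i j
      by (cases i; cases j) (auto simp: doubled_mat_eq star_mat_def quat_eq_iff)
  qed
  have z: "row_finite ?z"
    unfolding row_finite_def star_mat_def
  proof
    fix i
    have "{k. Quat (qfst (x k i)) (- cnj (qsnd (x k i))) \<noteq> 0} \<subseteq> {k. x k i \<noteq> 0}"
      by (auto simp: quat_eq_iff)
    then show "finite {k. Quat (qfst (x k i)) (- cnj (qsnd (x k i))) \<noteq> 0}"
      using finite_mat_finite_row(2)[OF hx(1)] by (rule finite_subset)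
  qed
  have zj: "mat_mul ?z (scalar_mat ?j) = mat_mul (scalar_mat ?j) (star_mat qcnj x)"
    by (intro ext) (simp add: mul_scalar_mat z scalar_mat_mul star_mat_def quat_eq_iff)
  have "mat_mul (mat_mul ?z (scalar_mat ?j)) x = scalar_mat ?j"
    unfolding zj by (simp add: mat_mul_assoc row_finite_scalar hx mat_mul_id_right)
  then show ?thesis
    unfolding pres_form_def symplectic_doubled(2) star
    by (simp add: doubled_mat_mul[OF d] z row_finite_mul row_finite_scalar)
qed


subsection \<open>The embedding of the maximal heavy subgroup\<close>

lemma star_real:
  assumes "\<And>i j. x i j \<in> \<real>"
  shows "star_mat (\<lambda>q. q) x = star_mat qcnj x"
  using assms by (intro ext) (simp add: star_mat_def quat_real_iff quat_eq_iff complex_eq_iff)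

lemma heavy_embed_irr_mem:
  assumes k: "\<And>c. c < length (heavy_factors X) \<Longrightarrow> k c \<in> carrier (heavy_irr (heavy_factors X ! c))"
  shows "heavy_embed_irr X k \<in> classical_mats X"
proof -
  have id: "id_mat \<in> carrier (heavy_irr t)" for t
    using group.is_monoid[OF group_heavy_irr[of t]] monoid.one_closed[of "heavy_irr t"] by simp
  have sesq: "pres_form qcnj (block_mat (scalar_mat c) (scalar_mat d)) (block_mat x y)"
    if "x \<in> carrier (heavy_irr t)" "y \<in> carrier (heavy_irr t)"
      "\<And>q. q \<in> scalars t \<Longrightarrow> q * c = c * q" "\<And>q. q \<in> scalars t \<Longrightarrow> q * d = d * q" for x y t c d
    by (intro pres_form_block heavy_irr_adjointD(2,3)[OF that(1)] heavy_irr_adjointD(2,3)[OF that(2)]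
        that(3)[OF heavy_irr_adjointD(4)[OF that(1)]] that(4)[OF heavy_irr_adjointD(4)[OF that(2)]]) simp
  have sig: "pres_form qcnj signature_mat (block_mat x y)"
    if "x \<in> carrier (heavy_irr t)" "y \<in> carrier (heavy_irr t)" for x y t
    unfolding signature_block by (rule sesq[OF that]) auto
  have bil: "pres_form (\<lambda>q. q) B (block_mat x y) \<longleftrightarrow> pres_form qcnj B (block_mat x y)"
    if x: "x \<in> carrier (heavy_irr O_inf)" and y: "y \<in> carrier (heavy_irr O_inf)" for x y B
  proof -
    have "block_mat x y i j \<in> \<real>" for i j
      using heavy_irrD(3)[OF x] heavy_irrD(3)[OF y] by (cases i; cases j) auto
    then show ?thesis
      by (simp add: pres_form_def star_real)
  qed
  have form_id: "pres_form qcnj id_mat (block_mat x id_mat)" if "x \<in> carrier (heavy_irr t)" for x t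
    using sesq[OF that id, of 1 1] by (simp add: scalar_mat_one block_mat_id)
  have form_i: "pres_form qcnj i_mat (block_mat x id_mat)" if "x \<in> carrier (heavy_irr U_inf)" for x
    unfolding i_mat_scalar scalar_block
    by (rule sesq[OF that id]; auto simp: quat_complex_iff quat_eq_iff)
  have GL: "block_mat x y \<in> GL_mats (scalars t) I"
    if "x \<in> carrier (heavy_irr t)" "y \<in> carrier (heavy_irr t)" "range Inl \<subseteq> I" "y = id_mat \<or> I = UNIV" for x y t I
    using heavy_irr_adjointD(1)[OF that(1)] heavy_irr_adjointD(1)[OF that(2)] that(3,4) by (intro block_GL_mats) auto
  have dbl: "doubled_mat \<tau> x \<in> GL_mats (scalars t) UNIV"
    if "x \<in> carrier (heavy_irr u)" "doubling \<tau> u t" for x \<tau> u t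
    by (rule doubled_GL_mats[OF that(2) heavy_irr_adjointD(1)[OF that(1)]])
  note form = pres_bilinear_form pres_sesquilinear_form
  have k0: "k 0 \<in> carrier (heavy_irr (heavy_factors X ! 0))"
    by (rule k) (cases X; simp)
  show ?thesis
  proof (cases X)
    case GL_R with k0 GL[OF _ id] show ?thesis by fastforce
  next case GL_C with k0 GL[OF _ id] show ?thesis by fastforce
  next case GL_H with k0 GL[OF _ id] show ?thesis by fastforce
  next case U_inf_inf with k0 k[of 1] GL[of "k 0" U_inf "k 1" UNIV] sig show ?thesis by (auto simp: form)
  next case Sp_R with k0 dbl[of "k 0" U_inf Realification O_inf] pres_symplectic_real
    show ?thesis by (simp add: form doubling_def)
  next case Sp_C with k0 dbl[of "k 0" Sp_inf Complexification U_inf] pres_symplectic_complex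
    show ?thesis by (simp add: form doubling_def)
  next case Sp_inf_inf with k0 k[of 1] GL[of "k 0" Sp_inf "k 1" UNIV] sig show ?thesis by (auto simp: form)
  next case O_inf_inf with k0 k[of 1] GL[of "k 0" O_inf "k 1" UNIV] sig show ?thesis by (auto simp: form bil)
  next case O_C
    have "GL_mats (scalars O_inf) Inl_inds \<subseteq> GL_mats (scalars U_inf) Inl_inds"
      by (intro GL_mats_mono) (auto simp: quat_complex_iff quat_real_iff)
    with O_C k0 GL[of "k 0" O_inf id_mat Inl_inds] form_id id show ?thesis by (auto simp: form bil)
  next case SO_star
    have "GL_mats (scalars U_inf) Inl_inds \<subseteq> GL_mats (scalars Sp_inf) Inl_inds"
      by (intro GL_mats_mono) auto
    with SO_star k0 GL[of "k 0" U_inf id_mat Inl_inds] form_i id show ?thesis by (auto simp: form)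
  next case (U_fin p) with k0 GL[of "k 0" U_inf id_mat "fin_inds p"] sig id show ?thesis by (auto simp: form)
  next case (O_fin p) with k0 GL[of "k 0" O_inf id_mat "fin_inds p"] sig id show ?thesis by (auto simp: form bil)
  next case (Sp_fin p) with k0 GL[of "k 0" Sp_inf id_mat "fin_inds p"] sig id show ?thesis by (auto simp: form)
  qed
qed

lemma heavy_embed_irr_mul:
  assumes k: "\<And>c. c < length (heavy_factors X) \<Longrightarrow> k c \<in> carrier (heavy_irr (heavy_factors X ! c))"
    and k': "\<And>c. c < length (heavy_factors X) \<Longrightarrow> k' c \<in> carrier (heavy_irr (heavy_factors X ! c))"
    and k'': "\<And>c. c < length (heavy_factors X) \<Longrightarrow> k'' c = mat_mul (k c) (k' c)"
  shows "heavy_embed_irr X k'' = mat_mul (heavy_embed_irr X k) (heavy_embed_irr X k')"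
proof -
  have 0: "0 < length (heavy_factors X)"
    by (cases X) auto
  note x = heavy_irrD[OF k[OF 0]] and y = heavy_irrD[OF k'[OF 0]]
  have R: "doubling Realification U_inf O_inf" and C: "doubling Complexification Sp_inf U_inf"
    by (simp_all add: doubling_def)
  show ?thesis
  proof (cases X)
    case Sp_R
    with x y k''[OF 0] show ?thesis by (simp add: doubled_mat_mul[OF R])
  next
    case Sp_C
    with x y k''[OF 0] show ?thesis by (simp add: doubled_mat_mul[OF C])
  qed (use k'' in \<open>simp_all add: block_mat_mul\<close>)
qed

lemma heavy_embed_irr_id:
  "\<exists>n. \<forall>k. (\<forall>c < length (heavy_factors X). \<forall>n'. k c n n' = id_mat n n' \<and> k c n' n = id_mat n' n) \<longrightarrow>
     (\<forall>y. heavy_embed_irr X k x y = id_mat x y \<and> heavy_embed_irr X k y x = id_mat y x)"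
proof (intro exI allI impI)
  let ?n = "fst (double_index x)"
  fix k y
  assume k: "\<forall>c < length (heavy_factors X). \<forall>n'. k c ?n n' = id_mat ?n n' \<and> k c n' ?n = id_mat n' ?n"
  have R: "doubling Realification U_inf O_inf" and C: "doubling Complexification Sp_inf U_inf"
    by (simp_all add: doubling_def)
  have block: "block_mat (k 0) z x y = id_mat x y \<and> block_mat (k 0) z y x = id_mat y x"
    if "\<And>n'. z ?n n' = id_mat ?n n' \<and> z n' ?n = id_mat n' ?n" "0 < length (heavy_factors X)" for z
    using k that by (cases x; cases y) (auto simp: id_mat_def)
  show "heavy_embed_irr X k x y = id_mat x y \<and> heavy_embed_irr X k y x = id_mat y x"
  proof (cases X)
    case Sp_R
    with k show ?thesis by (auto intro!: doubled_entry_id[OF R])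
  next
    case Sp_C
    with k show ?thesis by (auto intro!: doubled_entry_id[OF C])
  qed (use k block[of "k 1"] block[of id_mat] in simp_all)
qed


section \<open>Stabilizers and permutation matrices in a heavy group\<close>

lemma heavy_group_carrier:
  "l \<in> carrier (heavy_group Ls) \<longleftrightarrow>
     l \<in> extensional {..<length Ls} \<and> (\<forall>j < length Ls. l j \<in> carrier (heavy_irr (Ls ! j)))"
  by (auto simp: heavy_group_def PiE_def Pi_def)

lemma heavy_group_mult:
  "j < length Ls \<Longrightarrow> (l \<otimes>\<^bsub>heavy_group Ls\<^esub> l') j = mat_mul (l j) (l' j)"
  by (simp add: heavy_group_def)

lemma heavy_group_one: "j < length Ls \<Longrightarrow> \<one>\<^bsub>heavy_group Ls\<^esub> j = id_mat"
  by (simp add: heavy_group_def)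

lemma heavy_group_eqI:
  assumes "l \<in> carrier (heavy_group Ls)" "l' \<in> carrier (heavy_group Ls)"
    and "\<And>j i k. j < length Ls \<Longrightarrow> l j i k = l' j i k"
  shows "l = l'"
  using assms by (intro extensionalityI[of l "{..<length Ls}" l']) (auto simp: heavy_group_carrier fun_eq_iff)

lemma stabilizerD:
  assumes "l \<in> stabilizer Ls \<alpha>"
  shows "l \<in> carrier (heavy_group Ls)" "j < length Ls \<Longrightarrow> k < \<alpha> j \<Longrightarrow> l j i k = id_mat i k"
  using assms by (auto simp: stabilizer_def)

text \<open>
  If a unitary \<open>g\<close> fixes a basis vector \<open>e\<close>, then \<open>g\<^sup>* e = g\<^sup>* g e = e\<close>, and the columns of \<open>g\<^sup>*\<close>
  are the conjugate rows of \<open>g\<close>.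
\<close>

lemma stabilizer_row:
  assumes l: "l \<in> stabilizer Ls \<alpha>" and j: "j < length Ls" "k < \<alpha> j"
  shows "l j k i = id_mat k i"
proof -
  have x: "l j \<in> carrier (heavy_irr (Ls ! j))"
    using stabilizerD(1)[OF l] j(1) by (simp add: heavy_group_carrier)
  have "mat_mul (mat_adjoint (l j)) (l j) i k = mat_adjoint (l j) i k"
    using heavy_irr_adjointD(3)[OF x] stabilizerD(2)[OF l j]
    by (intro mat_mul_entry_col) (auto simp: adjoint_star)
  then have "qcnj (l j k i) = id_mat i k"
    using heavy_irrD(4)[OF x] by (simp add: mat_adjoint_def)
  then have "qcnj (qcnj (l j k i)) = qcnj (id_mat i k)"
    by (simp only:)
  then show ?thesis
    by (auto simp: id_mat_def split: if_splits)
qed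

lemma stabilizer_mono:
  "(\<And>j. j < length Ls \<Longrightarrow> \<alpha> j \<le> \<beta> j) \<Longrightarrow> stabilizer Ls \<beta> \<subseteq> stabilizer Ls \<alpha>"
  unfolding stabilizer_def using order_less_le_trans by blast

lemma stabilizer_subgroup: "subgroup (stabilizer Ls \<alpha>) (heavy_group Ls)"
proof -
  interpret L: Group.group "heavy_group Ls"
    by (rule group_heavy_group)
  have row: "row_finite (l j)" if "l \<in> carrier (heavy_group Ls)" "j < length Ls" for l j
    using that heavy_irrD(2) by (auto simp: heavy_group_carrier)
  show ?thesis
  proof (rule L.subgroupI)
    show "stabilizer Ls \<alpha> \<subseteq> carrier (heavy_group Ls)"
      by (auto simp: stabilizer_def)
    have "\<one>\<^bsub>heavy_group Ls\<^esub> \<in> stabilizer Ls \<alpha>"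
      by (simp add: stabilizer_def heavy_group_one)
    then show "stabilizer Ls \<alpha> \<noteq> {}"
      by blast
    show "l \<otimes>\<^bsub>heavy_group Ls\<^esub> l' \<in> stabilizer Ls \<alpha>"
      if l: "l \<in> stabilizer Ls \<alpha>" and l': "l' \<in> stabilizer Ls \<alpha>" for l l'
    proof -
      have "mat_mul (l j) (l' j) i k = id_mat i k" if "j < length Ls" "k < \<alpha> j" for i j k
        using mat_mul_entry_col[of "l j" i "l' j" k] row[OF stabilizerD(1)[OF l]]
          stabilizerD(2)[OF l] stabilizerD(2)[OF l'] that by simp
      then show ?thesis
        using stabilizerD(1)[OF l] stabilizerD(1)[OF l'] by (simp add: stabilizer_def heavy_group_mult)
    qed
    show "inv\<^bsub>heavy_group Ls\<^esub> l \<in> stabilizer Ls \<alpha>" if l: "l \<in> stabilizer Ls \<alpha>" for l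
    proof -
      let ?l' = "inv\<^bsub>heavy_group Ls\<^esub> l"
      have lc: "l \<in> carrier (heavy_group Ls)" "?l' \<in> carrier (heavy_group Ls)"
        using stabilizerD(1)[OF l] by simp_all
      have "?l' j i k = id_mat i k" if "j < length Ls" "k < \<alpha> j" for i j k
      proof -
        have "mat_mul (?l' j) (l j) = id_mat"
          using L.l_inv[OF lc(1)] heavy_group_mult[OF that(1), of ?l' l] heavy_group_one[OF that(1)] by simp
        moreover have "mat_mul (?l' j) (l j) i k = ?l' j i k"
          using row[OF lc(2)] stabilizerD(2)[OF l] that by (intro mat_mul_entry_col) auto
        ultimately show ?thesis
          by simp
      qed
      then show ?thesis
        using lc by (simp add: stabilizer_def)
    qed
  qed
qed

lemma swap_index_invol: "swap_index a m (swap_index a m i) = i"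
  by (auto simp: swap_index_def)

lemma id_mat_swap:
  "id_mat (swap_index a m i) k = id_mat i (swap_index a m k)"
  unfolding id_mat_def by (metis swap_index_invol)

lemma Theta_entry: "j < length Ls \<Longrightarrow> Theta Ls \<beta> m j i k = id_mat i (swap_index (\<beta> j) (m j) k)"
  by (simp add: Theta_def)

lemma Theta_carrier: "Theta Ls \<beta> m \<in> carrier (heavy_group Ls)"
proof -
  have "(\<lambda>i k. id_mat i (swap_index a n k)) \<in> carrier (heavy_irr t)" for a n t
  proof -
    let ?P = "(\<lambda>i k. id_mat i (swap_index a n k)) :: nat qmat"
    have "swap_index a n k = k" if "a + 2 * n \<le> k" for k
      using that by (simp add: swap_index_def)
    moreover have "?P i k = id_mat i k" if "swap_index a n i = i" for i k
      using that swap_index_invol[of a n] by (metis id_mat_def)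
    ultimately have "?P i k = id_mat i k" if "i \<notin> {..<a + 2 * n} \<or> k \<notin> {..<a + 2 * n}" for i k
      using that by (auto simp: not_less)
    then have fin: "finite_mat ?P"
      unfolding finite_mat_iff by (intro exI[of _ "{..<a + 2 * n}"]) auto
    have PP: "mat_mul ?P ?P = id_mat"
      by (intro ext) (simp add: mat_mul_perm_left swap_index_invol id_mat_swap)
    have "mat_adjoint ?P i k = id_mat (swap_index a n i) k" for i k
      by (simp add: mat_adjoint_def id_mat_def)
    then have "mat_adjoint ?P i k = ?P i k" for i k
      by (simp add: id_mat_swap)
    then have "mat_adjoint ?P = ?P"
      by blast
    moreover have "?P \<in> GL_mats (scalars t) UNIV"
      using fin PP by (auto simp: GL_mats_def finite_mats_def)
    ultimately show ?thesis
      using PP by (simp add: heavy_irr_def mat_group_def)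
  qed
  then show ?thesis
    by (simp add: heavy_group_carrier Theta_def)
qed

lemma mult_Theta:
  assumes "l \<in> carrier (heavy_group Ls)" "j < length Ls"
  shows "(l \<otimes>\<^bsub>heavy_group Ls\<^esub> Theta Ls \<beta> m) j i k = l j i (swap_index (\<beta> j) (m j) k)"
proof -
  have "row_finite (l j)"
    using assms heavy_irrD(2) by (auto simp: heavy_group_carrier)
  then show ?thesis
    using assms by (simp add: heavy_group_mult Theta_def mat_mul_perm_right)
qed

lemma Theta_mult:
  assumes "j < length Ls"
  shows "(Theta Ls \<beta> m \<otimes>\<^bsub>heavy_group Ls\<^esub> l) j i k = l j (swap_index (\<beta> j) (m j) i) k"
  using assms by (simp add: heavy_group_mult Theta_def mat_mul_perm_left swap_index_invol)

lemma Theta_square: "Theta Ls \<beta> m \<otimes>\<^bsub>heavy_group Ls\<^esub> Theta Ls \<beta> m = \<one>\<^bsub>heavy_group Ls\<^esub>"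
proof -
  interpret L: Group.group "heavy_group Ls"
    by (rule group_heavy_group)
  show ?thesis
    by (rule heavy_group_eqI[of _ Ls])
      (simp_all add: Theta_carrier mult_Theta Theta_entry swap_index_invol heavy_group_one)
qed

lemma Theta_stabilizer:
  "(\<And>j. j < length Ls \<Longrightarrow> \<alpha> j \<le> \<beta> j) \<Longrightarrow> Theta Ls \<beta> m \<in> stabilizer Ls \<alpha>"
  using order_less_le_trans by (fastforce simp: stabilizer_def Theta_carrier Theta_entry swap_index_def)

text \<open>
  For large \<open>m\<close>, conjugation by \<open>\<Theta>\<close> moves the finitely many basis vectors on which an
  element of \<open>L\<^sup>\<beta>\<close> acts beyond any given position.
\<close>

lemma Theta_conj_stabilizer:
  assumes b: "b \<in> stabilizer Ls \<beta>"
  obtains M where "\<And>N m. (\<And>j. j < length Ls \<Longrightarrow> M \<le> m j \<and> N \<le> m j) \<Longrightarrow>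
    Theta Ls \<beta> m \<otimes>\<^bsub>heavy_group Ls\<^esub> b \<otimes>\<^bsub>heavy_group Ls\<^esub> Theta Ls \<beta> m \<in> stabilizer Ls (\<lambda>_. N)"
proof -
  interpret L: Group.group "heavy_group Ls"
    by (rule group_heavy_group)
  have bc: "b \<in> carrier (heavy_group Ls)"
    by (rule stabilizerD(1)[OF b])
  have "\<exists>M. \<forall>i k. M \<le> k \<longrightarrow> b j i k = id_mat i k" if "j < length Ls" for j
  proof -
    have "finite_mat (b j)"
      using bc that heavy_irrD(1) by (auto simp: heavy_group_carrier)
    then obtain X where X: "finite X" "\<forall>i k. i \<notin> X \<or> k \<notin> X \<longrightarrow> b j i k = id_mat i k"
      by (auto simp: finite_mat_iff)
    from X(1) obtain M where "\<forall>k\<in>X. k < M"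
      by (auto simp: finite_nat_set_iff_bounded)
    then have "b j i k = id_mat i k" if "M \<le> k" for i k
      using X(2) that by (metis not_less)
    then show ?thesis
      by blast
  qed
  then obtain M where M: "\<And>j i k. j < length Ls \<Longrightarrow> M j \<le> k \<Longrightarrow> b j i k = id_mat i k"
    by metis
  define M' where "M' = Max (insert 0 (M ` {..<length Ls}))"
  have M': "M j \<le> M'" if "j < length Ls" for j
    unfolding M'_def using that by (intro Max_ge) auto
  show thesis
  proof (rule that[of M'])
    fix N m assume m: "\<And>j. j < length Ls \<Longrightarrow> M' \<le> m j \<and> N \<le> m j"
    have "b j (swap_index (\<beta> j) (m j) i) (swap_index (\<beta> j) (m j) k) = id_mat i k"
      if j: "j < length Ls" and k: "k < N" for i j k
    proof -
      let ?s = "swap_index (\<beta> j) (m j)"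
      have "b j (?s i) (?s k) = id_mat (?s i) (?s k)"
      proof (cases "k < \<beta> j")
        case True
        then have "?s k = k"
          by (simp add: swap_index_def)
        then show ?thesis
          using stabilizerD(2)[OF b j True] by simp
      next
        case False
        then have "?s k = k + m j"
          using m[OF j] k by (simp add: swap_index_def)
        then show ?thesis
          using M[OF j, of "?s k"] m[OF j] M'[OF j] by simp
      qed
      also have "\<dots> = id_mat i k"
        by (simp add: id_mat_swap swap_index_invol)
      finally show ?thesis .
    qed
    then show "Theta Ls \<beta> m \<otimes>\<^bsub>heavy_group Ls\<^esub> b \<otimes>\<^bsub>heavy_group Ls\<^esub> Theta Ls \<beta> m \<in> stabilizer Ls (\<lambda>_. N)"
      by (simp add: stabilizer_def bc Theta_carrier mult_Theta Theta_mult)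
  qed
qed

text \<open>
  Modulo \<open>L\<^sup>N\<close> on both sides a permutation is determined by its restriction to those of the
  first \<open>N\<close> basis vectors that it does not send past the \<open>N\<close>-th one, and for \<open>\<Theta>\<close> these are
  the first \<open>\<beta>\<close> vectors, as soon as \<open>m \<ge> N\<close>.  The left factor is itself a \<open>\<Theta>\<close>: the one
  that carries the block at distance \<open>m\<close> to the block at distance \<open>m + m'\<close>.
\<close>

lemma Theta_shift:
  assumes m: "\<And>j. j < length Ls \<Longrightarrow> \<beta> j \<le> N \<and> N \<le> m j \<and> N \<le> m' j"
  obtains s t where "s \<in> stabilizer Ls (\<lambda>_. N)" "t \<in> stabilizer Ls (\<lambda>_. N)"
    "Theta Ls \<beta> (\<lambda>j. m j + m' j) = s \<otimes>\<^bsub>heavy_group Ls\<^esub> Theta Ls \<beta> m \<otimes>\<^bsub>heavy_group Ls\<^esub> t"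
proof -
  interpret L: Group.group "heavy_group Ls"
    by (rule group_heavy_group)
  let ?T = "Theta Ls \<beta>"
  define s where "s = Theta Ls (\<lambda>j. \<beta> j + m j) m'"
  define t where "t = ?T m \<otimes>\<^bsub>heavy_group Ls\<^esub> s \<otimes>\<^bsub>heavy_group Ls\<^esub> ?T (\<lambda>j. m j + m' j)"
  have c: "?T m \<in> carrier (heavy_group Ls)" "s \<in> carrier (heavy_group Ls)"
    "?T (\<lambda>j. m j + m' j) \<in> carrier (heavy_group Ls)" "t \<in> carrier (heavy_group Ls)"
    by (simp_all add: t_def s_def Theta_carrier)
  have "s \<in> stabilizer Ls (\<lambda>_. N)"
    unfolding s_def using m by (intro Theta_stabilizer) (simp add: trans_le_add2)
  moreover have "t \<in> stabilizer Ls (\<lambda>_. N)"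
  proof -
    have "t j i k = id_mat i k" if j: "j < length Ls" and k: "k < N" for i j k
    proof -
      let ?u = "\<lambda>k. swap_index (\<beta> j) (m j + m' j) k"
      have "t j i k = id_mat i (swap_index (\<beta> j) (m j) (swap_index (\<beta> j + m j) (m' j) (?u k)))"
        using j c unfolding t_def s_def by (simp add: mult_Theta Theta_mult Theta_entry id_mat_swap)
      also have "swap_index (\<beta> j + m j) (m' j) (?u k) = swap_index (\<beta> j) (m j) k"
        using m[OF j] k by (auto simp: swap_index_def)
      also have "id_mat i (swap_index (\<beta> j) (m j) (swap_index (\<beta> j) (m j) k)) = id_mat i k"
        by (simp add: swap_index_invol)
      finally show ?thesis .
    qed
    then show ?thesis
      using c(4) by (simp add: stabilizer_def)
  qed
  moreover have "?T (\<lambda>j. m j + m' j) = s \<otimes>\<^bsub>heavy_group Ls\<^esub> ?T m \<otimes>\<^bsub>heavy_group Ls\<^esub> t"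
  proof -
    have "s \<otimes>\<^bsub>heavy_group Ls\<^esub> ?T m \<otimes>\<^bsub>heavy_group Ls\<^esub> t =
        s \<otimes>\<^bsub>heavy_group Ls\<^esub> ((?T m \<otimes>\<^bsub>heavy_group Ls\<^esub> ?T m) \<otimes>\<^bsub>heavy_group Ls\<^esub>
          (s \<otimes>\<^bsub>heavy_group Ls\<^esub> ?T (\<lambda>j. m j + m' j)))"
      unfolding t_def using c by (simp add: L.m_assoc)
    also have "\<dots> = (s \<otimes>\<^bsub>heavy_group Ls\<^esub> s) \<otimes>\<^bsub>heavy_group Ls\<^esub> ?T (\<lambda>j. m j + m' j)"
      using c by (simp add: Theta_square L.m_assoc)
    also have "\<dots> = ?T (\<lambda>j. m j + m' j)"
      using c unfolding s_def by (simp add: Theta_square)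
    finally show ?thesis by simp
  qed
  ultimately show thesis
    by (rule that)
qed


section \<open>The embedding of a heavy group into a classical group\<close>

text \<open>
  The role of straightness: a basis vector in the block of the copy \<open>\<tau>\<^sub>j\<close> of \<open>L\<^sub>m\<close> belongs to a
  single basis vector of \<open>L\<^sub>m\<close>, and those outside all blocks are fixed by the whole group.
\<close>

lemma straight_irr_fixes:
  assumes f: "straight_irr Ls t f"
  shows "\<exists>N. \<forall>l \<in> stabilizer Ls (\<lambda>_. N). \<forall>n'. f l n n' = id_mat n n' \<and> f l n' n = id_mat n' n"
proof -
  obtain a \<tau>s e where \<tau>s: "\<forall>(\<tau>, m) \<in> set \<tau>s. m < length Ls \<and> trivial_hom_type \<tau> (Ls ! m) t"
    and e: "bij_betw e UNIV (straight_index Ls a \<tau>s)"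
    and fe: "\<forall>g \<in> carrier (heavy_group Ls). \<forall>i j. f g i j = straight_diag \<tau>s g (e i) (e j)"
    using f unfolding straight_irr_def by blast
  have id_e: "id_mat n n' = (if e n = e n' then 1 else 0)" for n n'
    using e by (auto simp: id_mat_def bij_betw_def inj_def)
  have e_in: "e n \<in> straight_index Ls a \<tau>s" for n
    using e by (auto simp: bij_betw_def)
  show ?thesis
  proof (cases "e n")
    case (Inl k)
    have "straight_diag \<tau>s g (e n) (e n') = id_mat n n' \<and> straight_diag \<tau>s g (e n') (e n) = id_mat n' n" for g n'
      by (cases "e n'") (auto simp: Inl id_e[of n] id_e[of _ n] id_mat_def[of k] id_mat_def[of _ k])
    then have "f l n n' = id_mat n n' \<and> f l n' n = id_mat n' n" if "l \<in> stabilizer Ls (\<lambda>_. 0)" for l n'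
      using fe stabilizerD(1)[OF that] by simp
    then show ?thesis
      by blast
  next
    case (Inr q)
    then obtain j k r where n: "e n = Inr (j, k, r)"
      by (cases q) auto
    then have j: "j < length \<tau>s" and r: "r < block_dim (fst (\<tau>s ! j)) (Ls ! snd (\<tau>s ! j))"
      using e_in[of n] by (auto simp: straight_index_def)
    have \<tau>: "snd (\<tau>s ! j) < length Ls" "trivial_hom_type (fst (\<tau>s ! j)) (Ls ! snd (\<tau>s ! j)) t"
      using \<tau>s nth_mem[OF j] by (auto simp: split_beta)
    show ?thesis
    proof (intro exI[of _ "Suc k"] ballI allI)
      fix l n' assume l: "l \<in> stabilizer Ls (\<lambda>_. Suc k)"
      have lk: "l (snd (\<tau>s ! j)) k k' = id_mat k k'" "l (snd (\<tau>s ! j)) k' k = id_mat k' k" for k'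
        using stabilizer_row[OF l \<tau>(1)] stabilizerD(2)[OF l \<tau>(1)] by auto
      have "straight_diag \<tau>s l (e n) (e n') = id_mat n n' \<and> straight_diag \<tau>s l (e n') (e n) = id_mat n' n"
      proof (cases "e n'")
        case (Inl k')
        then show ?thesis by (simp add: n id_e)
      next
        case (Inr q')
        then obtain j' k' r' where n': "e n' = Inr (j', k', r')"
          by (cases q') auto
        show ?thesis
        proof (cases "j' = j")
          case True
          then have r': "r' < block_dim (fst (\<tau>s ! j)) (Ls ! snd (\<tau>s ! j))"
            using e_in[of n'] n' by (auto simp: straight_index_def)
          show ?thesis
            using block_entry_one[OF \<tau>(2) r r'] block_entry_one[OF \<tau>(2) r' r] True
            by (auto simp: n n' id_e[of n] id_e[of _ n] lk id_mat_def[of k] id_mat_def[of _ k])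
        next
          case False
          then show ?thesis by (auto simp: n n' id_e)
        qed
      qed
      then show "f l n n' = id_mat n n' \<and> f l n' n = id_mat n' n"
        using fe stabilizerD(1)[OF l] by simp
    qed
  qed
qed

locale GL_pair_embedding =
  fixes Gs :: "classical list" and Ls :: "heavy list"
    and F :: "(nat \<Rightarrow> nat qmat) \<Rightarrow> nat \<times> nat \<Rightarrow> nat qmat"
  assumes pair: "GL_pair Gs Ls F"
begin

abbreviation "G \<equiv> classical_group Gs"
abbreviation "L \<equiv> heavy_group Ls"
abbreviation "E \<equiv> L_embed Gs F"
abbreviation "St \<equiv> stabilizer Ls"
abbreviation "T \<equiv> Theta Ls"

sublocale G: Group.group G
  by (rule group_classical_group)

sublocale L: Group.group L
  by (rule group_heavy_group)

lemma St_carrier: "l \<in> St \<alpha> \<Longrightarrow> l \<in> carrier L"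
  by (rule stabilizerD(1))

lemma F_hom: "F \<in> hom L (product_group (max_heavy_index Gs) (\<lambda>c. heavy_irr (max_heavy_kind Gs c)))"
  and F_straight: "c \<in> max_heavy_index Gs \<Longrightarrow> straight_irr Ls (max_heavy_kind Gs c) (\<lambda>g. F g c)"
  using pair by (auto simp: GL_pair_def straight_hom_def)

lemma F_carrier:
  assumes "l \<in> carrier L" "i < length Gs" "c < length (heavy_factors (Gs ! i))"
  shows "F l (i, c) \<in> carrier (heavy_irr (heavy_factors (Gs ! i) ! c))"
proof -
  have "F l \<in> (\<Pi>\<^sub>E c\<in>max_heavy_index Gs. carrier (heavy_irr (max_heavy_kind Gs c)))"
    using F_hom assms(1) by (auto simp: hom_def)
  moreover have "(i, c) \<in> max_heavy_index Gs"
    using assms by (simp add: max_heavy_index_def)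
  ultimately have "F l (i, c) \<in> carrier (heavy_irr (max_heavy_kind Gs (i, c)))"
    by (rule PiE_mem)
  then show ?thesis
    by (simp add: max_heavy_kind_def)
qed

lemma F_mult:
  assumes "l \<in> carrier L" "l' \<in> carrier L" "i < length Gs" "c < length (heavy_factors (Gs ! i))"
  shows "F (l \<otimes>\<^bsub>L\<^esub> l') (i, c) = mat_mul (F l (i, c)) (F l' (i, c))"
proof -
  have "F (l \<otimes>\<^bsub>L\<^esub> l') = (\<lambda>c\<in>max_heavy_index Gs. mat_mul (F l c) (F l' c))"
    using hom_mult[OF F_hom assms(1,2)] by simp
  moreover have "(i, c) \<in> max_heavy_index Gs"
    using assms by (simp add: max_heavy_index_def)
  ultimately show ?thesis
    by simp
qed

lemma G_carrier:
  "g \<in> carrier G \<longleftrightarrow> g \<in> extensional {..<length Gs} \<and> (\<forall>i < length Gs. g i \<in> classical_mats (Gs ! i))"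
  by (auto simp: classical_group_def PiE_def Pi_def)

lemma G_mult: "g \<otimes>\<^bsub>G\<^esub> h = (\<lambda>i\<in>{..<length Gs}. mat_mul (g i) (h i))"
  by (simp add: classical_group_def)

lemma E_entry: "i < length Gs \<Longrightarrow> E l i = heavy_embed_irr (Gs ! i) (\<lambda>c. F l (i, c))"
  by (simp add: L_embed_def heavy_embed_def)

lemma E_hom: "E \<in> hom L G"
proof (rule homI)
  show E: "E l \<in> carrier G" if "l \<in> carrier L" for l
    unfolding G_carrier
  proof (intro conjI allI impI)
    show "E l \<in> extensional {..<length Gs}"
      by (simp add: L_embed_def heavy_embed_def)
    show "E l i \<in> classical_mats (Gs ! i)" if i: "i < length Gs" for i
      unfolding E_entry[OF i] using F_carrier[OF \<open>l \<in> carrier L\<close> i] by (rule heavy_embed_irr_mem)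
  qed
  show "E (l \<otimes>\<^bsub>L\<^esub> l') = E l \<otimes>\<^bsub>G\<^esub> E l'" if l: "l \<in> carrier L" and l': "l' \<in> carrier L" for l l'
  proof
    fix i
    show "E (l \<otimes>\<^bsub>L\<^esub> l') i = (E l \<otimes>\<^bsub>G\<^esub> E l') i"
    proof (cases "i < length Gs")
      case True
      have "heavy_embed_irr (Gs ! i) (\<lambda>c. F (l \<otimes>\<^bsub>L\<^esub> l') (i, c)) =
          mat_mul (heavy_embed_irr (Gs ! i) (\<lambda>c. F l (i, c))) (heavy_embed_irr (Gs ! i) (\<lambda>c. F l' (i, c)))"
        using F_carrier[OF l True] F_carrier[OF l' True] F_mult[OF l l' True]
        by (rule heavy_embed_irr_mul)
      then show ?thesis
        using True by (simp add: G_mult E_entry)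
    next
      case False
      then show ?thesis
        by (simp add: G_mult L_embed_def heavy_embed_def)
    qed
  qed
qed

lemma E_carrier: "l \<in> carrier L \<Longrightarrow> E l \<in> carrier G"
  using E_hom by (rule hom_in_carrier)

lemma E_mult: "l \<in> carrier L \<Longrightarrow> l' \<in> carrier L \<Longrightarrow> E (l \<otimes>\<^bsub>L\<^esub> l') = E l \<otimes>\<^bsub>G\<^esub> E l'"
  using E_hom by (rule hom_mult)

lemma E_one: "E \<one>\<^bsub>L\<^esub> = \<one>\<^bsub>G\<^esub>"
  using E_hom by (rule hom_one[OF _ L.group_axioms G.group_axioms])

lemma E_fixes:
  assumes i: "i < length Gs"
  shows "\<exists>N. \<forall>l \<in> St (\<lambda>_. N). \<forall>y. E l i x y = id_mat x y \<and> E l i y x = id_mat y x"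
proof -
  let ?p = "length (heavy_factors (Gs ! i))"
  obtain n where n: "\<And>k y. \<forall>c < ?p. \<forall>n'. k c n n' = id_mat n n' \<and> k c n' n = id_mat n' n \<Longrightarrow>
      heavy_embed_irr (Gs ! i) k x y = id_mat x y \<and> heavy_embed_irr (Gs ! i) k y x = id_mat y x"
    using heavy_embed_irr_id[of "Gs ! i" x] by blast
  have "\<exists>N. \<forall>l \<in> St (\<lambda>_. N). \<forall>n'. F l (i, c) n n' = id_mat n n' \<and> F l (i, c) n' n = id_mat n' n"
    if "c < ?p" for c
    using straight_irr_fixes[OF F_straight[of "(i, c)"]] i that by (simp add: max_heavy_index_def)
  then obtain N where N: "\<And>c l n'. c < ?p \<Longrightarrow> l \<in> St (\<lambda>_. N c) \<Longrightarrow>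
      F l (i, c) n n' = id_mat n n' \<and> F l (i, c) n' n = id_mat n' n"
    by metis
  define N' where "N' = Max (insert 0 (N ` {..<?p}))"
  have "St (\<lambda>_. N') \<subseteq> St (\<lambda>_. N c)" if "c < ?p" for c
    unfolding N'_def using that by (intro stabilizer_mono Max_ge) auto
  then have "\<forall>c < ?p. \<forall>n'. F l (i, c) n n' = id_mat n n' \<and> F l (i, c) n' n = id_mat n' n"
    if "l \<in> St (\<lambda>_. N')" for l
    using N that by blast
  then have "\<forall>l \<in> St (\<lambda>_. N'). \<forall>y. E l i x y = id_mat x y \<and> E l i y x = id_mat y x"
    unfolding E_entry[OF i] by (intro ballI allI n) simp
  then show ?thesis ..
qed

text \<open>
  By \<open>E_fixes\<close>, elements of \<open>L\<close> that fix enough basis vectors act trivially on the finite set of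
  basis vectors where \<open>g\<close> is not the identity.
\<close>

lemma St_commute:
  assumes g: "g \<in> carrier G"
  obtains N where "\<And>l. l \<in> St (\<lambda>_. N) \<Longrightarrow> E l \<otimes>\<^bsub>G\<^esub> g = g \<otimes>\<^bsub>G\<^esub> E l"
proof -
  have fin: "finite_mat (g i)" if "i < length Gs" for i
    using g that classical_mats_finite by (auto simp: G_carrier)
  have "\<exists>N. \<forall>l \<in> St (\<lambda>_. N). mat_mul (E l i) (g i) = mat_mul (g i) (E l i)" if i: "i < length Gs" for i
  proof -
    obtain X where X: "finite X" "\<And>x y. x \<notin> X \<or> y \<notin> X \<Longrightarrow> g i x y = id_mat x y"
      using fin[OF i] unfolding finite_mat_iff by blast
    obtain N where N: "\<And>x l y. l \<in> St (\<lambda>_. N x) \<Longrightarrow> E l i x y = id_mat x y \<and> E l i y x = id_mat y x"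
      using E_fixes[OF i] by metis
    define N' where "N' = Max (insert 0 (N ` X))"
    have sub: "St (\<lambda>_. N') \<subseteq> St (\<lambda>_. N x)" if "x \<in> X" for x
      unfolding N'_def using that X(1) by (intro stabilizer_mono Max_ge) auto
    have "mat_mul (E l i) (g i) = mat_mul (g i) (E l i)" if l: "l \<in> St (\<lambda>_. N')" for l
    proof (rule disjoint_mats_commute[OF _ _ X(2)])
      show "row_finite (g i)"
        by (rule finite_mat_row_finite[OF fin[OF i]])
      have "E l i \<in> classical_mats (Gs ! i)"
        using E_carrier[OF St_carrier[OF l]] i by (simp add: G_carrier)
      then show "row_finite (E l i)"
        by (intro finite_mat_row_finite classical_mats_finite)
      show "E l i x y = id_mat x y" if "x \<in> X \<or> y \<in> X" for x y
        using that N sub l by blast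
    qed
    then show ?thesis
      by blast
  qed
  then obtain N where N: "\<And>i l. i < length Gs \<Longrightarrow> l \<in> St (\<lambda>_. N i) \<Longrightarrow>
      mat_mul (E l i) (g i) = mat_mul (g i) (E l i)"
    by metis
  define N' where "N' = Max (insert 0 (N ` {..<length Gs}))"
  have sub: "St (\<lambda>_. N') \<subseteq> St (\<lambda>_. N i)" if "i < length Gs" for i
    unfolding N'_def using that by (intro stabilizer_mono Max_ge) auto
  show thesis
  proof (rule that[of N'])
    show "E l \<otimes>\<^bsub>G\<^esub> g = g \<otimes>\<^bsub>G\<^esub> E l" if "l \<in> St (\<lambda>_. N')" for l
      unfolding G_mult using N sub that by (intro restrict_ext) auto
  qed
qed


section \<open>Multiplication of double cosets\<close>

lemma mem_dcoset:
  "x \<in> dcoset Gs Ls F \<gamma> g \<alpha> \<longleftrightarrow> (\<exists>a \<in> St \<gamma>. \<exists>b \<in> St \<alpha>. x = E a \<otimes>\<^bsub>G\<^esub> g \<otimes>\<^bsub>G\<^esub> E b)"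
  by (auto simp: dcoset_def set_mult_def)

lemma dcoset_self:
  assumes "g \<in> carrier G"
  shows "g \<in> dcoset Gs Ls F \<gamma> g \<alpha>"
  unfolding mem_dcoset
  using assms subgroup.one_closed[OF stabilizer_subgroup] by (intro bexI[of _ "\<one>\<^bsub>L\<^esub>"]) (simp_all add: E_one)

lemma dcoset_absorb_subset:
  assumes a: "a \<in> St \<gamma>" and b: "b \<in> St \<alpha>" and g: "g \<in> carrier G"
  shows "dcoset Gs Ls F \<gamma> (E a \<otimes>\<^bsub>G\<^esub> g \<otimes>\<^bsub>G\<^esub> E b) \<alpha> \<subseteq> dcoset Gs Ls F \<gamma> g \<alpha>"
proof
  fix x assume "x \<in> dcoset Gs Ls F \<gamma> (E a \<otimes>\<^bsub>G\<^esub> g \<otimes>\<^bsub>G\<^esub> E b) \<alpha>"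
  then obtain a' b' where ab: "a' \<in> St \<gamma>" "b' \<in> St \<alpha>"
    and x: "x = E a' \<otimes>\<^bsub>G\<^esub> (E a \<otimes>\<^bsub>G\<^esub> g \<otimes>\<^bsub>G\<^esub> E b) \<otimes>\<^bsub>G\<^esub> E b'"
    unfolding mem_dcoset by blast
  have "x = E (a' \<otimes>\<^bsub>L\<^esub> a) \<otimes>\<^bsub>G\<^esub> g \<otimes>\<^bsub>G\<^esub> E (b \<otimes>\<^bsub>L\<^esub> b')"
    using ab a b g by (simp add: x E_mult E_carrier St_carrier G.m_assoc)
  moreover have "a' \<otimes>\<^bsub>L\<^esub> a \<in> St \<gamma>" "b \<otimes>\<^bsub>L\<^esub> b' \<in> St \<alpha>"
    using ab a b subgroup.m_closed[OF stabilizer_subgroup] by blast+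
  ultimately show "x \<in> dcoset Gs Ls F \<gamma> g \<alpha>"
    unfolding mem_dcoset by blast
qed

lemma dcoset_absorb:
  assumes a: "a \<in> St \<gamma>" and b: "b \<in> St \<alpha>" and g: "g \<in> carrier G"
  shows "dcoset Gs Ls F \<gamma> (E a \<otimes>\<^bsub>G\<^esub> g \<otimes>\<^bsub>G\<^esub> E b) \<alpha> = dcoset Gs Ls F \<gamma> g \<alpha>"
proof
  let ?h = "E a \<otimes>\<^bsub>G\<^esub> g \<otimes>\<^bsub>G\<^esub> E b"
  note c = St_carrier[OF a] St_carrier[OF b]
  have "E (inv\<^bsub>L\<^esub> a) \<otimes>\<^bsub>G\<^esub> ?h \<otimes>\<^bsub>G\<^esub> E (inv\<^bsub>L\<^esub> b) =
      (E (inv\<^bsub>L\<^esub> a) \<otimes>\<^bsub>G\<^esub> E a) \<otimes>\<^bsub>G\<^esub> g \<otimes>\<^bsub>G\<^esub> (E b \<otimes>\<^bsub>G\<^esub> E (inv\<^bsub>L\<^esub> b))"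
    using c g by (simp add: E_carrier G.m_assoc)
  also have "\<dots> = g"
    using c g by (simp add: E_mult[symmetric] E_one)
  finally have "dcoset Gs Ls F \<gamma> g \<alpha> = dcoset Gs Ls F \<gamma> (E (inv\<^bsub>L\<^esub> a) \<otimes>\<^bsub>G\<^esub> ?h \<otimes>\<^bsub>G\<^esub> E (inv\<^bsub>L\<^esub> b)) \<alpha>"
    by simp
  also have "\<dots> \<subseteq> dcoset Gs Ls F \<gamma> ?h \<alpha>"
    using a b c g subgroup.m_inv_closed[OF stabilizer_subgroup]
    by (intro dcoset_absorb_subset) (auto simp: E_carrier)
  finally show "dcoset Gs Ls F \<gamma> g \<alpha> \<subseteq> dcoset Gs Ls F \<gamma> ?h \<alpha>" .
qed (rule dcoset_absorb_subset[OF assms])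

lemma dcosetsE:
  assumes "\<gg> \<in> dcosets Gs Ls F \<gamma> \<alpha>" "x \<in> \<gg>"
  shows "x \<in> carrier G" "\<gg> = dcoset Gs Ls F \<gamma> x \<alpha>"
proof -
  obtain g where g: "g \<in> carrier G" "\<gg> = dcoset Gs Ls F \<gamma> g \<alpha>"
    using assms(1) by (auto simp: dcosets_def)
  then obtain a b where ab: "a \<in> St \<gamma>" "b \<in> St \<alpha>" "x = E a \<otimes>\<^bsub>G\<^esub> g \<otimes>\<^bsub>G\<^esub> E b"
    using assms(2) by (auto simp: mem_dcoset)
  then show "x \<in> carrier G"
    using g(1) by (simp add: E_carrier St_carrier)
  show "\<gg> = dcoset Gs Ls F \<gamma> x \<alpha>"
    using dcoset_absorb[OF ab(1,2) g(1)] g(2) ab(3) by simp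
qed

lemma multiindex_bound: "\<exists>N. \<forall>j < length Ls. \<alpha> j \<le> (N::nat)"
proof -
  have "\<forall>j < length Ls. \<alpha> j \<le> Max (insert 0 (\<alpha> ` {..<length Ls}))"
    by (auto intro!: Max_ge)
  then show ?thesis ..
qed

lemma St_antimono: "N \<le> N' \<Longrightarrow> St (\<lambda>_. N') \<subseteq> St (\<lambda>_. N)"
  by (rule stabilizer_mono)

text \<open>
  The double cosets for \<open>m\<close> and for \<open>m'\<close> are both compared with the one for \<open>m + m'\<close>: the factors
  from \<open>Theta_shift\<close> pass through \<open>g\<close> and \<open>h\<close>, and end up in \<open>L\<^sup>\<gamma>\<close> and \<open>L\<^sup>\<alpha>\<close>.
\<close>

lemma Theta_dcoset_stable:
  assumes g: "g \<in> carrier G" and h: "h \<in> carrier G"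
  obtains D where "D \<in> dcosets Gs Ls F \<gamma> \<alpha>" "eventual_dcoset Gs Ls F \<gamma> \<beta> \<alpha> g h D"
proof -
  obtain N1 where N1: "\<And>l. l \<in> St (\<lambda>_. N1) \<Longrightarrow> E l \<otimes>\<^bsub>G\<^esub> g = g \<otimes>\<^bsub>G\<^esub> E l"
    using St_commute[OF g] by blast
  obtain N2 where N2: "\<And>l. l \<in> St (\<lambda>_. N2) \<Longrightarrow> E l \<otimes>\<^bsub>G\<^esub> h = h \<otimes>\<^bsub>G\<^esub> E l"
    using St_commute[OF h] by blast
  obtain N3 where N3: "\<forall>j < length Ls. \<alpha> j \<le> N3"
    using multiindex_bound by blast
  obtain N4 where N4: "\<forall>j < length Ls. \<beta> j \<le> N4"
    using multiindex_bound by blast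
  obtain N5 where N5: "\<forall>j < length Ls. \<gamma> j \<le> N5"
    using multiindex_bound by blast
  define N where "N = N1 + N2 + N3 + N4 + N5"
  let ?D = "\<lambda>m. Theta_dcoset Gs Ls F \<gamma> \<beta> \<alpha> m g h"
  have shift: "?D (\<lambda>j. m j + m' j) = ?D m"
    if m: "\<forall>j < length Ls. N \<le> m j" and m': "\<forall>j < length Ls. N \<le> m' j" for m m'
  proof -
    have "\<beta> j \<le> N" if "j < length Ls" for j
      using N4 that by (simp add: N_def trans_le_add1 trans_le_add2)
    then obtain s t where s: "s \<in> St (\<lambda>_. N)" and t: "t \<in> St (\<lambda>_. N)"
      and eq: "T \<beta> (\<lambda>j. m j + m' j) = s \<otimes>\<^bsub>L\<^esub> T \<beta> m \<otimes>\<^bsub>L\<^esub> t"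
      using Theta_shift[of Ls \<beta> N m m'] m m' by blast
    note c = E_carrier[OF St_carrier[OF s]] E_carrier[OF St_carrier[OF t]] E_carrier[OF Theta_carrier, of \<beta> m]
    have "g \<otimes>\<^bsub>G\<^esub> E (T \<beta> (\<lambda>j. m j + m' j)) \<otimes>\<^bsub>G\<^esub> h =
        (g \<otimes>\<^bsub>G\<^esub> E s) \<otimes>\<^bsub>G\<^esub> E (T \<beta> m) \<otimes>\<^bsub>G\<^esub> (E t \<otimes>\<^bsub>G\<^esub> h)"
      using c g h St_carrier[OF s] St_carrier[OF t] by (simp add: eq E_mult Theta_carrier G.m_assoc)
    also have "g \<otimes>\<^bsub>G\<^esub> E s = E s \<otimes>\<^bsub>G\<^esub> g"
      using N1 s St_antimono[of N1 N] by (auto simp: N_def)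
    also have "E t \<otimes>\<^bsub>G\<^esub> h = h \<otimes>\<^bsub>G\<^esub> E t"
      using N2 t St_antimono[of N2 N] by (auto simp: N_def)
    also have "E s \<otimes>\<^bsub>G\<^esub> g \<otimes>\<^bsub>G\<^esub> E (T \<beta> m) \<otimes>\<^bsub>G\<^esub> (h \<otimes>\<^bsub>G\<^esub> E t) =
        E s \<otimes>\<^bsub>G\<^esub> (g \<otimes>\<^bsub>G\<^esub> E (T \<beta> m) \<otimes>\<^bsub>G\<^esub> h) \<otimes>\<^bsub>G\<^esub> E t"
      using c g h by (simp add: G.m_assoc)
    finally have "?D (\<lambda>j. m j + m' j) =
        dcoset Gs Ls F \<gamma> (E s \<otimes>\<^bsub>G\<^esub> (g \<otimes>\<^bsub>G\<^esub> E (T \<beta> m) \<otimes>\<^bsub>G\<^esub> h) \<otimes>\<^bsub>G\<^esub> E t) \<alpha>"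
      unfolding Theta_dcoset_def by simp
    also have "\<dots> = ?D m"
      unfolding Theta_dcoset_def
    proof (rule dcoset_absorb)
      show "s \<in> St \<gamma>" "t \<in> St \<alpha>"
        using s t N3 N5 stabilizer_mono[of Ls \<gamma> "\<lambda>_. N"] stabilizer_mono[of Ls \<alpha> "\<lambda>_. N"]
        by (auto simp: N_def trans_le_add1 trans_le_add2)
    qed (use c g h in simp)
    finally show ?thesis .
  qed
  have "?D m = ?D (\<lambda>_. N)" if m: "\<forall>j < length Ls. N \<le> m j" for m
    using shift[OF m, of "\<lambda>_. N"] shift[OF _ m, of "\<lambda>_. N"] by (simp add: add.commute)
  then have "eventual_dcoset Gs Ls F \<gamma> \<beta> \<alpha> g h (?D (\<lambda>_. N))"
    unfolding eventual_dcoset_def by blast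
  moreover have "?D (\<lambda>_. N) \<in> dcosets Gs Ls F \<gamma> \<alpha>"
    using g h by (auto simp: Theta_dcoset_def dcosets_def E_carrier Theta_carrier)
  ultimately show thesis
    by (rule that[rotated])
qed

end


context GL_pair_embedding
begin

text \<open>
  Changing the representatives \<open>g\<close> and \<open>h\<close> inserts an element \<open>b\<close> of \<open>L\<^sup>\<beta>\<close> next to
  \<open>\<Theta>\<close>.  Its conjugate by \<open>\<Theta>\<close> acts far away for large \<open>m\<close>; so it can be moved through
  \<open>h\<close>, respectively \<open>g\<close>, and is absorbed.
\<close>

lemma Theta_dcoset_left_indep:
  assumes g: "g \<in> carrier G" and h: "h \<in> carrier G" and a: "a \<in> St \<gamma>" and b: "b \<in> St \<beta>"
  obtains M where "\<And>m. (\<And>j. j < length Ls \<Longrightarrow> M \<le> m j) \<Longrightarrow>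
    Theta_dcoset Gs Ls F \<gamma> \<beta> \<alpha> m (E a \<otimes>\<^bsub>G\<^esub> g \<otimes>\<^bsub>G\<^esub> E b) h = Theta_dcoset Gs Ls F \<gamma> \<beta> \<alpha> m g h"
proof -
  obtain N1 where N1: "\<And>l. l \<in> St (\<lambda>_. N1) \<Longrightarrow> E l \<otimes>\<^bsub>G\<^esub> h = h \<otimes>\<^bsub>G\<^esub> E l"
    using St_commute[OF h] by blast
  obtain N2 where N2: "\<forall>j < length Ls. \<alpha> j \<le> N2"
    using multiindex_bound by blast
  obtain M where M: "\<And>N m. (\<And>j. j < length Ls \<Longrightarrow> M \<le> m j \<and> N \<le> m j) \<Longrightarrow>
      T \<beta> m \<otimes>\<^bsub>L\<^esub> b \<otimes>\<^bsub>L\<^esub> T \<beta> m \<in> St (\<lambda>_. N)"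
    using Theta_conj_stabilizer[OF b] by blast
  define N where "N = N1 + N2"
  show thesis
  proof (rule that[of "M + N"])
    fix m assume m: "\<And>j. j < length Ls \<Longrightarrow> M + N \<le> m j"
    define b' where "b' = T \<beta> m \<otimes>\<^bsub>L\<^esub> b \<otimes>\<^bsub>L\<^esub> T \<beta> m"
    have b': "b' \<in> St (\<lambda>_. N)"
      unfolding b'_def using m by (intro M) (meson add_leE)
    note cL = Theta_carrier[of Ls \<beta> m] St_carrier[OF a] St_carrier[OF b] St_carrier[OF b']
    note c = cL[THEN E_carrier]
    have "T \<beta> m \<otimes>\<^bsub>L\<^esub> b' = (T \<beta> m \<otimes>\<^bsub>L\<^esub> T \<beta> m) \<otimes>\<^bsub>L\<^esub> b \<otimes>\<^bsub>L\<^esub> T \<beta> m"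
      unfolding b'_def using cL by (simp add: L.m_assoc)
    then have bT: "b \<otimes>\<^bsub>L\<^esub> T \<beta> m = T \<beta> m \<otimes>\<^bsub>L\<^esub> b'"
      using cL by (simp add: Theta_square)
    have "E a \<otimes>\<^bsub>G\<^esub> g \<otimes>\<^bsub>G\<^esub> E b \<otimes>\<^bsub>G\<^esub> E (T \<beta> m) \<otimes>\<^bsub>G\<^esub> h = E a \<otimes>\<^bsub>G\<^esub> g \<otimes>\<^bsub>G\<^esub> E (b \<otimes>\<^bsub>L\<^esub> T \<beta> m) \<otimes>\<^bsub>G\<^esub> h"
      using c g h cL by (simp add: E_mult G.m_assoc)
    also have "\<dots> = E a \<otimes>\<^bsub>G\<^esub> g \<otimes>\<^bsub>G\<^esub> E (T \<beta> m) \<otimes>\<^bsub>G\<^esub> (E b' \<otimes>\<^bsub>G\<^esub> h)"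
      using c g h cL unfolding bT by (simp add: E_mult G.m_assoc)
    also have "E b' \<otimes>\<^bsub>G\<^esub> h = h \<otimes>\<^bsub>G\<^esub> E b'"
      using N1 b' St_antimono[of N1 N] by (auto simp: N_def)
    also have "E a \<otimes>\<^bsub>G\<^esub> g \<otimes>\<^bsub>G\<^esub> E (T \<beta> m) \<otimes>\<^bsub>G\<^esub> (h \<otimes>\<^bsub>G\<^esub> E b') =
        E a \<otimes>\<^bsub>G\<^esub> (g \<otimes>\<^bsub>G\<^esub> E (T \<beta> m) \<otimes>\<^bsub>G\<^esub> h) \<otimes>\<^bsub>G\<^esub> E b'"
      using c g h by (simp add: G.m_assoc)
    finally have "Theta_dcoset Gs Ls F \<gamma> \<beta> \<alpha> m (E a \<otimes>\<^bsub>G\<^esub> g \<otimes>\<^bsub>G\<^esub> E b) h =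
        dcoset Gs Ls F \<gamma> (E a \<otimes>\<^bsub>G\<^esub> (g \<otimes>\<^bsub>G\<^esub> E (T \<beta> m) \<otimes>\<^bsub>G\<^esub> h) \<otimes>\<^bsub>G\<^esub> E b') \<alpha>"
      unfolding Theta_dcoset_def by simp
    also have "\<dots> = Theta_dcoset Gs Ls F \<gamma> \<beta> \<alpha> m g h"
      unfolding Theta_dcoset_def
    proof (rule dcoset_absorb[OF a])
      show "b' \<in> St \<alpha>"
        using b' N2 stabilizer_mono[of Ls \<alpha> "\<lambda>_. N"] by (auto simp: N_def trans_le_add2)
    qed (use c g h in simp)
    finally show "Theta_dcoset Gs Ls F \<gamma> \<beta> \<alpha> m (E a \<otimes>\<^bsub>G\<^esub> g \<otimes>\<^bsub>G\<^esub> E b) h = Theta_dcoset Gs Ls F \<gamma> \<beta> \<alpha> m g h" .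
  qed
qed

lemma Theta_dcoset_right_indep:
  assumes g: "g \<in> carrier G" and h: "h \<in> carrier G" and b: "b \<in> St \<beta>" and a: "a \<in> St \<alpha>"
  obtains M where "\<And>m. (\<And>j. j < length Ls \<Longrightarrow> M \<le> m j) \<Longrightarrow>
    Theta_dcoset Gs Ls F \<gamma> \<beta> \<alpha> m g (E b \<otimes>\<^bsub>G\<^esub> h \<otimes>\<^bsub>G\<^esub> E a) = Theta_dcoset Gs Ls F \<gamma> \<beta> \<alpha> m g h"
proof -
  obtain N1 where N1: "\<And>l. l \<in> St (\<lambda>_. N1) \<Longrightarrow> E l \<otimes>\<^bsub>G\<^esub> g = g \<otimes>\<^bsub>G\<^esub> E l"
    using St_commute[OF g] by blast
  obtain N2 where N2: "\<forall>j < length Ls. \<gamma> j \<le> N2"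
    using multiindex_bound by blast
  obtain M where M: "\<And>N m. (\<And>j. j < length Ls \<Longrightarrow> M \<le> m j \<and> N \<le> m j) \<Longrightarrow>
      T \<beta> m \<otimes>\<^bsub>L\<^esub> b \<otimes>\<^bsub>L\<^esub> T \<beta> m \<in> St (\<lambda>_. N)"
    using Theta_conj_stabilizer[OF b] by blast
  define N where "N = N1 + N2"
  show thesis
  proof (rule that[of "M + N"])
    fix m assume m: "\<And>j. j < length Ls \<Longrightarrow> M + N \<le> m j"
    define b' where "b' = T \<beta> m \<otimes>\<^bsub>L\<^esub> b \<otimes>\<^bsub>L\<^esub> T \<beta> m"
    have b': "b' \<in> St (\<lambda>_. N)"
      unfolding b'_def using m by (intro M) (meson add_leE)
    note cL = Theta_carrier[of Ls \<beta> m] St_carrier[OF a] St_carrier[OF b] St_carrier[OF b']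
    note c = cL[THEN E_carrier]
    have "b' \<otimes>\<^bsub>L\<^esub> T \<beta> m = T \<beta> m \<otimes>\<^bsub>L\<^esub> b \<otimes>\<^bsub>L\<^esub> (T \<beta> m \<otimes>\<^bsub>L\<^esub> T \<beta> m)"
      unfolding b'_def using cL by (simp add: L.m_assoc)
    then have Tb: "T \<beta> m \<otimes>\<^bsub>L\<^esub> b = b' \<otimes>\<^bsub>L\<^esub> T \<beta> m"
      using cL by (simp add: Theta_square)
    have "g \<otimes>\<^bsub>G\<^esub> E (T \<beta> m) \<otimes>\<^bsub>G\<^esub> (E b \<otimes>\<^bsub>G\<^esub> h \<otimes>\<^bsub>G\<^esub> E a) = g \<otimes>\<^bsub>G\<^esub> E (T \<beta> m \<otimes>\<^bsub>L\<^esub> b) \<otimes>\<^bsub>G\<^esub> h \<otimes>\<^bsub>G\<^esub> E a"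
      using c g h cL by (simp add: E_mult G.m_assoc)
    also have "\<dots> = (g \<otimes>\<^bsub>G\<^esub> E b') \<otimes>\<^bsub>G\<^esub> E (T \<beta> m) \<otimes>\<^bsub>G\<^esub> h \<otimes>\<^bsub>G\<^esub> E a"
      using c g h cL unfolding Tb by (simp add: E_mult G.m_assoc)
    also have "g \<otimes>\<^bsub>G\<^esub> E b' = E b' \<otimes>\<^bsub>G\<^esub> g"
      using N1 b' St_antimono[of N1 N] by (auto simp: N_def)
    also have "E b' \<otimes>\<^bsub>G\<^esub> g \<otimes>\<^bsub>G\<^esub> E (T \<beta> m) \<otimes>\<^bsub>G\<^esub> h \<otimes>\<^bsub>G\<^esub> E a =
        E b' \<otimes>\<^bsub>G\<^esub> (g \<otimes>\<^bsub>G\<^esub> E (T \<beta> m) \<otimes>\<^bsub>G\<^esub> h) \<otimes>\<^bsub>G\<^esub> E a"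
      using c g h by (simp add: G.m_assoc)
    finally have "Theta_dcoset Gs Ls F \<gamma> \<beta> \<alpha> m g (E b \<otimes>\<^bsub>G\<^esub> h \<otimes>\<^bsub>G\<^esub> E a) =
        dcoset Gs Ls F \<gamma> (E b' \<otimes>\<^bsub>G\<^esub> (g \<otimes>\<^bsub>G\<^esub> E (T \<beta> m) \<otimes>\<^bsub>G\<^esub> h) \<otimes>\<^bsub>G\<^esub> E a) \<alpha>"
      unfolding Theta_dcoset_def by simp
    also have "\<dots> = Theta_dcoset Gs Ls F \<gamma> \<beta> \<alpha> m g h"
      unfolding Theta_dcoset_def
    proof (rule dcoset_absorb[OF _ a])
      show "b' \<in> St \<gamma>"
        using b' N2 stabilizer_mono[of Ls \<gamma> "\<lambda>_. N"] by (auto simp: N_def trans_le_add2)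
    qed (use c g h in simp)
    finally show "Theta_dcoset Gs Ls F \<gamma> \<beta> \<alpha> m g (E b \<otimes>\<^bsub>G\<^esub> h \<otimes>\<^bsub>G\<^esub> E a) = Theta_dcoset Gs Ls F \<gamma> \<beta> \<alpha> m g h" .
  qed
qed

lemma eventual_dcoset_indep:
  assumes ev: "eventual_dcoset Gs Ls F \<gamma> \<beta> \<alpha> g h D"
    and g: "g \<in> carrier G" "g' \<in> dcoset Gs Ls F \<gamma> g \<beta>"
    and h: "h \<in> carrier G" "h' \<in> dcoset Gs Ls F \<beta> h \<alpha>"
  shows "eventual_dcoset Gs Ls F \<gamma> \<beta> \<alpha> g' h' D"
proof -
  obtain a b where ab: "a \<in> St \<gamma>" "b \<in> St \<beta>" and g': "g' = E a \<otimes>\<^bsub>G\<^esub> g \<otimes>\<^bsub>G\<^esub> E b"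
    using g(2) by (auto simp: mem_dcoset)
  obtain c d where cd: "c \<in> St \<beta>" "d \<in> St \<alpha>" and h': "h' = E c \<otimes>\<^bsub>G\<^esub> h \<otimes>\<^bsub>G\<^esub> E d"
    using h(2) by (auto simp: mem_dcoset)
  have h'c: "h' \<in> carrier G"
    using h(1) cd by (simp add: h' E_carrier St_carrier)
  obtain M1 where M1: "\<And>m. (\<And>j. j < length Ls \<Longrightarrow> M1 \<le> m j) \<Longrightarrow>
      Theta_dcoset Gs Ls F \<gamma> \<beta> \<alpha> m g' h' = Theta_dcoset Gs Ls F \<gamma> \<beta> \<alpha> m g h'"
    using Theta_dcoset_left_indep[OF g(1) h'c ab] unfolding g' by blast
  obtain M2 where M2: "\<And>m. (\<And>j. j < length Ls \<Longrightarrow> M2 \<le> m j) \<Longrightarrow>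
      Theta_dcoset Gs Ls F \<gamma> \<beta> \<alpha> m g h' = Theta_dcoset Gs Ls F \<gamma> \<beta> \<alpha> m g h"
    using Theta_dcoset_right_indep[OF g(1) h(1) cd] unfolding h' by blast
  obtain M3 where M3: "\<And>m. (\<forall>j < length Ls. M3 \<le> m j) \<Longrightarrow> Theta_dcoset Gs Ls F \<gamma> \<beta> \<alpha> m g h = D"
    using ev unfolding eventual_dcoset_def by blast
  have "Theta_dcoset Gs Ls F \<gamma> \<beta> \<alpha> m g' h' = D" if m: "\<forall>j < length Ls. M1 + M2 + M3 \<le> m j" for m
  proof -
    have "M1 \<le> m j" "M2 \<le> m j" "M3 \<le> m j" if "j < length Ls" for j
      using m that by (meson add_leE)+
    then show ?thesis
      using M1[of m] M2[of m] M3[of m] by simp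
  qed
  then show ?thesis
    unfolding eventual_dcoset_def by blast
qed

lemma eventual_dcoset_unique:
  assumes "eventual_dcoset Gs Ls F \<gamma> \<beta> \<alpha> g h D" "eventual_dcoset Gs Ls F \<gamma> \<beta> \<alpha> g h D'"
  shows "D = D'"
proof -
  obtain M M' where M: "\<And>m. (\<forall>j < length Ls. M \<le> m j) \<Longrightarrow> Theta_dcoset Gs Ls F \<gamma> \<beta> \<alpha> m g h = D"
    and M': "\<And>m. (\<forall>j < length Ls. M' \<le> m j) \<Longrightarrow> Theta_dcoset Gs Ls F \<gamma> \<beta> \<alpha> m g h = D'"
    using assms unfolding eventual_dcoset_def by blast
  show ?thesis
    using M[of "\<lambda>_. M + M'"] M'[of "\<lambda>_. M + M'"] by simp
qed

lemma dcoset_mult_eventual: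
  assumes \<gg>: "\<gg> \<in> dcosets Gs Ls F \<gamma> \<beta>" and \<hh>: "\<hh> \<in> dcosets Gs Ls F \<beta> \<alpha>"
  shows "dcoset_mult Gs Ls F \<gamma> \<beta> \<alpha> \<gg> \<hh> \<in> dcosets Gs Ls F \<gamma> \<alpha>"
    and "g \<in> \<gg> \<Longrightarrow> h \<in> \<hh> \<Longrightarrow>
      eventual_dcoset Gs Ls F \<gamma> \<beta> \<alpha> g h (dcoset_mult Gs Ls F \<gamma> \<beta> \<alpha> \<gg> \<hh>)"
proof -
  obtain g0 where g0: "g0 \<in> carrier G" "\<gg> = dcoset Gs Ls F \<gamma> g0 \<beta>"
    using \<gg> by (auto simp: dcosets_def)
  obtain h0 where h0: "h0 \<in> carrier G" "\<hh> = dcoset Gs Ls F \<beta> h0 \<alpha>"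
    using \<hh> by (auto simp: dcosets_def)
  obtain D where D: "D \<in> dcosets Gs Ls F \<gamma> \<alpha>" "eventual_dcoset Gs Ls F \<gamma> \<beta> \<alpha> g0 h0 D"
    using Theta_dcoset_stable[OF g0(1) h0(1)] .
  have all: "\<forall>g \<in> \<gg>. \<forall>h \<in> \<hh>. eventual_dcoset Gs Ls F \<gamma> \<beta> \<alpha> g h D"
    using eventual_dcoset_indep[OF D(2) g0(1) _ h0(1)] g0(2) h0(2) by blast
  have "g0 \<in> \<gg>" "h0 \<in> \<hh>"
    using g0 h0 dcoset_self by auto
  then have eq: "dcoset_mult Gs Ls F \<gamma> \<beta> \<alpha> \<gg> \<hh> = D"
    unfolding dcoset_mult_def using all D(2) eventual_dcoset_unique by (intro the_equality) blast+
  show "dcoset_mult Gs Ls F \<gamma> \<beta> \<alpha> \<gg> \<hh> \<in> dcosets Gs Ls F \<gamma> \<alpha>"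
    by (simp add: eq D(1))
  show "eventual_dcoset Gs Ls F \<gamma> \<beta> \<alpha> g h (dcoset_mult Gs Ls F \<gamma> \<beta> \<alpha> \<gg> \<hh>)" if "g \<in> \<gg>" "h \<in> \<hh>"
    using that all by (simp add: eq)
qed

end


section \<open>Projections and means in Hilbert spaces\<close>

lemma cinner_add_left: "cinner (x + y) z = cinner x z + cinner y z"
  by (metis cinner_add_right cinner_commute complex_cnj_add)

lemma cinner_scaleC_left: "cinner (scaleC a x) y = cnj a * cinner x y"
  by (metis cinner_scaleC_right cinner_commute complex_cnj_mult)

lemma cinner_scaleR_right: "cinner x (r *\<^sub>R y) = of_real r * cinner x y"
  by (metis cinner_scaleC_right scaleC_of_real)

lemma cinner_scaleR_left: "cinner (r *\<^sub>R x) y = of_real r * cinner x y"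
  by (metis cinner_scaleC_left scaleC_of_real complex_cnj_complex_of_real)

lemma cinner_zero_right [simp]: "cinner x 0 = 0"
  using cinner_add_right[of x 0 0] by simp

lemma cinner_zero_left [simp]: "cinner 0 x = 0"
  using cinner_add_left[of 0 0 x] by simp

lemma cinner_minus_right: "cinner x (- y) = - cinner x y"
  using cinner_add_right[of x y "- y"] by (simp add: add_eq_0_iff)

lemma cinner_diff_right: "cinner x (y - z) = cinner x y - cinner x z"
  using cinner_add_right[of x y "- z"] by (simp add: cinner_minus_right)

lemma cinner_diff_left: "cinner (x - y) z = cinner x z - cinner y z"
  by (metis cinner_diff_right cinner_commute complex_cnj_diff)

lemma cinner_sum_right: "cinner x (sum f A) = (\<Sum>i\<in>A. cinner x (f i))"
  by (induction A rule: infinite_finite_induct) (simp_all add: cinner_add_right)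

lemma cinner_sum_left: "cinner (sum f A) x = (\<Sum>i\<in>A. cinner (f i) x)"
  by (induction A rule: infinite_finite_induct) (simp_all add: cinner_add_left)

lemma norm_add_sq: "(norm (x + y))\<^sup>2 = (norm x)\<^sup>2 + (norm y)\<^sup>2 + 2 * Re (cinner x y)"
proof -
  have "complex_of_real ((norm (x + y))\<^sup>2) =
      complex_of_real ((norm x)\<^sup>2) + complex_of_real ((norm y)\<^sup>2) + (cinner x y + cnj (cinner x y))"
    unfolding cinner_self[symmetric] using cinner_commute[of y x]
    by (simp add: cinner_add_left cinner_add_right)
  also have "\<dots> = complex_of_real ((norm x)\<^sup>2 + (norm y)\<^sup>2 + 2 * Re (cinner x y))"
    by (simp add: complex_add_cnj)
  finally show ?thesis
    by (simp only: of_real_eq_iff)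
qed

lemma cinner_eq_0_self: "cinner x x = 0 \<Longrightarrow> x = 0"
  by (simp add: cinner_self)

text \<open>Continuity follows from polarization.\<close>

lemma tendsto_cinner:
  assumes "f \<longlonglongrightarrow> y"
  shows "(\<lambda>n. cinner x (f n)) \<longlonglongrightarrow> cinner x y"
proof -
  have Re_eq: "Re (cinner u v) = ((norm (u + v))\<^sup>2 - (norm u)\<^sup>2 - (norm v)\<^sup>2) / 2" for u v
    by (simp add: norm_add_sq)
  have Re: "(\<lambda>n. Re (cinner u (f n))) \<longlonglongrightarrow> Re (cinner u y)" for u
    unfolding Re_eq by (intro tendsto_intros assms) simp
  have "Im (cinner x v) = Re (cinner (scaleC \<i> x) v)" for v
    by (simp add: cinner_scaleC_left)
  then have "(\<lambda>n. Im (cinner x (f n))) \<longlonglongrightarrow> Im (cinner x y)"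
    using Re[of "scaleC \<i> x"] by simp
  then show ?thesis
    using Re[of x] by (simp add: tendsto_complex_iff)
qed

lemma convergent_norm_sq_bound:
  fixes x :: "nat \<Rightarrow> 'h::banach"
  assumes "\<And>m n. (norm (x m - x n))\<^sup>2 \<le> C * (1 / real (Suc m) + 1 / real (Suc n))"
  shows "convergent x"
proof -
  have "Cauchy x"
    unfolding Cauchy_iff
  proof (intro allI impI)
    fix e :: real assume e: "0 < e"
    obtain M where M: "2 * \<bar>C\<bar> / e\<^sup>2 < real M"
      using reals_Archimedean2 by blast
    have "norm (x m - x n) < e" if mn: "M \<le> m" "M \<le> n" for m n
    proof -
      have "1 / real (Suc m) \<le> 1 / real (Suc M)" "1 / real (Suc n) \<le> 1 / real (Suc M)"
        using mn by (simp_all add: frac_le)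
      then have "C * (1 / real (Suc m) + 1 / real (Suc n)) \<le> \<bar>C\<bar> * (2 / real (Suc M))"
        by (intro mult_mono) auto
      also have "\<dots> < e\<^sup>2"
      proof -
        have "2 * \<bar>C\<bar> < real M * e\<^sup>2"
          using M e by (simp add: field_simps)
        also have "\<dots> \<le> real (Suc M) * e\<^sup>2"
          by (intro mult_right_mono) auto
        finally show ?thesis
          by (simp add: field_simps)
      qed
      finally have "(norm (x m - x n))\<^sup>2 < e\<^sup>2"
        using assms[of m n] by simp
      then show ?thesis
        using e by (simp add: power_less_imp_less_base)
    qed
    then show "\<exists>M. \<forall>m\<ge>M. \<forall>n\<ge>M. norm (x m - x n) < e"
      by blast
  qed
  then show ?thesis
    by (simp add: Cauchy_convergent_iff)
qed

definition closed_csubspace :: "'h::complex_hilbert_space set \<Rightarrow> bool"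
  where "closed_csubspace S \<longleftrightarrow> 0 \<in> S \<and> (\<forall>x\<in>S. \<forall>y\<in>S. x + y \<in> S) \<and> (\<forall>a. \<forall>x\<in>S. scaleC a x \<in> S) \<and>
     (\<forall>f y. (\<forall>n::nat. f n \<in> S) \<longrightarrow> f \<longlonglongrightarrow> y \<longrightarrow> y \<in> S)"

text \<open>By the parallelogram law, a sequence in \<open>S\<close> that minimizes the distance to \<open>v\<close> is Cauchy.\<close>

lemma nearest_point_exists:
  fixes S :: "'h::complex_hilbert_space set"
  assumes S: "closed_csubspace S"
  obtains w where "w \<in> S" "\<And>s. s \<in> S \<Longrightarrow> norm (v - w) \<le> norm (v - s)"
proof -
  define D where "D = (INF s\<in>S. (norm (v - s))\<^sup>2)"
  have ne: "S \<noteq> {}"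
    using S by (auto simp: closed_csubspace_def)
  have bdd: "bdd_below ((\<lambda>s. (norm (v - s))\<^sup>2) ` S)"
    by (rule bdd_belowI[of _ 0]) auto
  have D_le: "D \<le> (norm (v - s))\<^sup>2" if "s \<in> S" for s
    unfolding D_def using bdd that by (rule cINF_lower)
  have "\<exists>s\<in>S. (norm (v - s))\<^sup>2 < D + 1 / real (Suc n)" for n
    using cINF_less_iff[OF ne bdd, of "D + 1 / real (Suc n)"] by (simp add: D_def)
  then obtain f where f: "\<And>n. f n \<in> S" "\<And>n. (norm (v - f n))\<^sup>2 < D + 1 / real (Suc n)"
    by metis
  have "(norm (f m - f n))\<^sup>2 \<le> 2 * (1 / real (Suc m) + 1 / real (Suc n))" for m n
  proof -
    let ?p = "v - f m" and ?q = "v - f n"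
    have half: "(1/2) *\<^sub>R (f m + f n) \<in> S"
      using S f(1) unfolding closed_csubspace_def by (metis scaleC_of_real)
    have "(norm (?p + ?q))\<^sup>2 + (norm (?p + (- ?q)))\<^sup>2 = 2 * (norm ?p)\<^sup>2 + 2 * (norm ?q)\<^sup>2"
      unfolding norm_add_sq by (simp only: cinner_minus_right norm_minus_cancel) simp
    moreover have "?p + (- ?q) = - (f m - f n)"
      by simp
    moreover have "?p + ?q = 2 *\<^sub>R (v - (1/2) *\<^sub>R (f m + f n))"
      by (simp add: algebra_simps scaleR_2)
    ultimately have "4 * (norm (v - (1/2) *\<^sub>R (f m + f n)))\<^sup>2 + (norm (f m - f n))\<^sup>2 =
        2 * (norm ?p)\<^sup>2 + 2 * (norm ?q)\<^sup>2"
      by (simp only: norm_scaleR norm_minus_cancel power_mult_distrib) simp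
    then show ?thesis
      using D_le[OF half] f(2)[of m] f(2)[of n] by simp
  qed
  then have "convergent f"
    by (rule convergent_norm_sq_bound)
  then obtain w where w: "f \<longlonglongrightarrow> w"
    by (auto simp: convergent_def)
  have "w \<in> S"
    using S f(1) w unfolding closed_csubspace_def by blast
  moreover have "norm (v - w) \<le> norm (v - s)" if "s \<in> S" for s
  proof -
    have "(\<lambda>n. (norm (v - f n))\<^sup>2) \<longlonglongrightarrow> (norm (v - w))\<^sup>2"
      by (intro tendsto_intros w)
    moreover have "(\<lambda>n. D + 1 / real (Suc n)) \<longlonglongrightarrow> D + 0"
      by (intro tendsto_add tendsto_const LIMSEQ_Suc lim_1_over_n)
    ultimately have "(norm (v - w))\<^sup>2 \<le> D + 0"
      using f(2) by (intro LIMSEQ_le) (auto intro: less_imp_le)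
    then have "(norm (v - w))\<^sup>2 \<le> (norm (v - s))\<^sup>2"
      using D_le[OF \<open>s \<in> S\<close>] by linarith
    then show ?thesis
      by (rule power2_le_imp_le) (rule norm_ge_zero)
  qed
  ultimately show thesis
    by (rule that)
qed

lemma orthogonal_projection_unique:
  assumes S: "closed_csubspace S" and w: "w \<in> S" "\<And>s. s \<in> S \<Longrightarrow> cinner s (v - w) = 0"
  shows "orthogonal_projection S v = w"
  unfolding orthogonal_projection_def
proof (rule the_equality)
  fix w' assume w': "w' \<in> S \<and> (\<forall>s\<in>S. cinner s (v - w') = 0)"
  have "scaleC (of_real (-1)) w' \<in> S"
    using S w' unfolding closed_csubspace_def by blast
  then have "- w' \<in> S"
    unfolding scaleC_of_real by simp
  then have "w + (- w') \<in> S"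
    using S w(1) unfolding closed_csubspace_def by blast
  then have d: "w - w' \<in> S"
    by simp
  have "cinner (w - w') (w - w') = cinner (w - w') ((v - w') - (v - w))"
    by simp
  also have "\<dots> = 0"
    using w(2)[OF d] w' d by (simp only: cinner_diff_right) simp
  finally have "w - w' = 0"
    by (rule cinner_eq_0_self)
  then show "w' = w"
    by simp
qed (use w in auto)

lemma orthogonal_projection:
  fixes S :: "'h::complex_hilbert_space set"
  assumes S: "closed_csubspace S"
  shows "orthogonal_projection S v \<in> S" "s \<in> S \<Longrightarrow> cinner s (v - orthogonal_projection S v) = 0"
proof -
  obtain w where w: "w \<in> S" "\<And>s. s \<in> S \<Longrightarrow> norm (v - w) \<le> norm (v - s)"
    using nearest_point_exists[OF S] by blast
  have orth: "cinner s (v - w) = 0" if s: "s \<in> S" for s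
  proof (rule ccontr)
    define a where "a = cinner s (v - w)"
    define A B where "A = (cmod a)\<^sup>2" and "B = (norm (scaleC a s))\<^sup>2"
    \<comment> \<open>any positive \<open>t\<close> with \<open>t * B < 2 * A\<close> would do: it makes \<open>w + t a s\<close> closer to \<open>v\<close> than \<open>w\<close>\<close>
    define t where "t = A / (B + 1)"
    assume "cinner s (v - w) \<noteq> 0"
    then have A: "0 < A" and B: "0 \<le> B"
      by (simp_all add: A_def B_def a_def)
    then have t: "0 < t"
      by (simp add: t_def)
    have "scaleC (of_real t) (scaleC a s) \<in> S"
      using S s unfolding closed_csubspace_def by blast
    then have "w + t *\<^sub>R scaleC a s \<in> S"
      using S w(1) unfolding closed_csubspace_def scaleC_of_real by blast
    then have "(norm (v - w))\<^sup>2 \<le> (norm (v - (w + t *\<^sub>R scaleC a s)))\<^sup>2"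
      by (intro power_mono w(2)) auto
    also have "v - (w + t *\<^sub>R scaleC a s) = (- t) *\<^sub>R scaleC a s + (v - w)"
      by simp
    also have "(norm \<dots>)\<^sup>2 = t\<^sup>2 * B + (norm (v - w))\<^sup>2 + 2 * Re (- of_real t * (cnj a * a))"
      by (simp only: norm_add_sq cinner_scaleR_left cinner_scaleC_left norm_scaleR power_mult_distrib
          B_def a_def[symmetric]) simp
    also have "- of_real t * (cnj a * a) = of_real (- t * A)"
      by (simp add: A_def complex_norm_square mult.commute del: of_real_power)
    finally have "t * (2 * A) \<le> t * (t * B)"
      by (simp add: power2_eq_square algebra_simps)
    then have "2 * A \<le> t * B"
      using t by simp
    also have "t * B \<le> A"
      using A B by (simp add: t_def field_simps)
    finally show False
      using A by simp
  qed
  have "orthogonal_projection S v = w"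
    by (rule orthogonal_projection_unique[OF S w(1) orth])
  then show "orthogonal_projection S v \<in> S" "s \<in> S \<Longrightarrow> cinner s (v - orthogonal_projection S v) = 0"
    using w(1) orth by simp_all
qed

lemma orthogonal_projection_cong:
  assumes S: "closed_csubspace S" and eq: "\<And>s. s \<in> S \<Longrightarrow> cinner s x = cinner s y"
  shows "orthogonal_projection S x = orthogonal_projection S y"
proof (rule orthogonal_projection_unique[OF S orthogonal_projection(1)[OF S]])
  show "cinner s (x - orthogonal_projection S y) = 0" if "s \<in> S" for s
    using orthogonal_projection(2)[OF S that, of y] eq[OF that] by (simp add: cinner_diff_right)
qed

text \<open>
  All inner products of means are explicit, and the squared distance between the means of \<open>n\<close>
  and of \<open>m\<close> vectors comes out as \<open>\<bar>1/n - 1/m\<bar> (e - d)\<close>.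
\<close>

lemma equiangular_means_convergent:
  fixes x :: "nat \<Rightarrow> 'h::complex_hilbert_space"
  assumes x: "\<And>i j. cinner (x i) (x j) = (if i = j then e else d)"
  shows "convergent (\<lambda>n. (1 / real (Suc n)) *\<^sub>R (\<Sum>i<Suc n. x i))"
proof -
  define y where "y n = (1 / real (Suc n)) *\<^sub>R (\<Sum>i<Suc n. x i)" for n
  have "cinner (\<Sum>i<n. x i) (\<Sum>i<m. x i) = of_nat (n * m) * d + of_nat (min n m) * (e - d)" for n m
  proof -
    have "cinner (\<Sum>i<n. x i) (\<Sum>i<m. x i) = (\<Sum>i<n. \<Sum>j<m. d + (if i = j then e - d else 0))"
      by (subst cinner_sum_left, subst cinner_sum_right) (auto simp: x intro!: sum.cong)
    also have "\<dots> = (\<Sum>i<n. of_nat m * d + (if i \<in> {..<m} then e - d else 0))"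
      by (intro sum.cong) (simp_all add: sum.distrib)
    also have "\<dots> = of_nat (n * m) * d + (\<Sum>i\<in>{..<n} \<inter> {..<m}. e - d)"
      unfolding sum.distrib by (subst sum.inter_restrict) (simp_all add: algebra_simps)
    also have "{..<n} \<inter> {..<m} = {..<min n m}"
      by auto
    finally show ?thesis by simp
  qed
  note sums = this
  have yy: "cinner (y n) (y m) = d + of_real (1 / real (Suc (max n m))) * (e - d)" for n m
  proof -
    define ab :: complex where "ab = of_nat (Suc n) * of_nat (Suc m)"
    have ab: "ab \<noteq> 0"
      by (simp add: ab_def del: of_nat_Suc)
    have min: "of_nat (min (Suc n) (Suc m)) / ab = of_real (1 / real (Suc (max n m)))"
      unfolding ab_def by (cases "n \<le> m") (simp_all add: min_def max_def field_simps del: of_nat_Suc)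
    have "cinner (y n) (y m) = cinner (\<Sum>i<Suc n. x i) (\<Sum>i<Suc m. x i) / ab"
      by (simp add: y_def ab_def cinner_scaleR_left cinner_scaleR_right del: of_nat_Suc sum.lessThan_Suc)
    also have "\<dots> = (ab * d + of_nat (min (Suc n) (Suc m)) * (e - d)) / ab"
      unfolding sums by (simp only: ab_def of_nat_mult)
    also have "\<dots> = d + of_nat (min (Suc n) (Suc m)) / ab * (e - d)"
      using ab by (simp add: add_divide_distrib del: of_nat_min min_Suc_Suc)
    finally show ?thesis
      unfolding min .
  qed
  have "(norm (y m - y n))\<^sup>2 \<le> cmod (e - d) * (1 / real (Suc m) + 1 / real (Suc n))" for m n
  proof -
    define r where "r = 1 / real (Suc m) + 1 / real (Suc n) - 2 / real (Suc (max m n))"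
    have r: "0 \<le> r" "r \<le> 1 / real (Suc m) + 1 / real (Suc n)"
    proof -
      have "1 / real (Suc (max m n)) \<le> 1 / real (Suc m)" "1 / real (Suc (max m n)) \<le> 1 / real (Suc n)"
        by (simp_all add: frac_le)
      then show "0 \<le> r" "r \<le> 1 / real (Suc m) + 1 / real (Suc n)"
        by (simp_all add: r_def)
    qed
    have "complex_of_real ((norm (y m - y n))\<^sup>2) = of_real r * (e - d)"
      unfolding cinner_self[symmetric]
      by (simp add: cinner_diff_left cinner_diff_right yy r_def max.commute algebra_simps del: of_nat_Suc)
    then have "(norm (y m - y n))\<^sup>2 = cmod (of_real r * (e - d))"
      by (metis norm_of_real abs_of_nonneg zero_le_power2)
    also have "\<dots> = r * cmod (e - d)"
      using r(1) by (simp add: norm_mult)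
    also have "\<dots> \<le> cmod (e - d) * (1 / real (Suc m) + 1 / real (Suc n))"
      using mult_left_mono[OF r(2), of "cmod (e - d)"] by (simp only: norm_ge_zero mult.commute)
    finally show ?thesis .
  qed
  then have "convergent y"
    by (rule convergent_norm_sq_bound)
  then show ?thesis
    by (simp add: y_def[abs_def])
qed

lemma means_of_eventually_zero:
  fixes z :: "nat \<Rightarrow> 'h::real_normed_vector"
  assumes "\<And>i. K \<le> i \<Longrightarrow> z i = 0"
  shows "(\<lambda>n. (1 / real (Suc n)) *\<^sub>R (\<Sum>i<Suc n. z i)) \<longlonglongrightarrow> 0"
proof -
  have "(\<lambda>n. (1 / real (Suc n)) *\<^sub>R (\<Sum>i<K. z i)) \<longlonglongrightarrow> 0 *\<^sub>R (\<Sum>i<K. z i)"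
    by (intro tendsto_intros LIMSEQ_Suc lim_1_over_n)
  moreover have "(\<Sum>i<Suc n. z i) = (\<Sum>i<K. z i)" if "K \<le> n" for n
    using assms that by (intro sum.mono_neutral_right) auto
  then have "\<forall>\<^sub>F n in sequentially. (1 / real (Suc n)) *\<^sub>R (\<Sum>i<K. z i) = (1 / real (Suc n)) *\<^sub>R (\<Sum>i<Suc n. z i)"
    by (intro eventually_sequentiallyI[of K]) simp
  ultimately show ?thesis
    by (simp add: tendsto_cong del: of_nat_Suc sum.lessThan_Suc)
qed

text \<open>
  The bound \<open>M\<close> is arbitrary, so the next term is made larger than \<open>M i\<close> for all \<open>i\<close> up to the
  present term.
\<close>

lemma sparse_sequence:
  fixes M :: "nat \<Rightarrow> nat"
  obtains m where "\<And>k. N + k \<le> m k" "\<And>j k. j < k \<Longrightarrow> M (m j) \<le> m k"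
proof -
  define m where "m = rec_nat N (\<lambda>_ n. Suc n + (\<Sum>i\<le>n. M i))"
  have m_Suc: "m (Suc k) = Suc (m k) + (\<Sum>i\<le>m k. M i)" for k
    by (simp add: m_def)
  have "N + k \<le> m k" for k
    by (induction k) (simp_all add: m_Suc, simp add: m_def)
  moreover have "M (m j) \<le> m k" if "j < k" for j k
  proof -
    obtain k' where k': "k = Suc k'" "j \<le> k'"
      using \<open>j < k\<close> less_imp_Suc_add[of j k] by auto
    have "m j \<le> m k'"
      by (rule lift_Suc_mono_le[OF _ k'(2)]) (simp add: m_Suc)
    then have "M (m j) \<le> (\<Sum>i\<le>m k'. M i)"
      by (intro member_le_sum) auto
    then show ?thesis
      by (simp add: k'(1) m_Suc)
  qed
  ultimately show thesis
    using that by blast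
qed


section \<open>Unitary representations\<close>

locale GL_pair_rep = GL_pair_embedding +
  fixes \<rho> :: "(nat \<Rightarrow> (nat + nat) qmat) \<Rightarrow> 'h::complex_hilbert_space \<Rightarrow> 'h"
  assumes rep: "unitary_rep Gs Ls F \<rho>"
begin

abbreviation "H \<equiv> fixed_space Gs Ls F \<rho>"
abbreviation "R l \<equiv> \<rho> (E l)"

lemma rep_unitary: "g \<in> carrier G \<Longrightarrow> unitary_operator (\<rho> g)"
  using rep unfolding unitary_rep_def hom_def by (auto simp: unitary_group_def)

lemma rep_mult: "g \<in> carrier G \<Longrightarrow> h \<in> carrier G \<Longrightarrow> \<rho> (g \<otimes>\<^bsub>G\<^esub> h) v = \<rho> g (\<rho> h v)"
  using rep unfolding unitary_rep_def hom_def by (auto simp: unitary_group_def)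

lemma rep_add: "g \<in> carrier G \<Longrightarrow> \<rho> g (x + y) = \<rho> g x + \<rho> g y"
  and rep_scaleC: "g \<in> carrier G \<Longrightarrow> \<rho> g (scaleC a x) = scaleC a (\<rho> g x)"
  and rep_cinner: "g \<in> carrier G \<Longrightarrow> cinner (\<rho> g x) (\<rho> g y) = cinner x y"
  and rep_surj: "g \<in> carrier G \<Longrightarrow> \<exists>x. \<rho> g x = z"
  using rep_unitary by (auto simp: unitary_operator_def surj_def) metis

lemma rep_scaleR: "g \<in> carrier G \<Longrightarrow> \<rho> g (r *\<^sub>R x) = r *\<^sub>R \<rho> g x"
  using rep_scaleC[of g "of_real r" x] by (simp add: scaleC_of_real)

lemma rep_zero: "g \<in> carrier G \<Longrightarrow> \<rho> g 0 = 0"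
  using rep_scaleR[of g 0 0] by simp

lemma rep_diff: "g \<in> carrier G \<Longrightarrow> \<rho> g (x - y) = \<rho> g x - \<rho> g y"
  using rep_add[of g x "(-1) *\<^sub>R y"] rep_scaleR[of g "-1" y] by simp

lemma rep_sum: "g \<in> carrier G \<Longrightarrow> \<rho> g (sum f A) = (\<Sum>i\<in>A. \<rho> g (f i))"
  by (induction A rule: infinite_finite_induct) (simp_all add: rep_zero rep_add)

lemma rep_norm: "g \<in> carrier G \<Longrightarrow> norm (\<rho> g x) = norm x"
  using rep_cinner[of g x x] by (simp add: cinner_self power2_eq_iff_nonneg del: of_real_power)

lemma rep_inj: "g \<in> carrier G \<Longrightarrow> \<rho> g x = \<rho> g y \<Longrightarrow> x = y"
  using rep_norm[of g "x - y"] by (simp add: rep_diff)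

lemma rep_one: "\<rho> \<one>\<^bsub>G\<^esub> x = x"
  using rep_mult[of "\<one>\<^bsub>G\<^esub>" "\<one>\<^bsub>G\<^esub>" x] by (auto intro: rep_inj)

lemma rep_tendsto:
  assumes g: "g \<in> carrier G" and f: "f \<longlonglongrightarrow> y"
  shows "(\<lambda>n. \<rho> g (f n)) \<longlonglongrightarrow> \<rho> g y"
proof -
  have "(\<lambda>n. norm (f n - y)) \<longlonglongrightarrow> 0"
    using f by (simp add: LIM_zero tendsto_norm_zero)
  then have "(\<lambda>n. norm (\<rho> g (f n) - \<rho> g y)) \<longlonglongrightarrow> 0"
    by (simp add: rep_diff[OF g, symmetric] rep_norm[OF g])
  then show ?thesis
    by (simp add: LIM_zero_iff tendsto_norm_zero_iff)
qed

lemma R_mult: "l \<in> carrier L \<Longrightarrow> l' \<in> carrier L \<Longrightarrow> R (l \<otimes>\<^bsub>L\<^esub> l') v = R l (R l' v)"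
  by (simp add: E_mult E_carrier rep_mult)

lemma H_D: "v \<in> H \<alpha> \<Longrightarrow> l \<in> St \<alpha> \<Longrightarrow> R l v = v"
  by (simp add: fixed_space_def)

lemma H_mono: "(\<And>j. j < length Ls \<Longrightarrow> \<alpha> j \<le> \<beta> j) \<Longrightarrow> H \<alpha> \<subseteq> H \<beta>"
  using stabilizer_mono[of Ls \<alpha> \<beta>] by (auto simp: fixed_space_def)

lemma H_closed_csubspace: "closed_csubspace (H \<alpha>)"
  unfolding closed_csubspace_def
proof (intro conjI ballI allI impI)
  show "0 \<in> H \<alpha>"
    by (simp add: fixed_space_def rep_zero E_carrier St_carrier)
  show "x + y \<in> H \<alpha>" if "x \<in> H \<alpha>" "y \<in> H \<alpha>" for x y
    using that by (simp add: fixed_space_def rep_add E_carrier St_carrier)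
  show "scaleC a x \<in> H \<alpha>" if "x \<in> H \<alpha>" for a x
    using that by (simp add: fixed_space_def rep_scaleC E_carrier St_carrier)
  show "y \<in> H \<alpha>" if f: "\<forall>n. f n \<in> H \<alpha>" "f \<longlonglongrightarrow> y" for f :: "nat \<Rightarrow> 'h" and y
    unfolding fixed_space_def
  proof (intro CollectI ballI)
    fix l assume l: "l \<in> St \<alpha>"
    have "(\<lambda>n. R l (f n)) \<longlonglongrightarrow> R l y"
      by (intro rep_tendsto E_carrier St_carrier[OF l] f(2))
    moreover have "(\<lambda>n. R l (f n)) = f"
      using H_D[OF _ l] f(1) by (simp add: fun_eq_iff)
    ultimately show "R l y = y"
      using f(2) LIMSEQ_unique by auto
  qed
qed

abbreviation proj :: "(nat \<Rightarrow> nat) \<Rightarrow> 'h \<Rightarrow> 'h"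
  where "proj \<alpha> \<equiv> orthogonal_projection (H \<alpha>)"

lemmas proj_mem = orthogonal_projection(1)[OF H_closed_csubspace]
lemmas proj_orth = orthogonal_projection(2)[OF H_closed_csubspace]
lemmas proj_cong = orthogonal_projection_cong[OF H_closed_csubspace]

lemma H_diff: "x \<in> H \<alpha> \<Longrightarrow> y \<in> H \<alpha> \<Longrightarrow> x - y \<in> H \<alpha>"
  by (simp add: fixed_space_def rep_diff E_carrier St_carrier)

lemma cinner_R_left:
  "w \<in> H \<alpha> \<Longrightarrow> l \<in> St \<alpha> \<Longrightarrow> cinner w (R l z) = cinner w z"
  by (metis H_D rep_cinner E_carrier St_carrier)

lemma rho_bar_eq:
  assumes \<gg>: "\<gg> \<in> dcosets Gs Ls F \<beta> \<alpha>" and g: "g \<in> \<gg>"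
  shows "rho_bar Gs Ls F \<rho> \<alpha> \<beta> \<gg> = rho_bar_elt Gs Ls F \<rho> \<alpha> \<beta> g"
proof -
  define g' where "g' = (SOME g. g \<in> \<gg>)"
  have gc: "g \<in> carrier G" and \<gg>_eq: "\<gg> = dcoset Gs Ls F \<beta> g \<alpha>"
    using dcosetsE[OF \<gg> g] by auto
  have "g' \<in> \<gg>"
    unfolding g'_def using someI[of "\<lambda>x. x \<in> \<gg>" g] g by simp
  then obtain a b where a: "a \<in> St \<beta>" and b: "b \<in> St \<alpha>" and g': "g' = E a \<otimes>\<^bsub>G\<^esub> g \<otimes>\<^bsub>G\<^esub> E b"
    unfolding \<gg>_eq by (auto simp: mem_dcoset)
  have "proj \<beta> (\<rho> g' v) = proj \<beta> (\<rho> g v)" if v: "v \<in> H \<alpha>" for v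
  proof (rule proj_cong)
    have "\<rho> g' v = R a (\<rho> g v)"
      using a b gc H_D[OF v b] by (simp add: g' rep_mult E_carrier St_carrier)
    then show "cinner s (\<rho> g' v) = cinner s (\<rho> g v)" if "s \<in> H \<beta>" for s
      using cinner_R_left[OF that a] by simp
  qed
  then show ?thesis
    unfolding rho_bar_def rho_bar_elt_def g'_def[symmetric] by (intro restrict_ext) auto
qed

lemma R_Theta_self_adjoint: "cinner (R (T \<beta> m) w) z = cinner w (R (T \<beta> m) z)"
proof -
  have "R (T \<beta> m) (R (T \<beta> m) z) = z"
    by (simp add: R_mult[symmetric] Theta_carrier Theta_square E_one rep_one)
  then show ?thesis
    using rep_cinner[OF E_carrier[OF Theta_carrier], of \<beta> m w "R (T \<beta> m) z"] by simp
qed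

lemma Theta_coefficient_stable:
  assumes u: "u \<in> H (\<lambda>_. N)" and w: "w \<in> H (\<lambda>_. N)" and \<beta>: "\<And>j. j < length Ls \<Longrightarrow> \<beta> j \<le> N"
    and m: "\<And>j. j < length Ls \<Longrightarrow> N \<le> m j" and m': "\<And>j. j < length Ls \<Longrightarrow> N \<le> m' j"
  shows "cinner w (R (T \<beta> m) u) = cinner w (R (T \<beta> m') u)"
proof -
  have shift: "cinner w (R (T \<beta> (\<lambda>j. m j + m' j)) u) = cinner w (R (T \<beta> m) u)"
    if n: "\<And>j. j < length Ls \<Longrightarrow> N \<le> m j" "\<And>j. j < length Ls \<Longrightarrow> N \<le> m' j" for m m'
  proof -
    obtain s t where s: "s \<in> St (\<lambda>_. N)" and t: "t \<in> St (\<lambda>_. N)"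
      and eq: "T \<beta> (\<lambda>j. m j + m' j) = s \<otimes>\<^bsub>L\<^esub> T \<beta> m \<otimes>\<^bsub>L\<^esub> t"
      using Theta_shift[of Ls \<beta> N m m'] n \<beta> by blast
    have "R (T \<beta> (\<lambda>j. m j + m' j)) u = R s (R (T \<beta> m) (R t u))"
      unfolding eq by (simp add: R_mult St_carrier[OF s] St_carrier[OF t] Theta_carrier)
    then show ?thesis
      by (simp add: H_D[OF u t] cinner_R_left[OF w s])
  qed
  show ?thesis
    using shift[OF m m'] shift[OF m' m] by (simp add: add.commute)
qed

text \<open>
  The vectors \<open>\<rho>(\<Theta>\<^sub>m) u\<close> for a sparse sequence of \<open>m\<close> have pairwise the same inner
  product, because \<open>\<Theta>\<^sub>m \<Theta>\<^sub>n \<in> \<Theta>\<^sub>n L\<^sup>N\<close> for \<open>n\<close> much larger than \<open>m\<close>.  Their averages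
  therefore converge.  Every element of \<open>L\<^sup>\<beta>\<close> fixes all but finitely many of the vectors, so
  the limit is in \<open>H\<^sup>\<beta>\<close>; but like \<open>u\<close> it is also orthogonal to \<open>H\<^sup>\<beta>\<close>, hence zero.
\<close>

lemma Theta_coefficient_zero:
  assumes u: "u \<in> H (\<lambda>_. N)" and w: "w \<in> H (\<lambda>_. N)" and \<beta>: "\<And>j. j < length Ls \<Longrightarrow> \<beta> j \<le> N"
    and m: "\<And>j. j < length Ls \<Longrightarrow> N \<le> m j"
    and orth: "\<And>z. z \<in> H \<beta> \<Longrightarrow> cinner z u = 0"
  shows "cinner w (R (T \<beta> m) u) = 0"
proof -
  let ?T = "\<lambda>n. T \<beta> (\<lambda>_. n)"
  have T\<beta>: "?T n \<in> St \<beta>" for n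
    by (rule Theta_stabilizer) simp
  have Tc: "?T n \<in> carrier L" for n
    by (rule Theta_carrier)
  have conj: "\<exists>M. \<forall>n \<ge> M. N \<le> n \<longrightarrow> R b (R (?T n) u) = R (?T n) u" if b: "b \<in> St \<beta>" for b
  proof -
    obtain M where M: "\<And>N m. (\<And>j. j < length Ls \<Longrightarrow> M \<le> m j \<and> N \<le> m j) \<Longrightarrow>
        T \<beta> m \<otimes>\<^bsub>L\<^esub> b \<otimes>\<^bsub>L\<^esub> T \<beta> m \<in> St (\<lambda>_. N)"
      using Theta_conj_stabilizer[OF b] by blast
    have "R b (R (?T n) u) = R (?T n) u" if n: "M \<le> n" "N \<le> n" for n
    proof -
      let ?b' = "?T n \<otimes>\<^bsub>L\<^esub> b \<otimes>\<^bsub>L\<^esub> ?T n"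
      have b': "?b' \<in> St (\<lambda>_. N)"
        using n by (intro M) simp
      have "?T n \<otimes>\<^bsub>L\<^esub> ?b' = (?T n \<otimes>\<^bsub>L\<^esub> ?T n) \<otimes>\<^bsub>L\<^esub> (b \<otimes>\<^bsub>L\<^esub> ?T n)"
        using Tc St_carrier[OF b] by (simp add: L.m_assoc)
      also have "\<dots> = b \<otimes>\<^bsub>L\<^esub> ?T n"
        using Tc St_carrier[OF b] by (simp add: Theta_square)
      finally have "R b (R (?T n) u) = R (?T n) (R ?b' u)"
        using Tc St_carrier[OF b] St_carrier[OF b'] by (simp only: R_mult[symmetric])
      then show ?thesis
        by (simp only: H_D[OF u b'])
    qed
    then show ?thesis
      by blast
  qed
  obtain M where M: "\<And>k n. M k \<le> n \<Longrightarrow> N \<le> n \<Longrightarrow> R (?T k) (R (?T n) u) = R (?T n) u"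
    using conj[OF T\<beta>] by metis
  obtain \<mu> where \<mu>: "\<And>k. N + k \<le> \<mu> k" "\<And>j k. j < k \<Longrightarrow> M (\<mu> j) \<le> \<mu> k"
    using sparse_sequence[of N M] by blast
  have \<mu>N: "N \<le> \<mu> k" for k
    using \<mu>(1)[of k] by simp
  define x where "x k = R (?T (\<mu> k)) u" for k
  define d where "d = cinner u (R (?T N) u)"
  have stable: "cinner v (x k) = cinner v (R (T \<beta> m) u)" if "v \<in> H (\<lambda>_. N)" "\<And>j. j < length Ls \<Longrightarrow> N \<le> m j" for v k m
    unfolding x_def using u that \<beta> \<mu>N by (intro Theta_coefficient_stable) auto
  have less: "cinner (x i) (x j) = d" if "i < j" for i j
  proof -
    have "cinner (x i) (x j) = cinner u (R (?T (\<mu> i)) (x j))"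
      by (simp add: x_def R_Theta_self_adjoint)
    also have "R (?T (\<mu> i)) (x j) = x j"
      unfolding x_def by (rule M[OF \<mu>(2)[OF that] \<mu>N])
    also have "cinner u (x j) = d"
      unfolding d_def by (rule stable[OF u]) simp
    finally show ?thesis .
  qed
  have "cnj d = d"
    unfolding d_def by (metis R_Theta_self_adjoint cinner_commute)
  then have gram: "cinner (x i) (x j) = (if i = j then complex_of_real ((norm u)\<^sup>2) else d)" for i j
    using less[of i j] less[of j i] cinner_commute[of "x i" "x j"]
    by (cases i j rule: linorder_cases) (simp_all add: x_def cinner_self rep_norm E_carrier Tc)
  define y where "y n = (1 / real (Suc n)) *\<^sub>R (\<Sum>i<Suc n. x i)" for n
  have "convergent y"
    using equiangular_means_convergent[OF gram] by (simp only: y_def[abs_def])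
  then obtain z where z: "y \<longlonglongrightarrow> z"
    by (auto simp: convergent_def)
  have mean: "cinner v z = a" if "\<And>k. cinner v (x k) = a" for v a
  proof -
    have "cinner v (y n) = a" for n
      by (simp add: y_def cinner_scaleR_right cinner_sum_right that del: of_nat_Suc sum.lessThan_Suc)
    then have "(\<lambda>n. a) \<longlonglongrightarrow> cinner v z"
      using tendsto_cinner[OF z, of v] by simp
    then show ?thesis
      by (simp add: LIMSEQ_const_iff)
  qed
  have "z \<in> H \<beta>"
    unfolding fixed_space_def
  proof (intro CollectI ballI)
    fix b assume b: "b \<in> St \<beta>"
    note bc = E_carrier[OF St_carrier[OF b]]
    obtain K where K: "\<And>n. K \<le> n \<Longrightarrow> N \<le> n \<Longrightarrow> R b (R (?T n) u) = R (?T n) u"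
      using conj[OF b] by blast
    have "R b (x i) - x i = 0" if "K \<le> i" for i
      unfolding x_def using K[of "\<mu> i"] \<mu>(1)[of i] that by simp
    then have "(\<lambda>n. (1 / real (Suc n)) *\<^sub>R (\<Sum>i<Suc n. R b (x i) - x i)) \<longlonglongrightarrow> 0"
      by (rule means_of_eventually_zero)
    then have "(\<lambda>n. R b (y n) - y n) \<longlonglongrightarrow> 0"
      by (simp only: y_def rep_scaleR[OF bc] rep_sum[OF bc] sum_subtractf scaleR_diff_right)
    moreover have "(\<lambda>n. R b (y n) - y n) \<longlonglongrightarrow> R b z - z"
      by (intro tendsto_diff rep_tendsto bc z)
    ultimately have "R b z - z = 0"
      by (metis LIMSEQ_unique)
    then show "R b z = z"
      by simp
  qed
  then have "cinner z (x k) = 0" for k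
    using cinner_R_left[of z \<beta> "?T (\<mu> k)" u] T\<beta> orth by (simp add: x_def)
  then have "z = 0"
    using mean[of z 0] cinner_eq_0_self by blast
  moreover have "cinner w z = cinner w (R (T \<beta> m) u)"
    by (rule mean, rule stable[OF w m])
  ultimately show ?thesis
    by simp
qed

text \<open>
  As \<open>\<Theta>\<^sub>m \<in> L\<^sup>\<beta>\<close> fixes the projection of \<open>u\<close>, only the part of \<open>u\<close> orthogonal to \<open>H\<^sup>\<beta>\<close> matters.
\<close>

lemma Theta_coefficient:
  assumes u: "u \<in> H (\<lambda>_. N)" and w: "w \<in> H (\<lambda>_. N)" and \<beta>: "\<And>j. j < length Ls \<Longrightarrow> \<beta> j \<le> N"
    and m: "\<And>j. j < length Ls \<Longrightarrow> N \<le> m j"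
  shows "cinner w (R (T \<beta> m) u) = cinner w (proj \<beta> u)"
proof -
  let ?p = "proj \<beta> u"
  have "?p \<in> H (\<lambda>_. N)"
    using proj_mem H_mono[of \<beta> "\<lambda>_. N"] \<beta> by blast
  then have "cinner w (R (T \<beta> m) (u - ?p)) = 0"
    using proj_orth[of _ \<beta> u] by (intro Theta_coefficient_zero[OF _ w \<beta> m] H_diff u) auto
  moreover have "R (T \<beta> m) ?p = ?p"
    by (rule H_D[OF proj_mem Theta_stabilizer]) simp
  ultimately show ?thesis
    by (simp add: rep_diff E_carrier Theta_carrier cinner_diff_right)
qed

lemma St_commute_H:
  assumes g: "g \<in> carrier G" and comm: "\<And>l. l \<in> St \<alpha> \<Longrightarrow> E l \<otimes>\<^bsub>G\<^esub> g = g \<otimes>\<^bsub>G\<^esub> E l"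
  shows "\<rho> g v \<in> H \<alpha> \<longleftrightarrow> v \<in> H \<alpha>"
proof -
  have "R l (\<rho> g v) = \<rho> g (R l v)" if "l \<in> St \<alpha>" for l
    using comm[OF that] rep_mult[OF E_carrier[OF St_carrier[OF that]] g, of v]
      rep_mult[OF g E_carrier[OF St_carrier[OF that]], of v] by simp
  then show ?thesis
    unfolding fixed_space_def using rep_inj[OF g] by fastforce
qed

text \<open>
  Moving \<open>\<rho>(g)\<close> to the other side of the inner product, both sides of the claim become matrix
  coefficients between vectors that are fixed by the same \<open>L\<^sup>N\<close>.
\<close>

lemma rho_bar_mult:
  assumes \<gg>: "\<gg> \<in> dcosets Gs Ls F \<gamma> \<beta>" and \<hh>: "\<hh> \<in> dcosets Gs Ls F \<beta> \<alpha>" and v: "v \<in> H \<alpha>"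
  shows "rho_bar Gs Ls F \<rho> \<beta> \<gamma> \<gg> (rho_bar Gs Ls F \<rho> \<alpha> \<beta> \<hh> v) =
    rho_bar Gs Ls F \<rho> \<alpha> \<gamma> (dcoset_mult Gs Ls F \<gamma> \<beta> \<alpha> \<gg> \<hh>) v"
proof -
  obtain g where g: "g \<in> carrier G" "g \<in> \<gg>"
    using \<gg> dcoset_self by (auto simp: dcosets_def)
  obtain h where h: "h \<in> carrier G" "h \<in> \<hh>"
    using \<hh> dcoset_self by (auto simp: dcosets_def)
  let ?D = "dcoset_mult Gs Ls F \<gamma> \<beta> \<alpha> \<gg> \<hh>"
  obtain M where M: "\<And>m. (\<forall>j < length Ls. M \<le> m j) \<Longrightarrow> Theta_dcoset Gs Ls F \<gamma> \<beta> \<alpha> m g h = ?D"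
    using dcoset_mult_eventual(2)[OF \<gg> \<hh> g(2) h(2)] unfolding eventual_dcoset_def by blast
  obtain N1 where N1: "\<And>l. l \<in> St (\<lambda>_. N1) \<Longrightarrow> E l \<otimes>\<^bsub>G\<^esub> g = g \<otimes>\<^bsub>G\<^esub> E l"
    using St_commute[OF g(1)] by blast
  obtain N2 where N2: "\<And>l. l \<in> St (\<lambda>_. N2) \<Longrightarrow> E l \<otimes>\<^bsub>G\<^esub> h = h \<otimes>\<^bsub>G\<^esub> E l"
    using St_commute[OF h(1)] by blast
  obtain N3 where N3: "\<forall>j < length Ls. \<alpha> j \<le> N3"
    using multiindex_bound by blast
  obtain N4 where N4: "\<forall>j < length Ls. \<beta> j \<le> N4"
    using multiindex_bound by blast
  obtain N5 where N5: "\<forall>j < length Ls. \<gamma> j \<le> N5"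
    using multiindex_bound by blast
  define N where "N = N1 + N2 + N3 + N4 + N5"
  define m where "m = (\<lambda>j::nat. M + N)"
  let ?x = "g \<otimes>\<^bsub>G\<^esub> E (T \<beta> m) \<otimes>\<^bsub>G\<^esub> h" and ?u = "\<rho> h v"
  have HN: "H \<alpha> \<subseteq> H (\<lambda>_. N)" "H \<gamma> \<subseteq> H (\<lambda>_. N)"
    using N3 N5 by (auto intro!: H_mono simp: N_def trans_le_add1 trans_le_add2)
  have gN: "\<rho> g w \<in> H (\<lambda>_. N) \<longleftrightarrow> w \<in> H (\<lambda>_. N)" for w
    using N1 St_antimono[of N1 N] by (intro St_commute_H g(1)) (auto simp: N_def)
  have hN: "\<rho> h w \<in> H (\<lambda>_. N) \<longleftrightarrow> w \<in> H (\<lambda>_. N)" for w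
    using N2 St_antimono[of N2 N] by (intro St_commute_H h(1)) (auto simp: N_def)
  have u: "?u \<in> H (\<lambda>_. N)"
    using hN HN(1) v by blast
  have xc: "?x \<in> carrier G"
    using g(1) h(1) by (simp add: E_carrier Theta_carrier)
  have x: "?x \<in> ?D"
    using dcoset_self[OF xc, of \<gamma> \<alpha>] M[of m] by (simp add: Theta_dcoset_def m_def)
  have "proj \<gamma> (\<rho> g (proj \<beta> ?u)) = proj \<gamma> (\<rho> ?x v)"
  proof (rule proj_cong)
    fix s assume s: "s \<in> H \<gamma>"
    obtain w where w: "\<rho> g w = s"
      using rep_surj[OF g(1)] by blast
    then have wN: "w \<in> H (\<lambda>_. N)"
      using gN HN(2) s by blast
    have "cinner s (\<rho> g (proj \<beta> ?u)) = cinner w (proj \<beta> ?u)"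
      by (simp add: w[symmetric] rep_cinner g(1))
    also have "\<dots> = cinner w (R (T \<beta> m) ?u)"
      using N4 by (intro Theta_coefficient[OF u wN, symmetric]) (auto simp: m_def N_def trans_le_add1 trans_le_add2)
    also have "\<dots> = cinner s (\<rho> ?x v)"
      using g(1) h(1) by (simp add: w[symmetric] rep_cinner rep_mult E_carrier Theta_carrier)
    finally show "cinner s (\<rho> g (proj \<beta> ?u)) = cinner s (\<rho> ?x v)" .
  qed
  then show ?thesis
    unfolding rho_bar_eq[OF \<gg> g(2)] rho_bar_eq[OF \<hh> h(2)]
      rho_bar_eq[OF dcoset_mult_eventual(1)[OF \<gg> \<hh>] x] rho_bar_elt_def
    by (simp add: v proj_mem)
qed

end

theorem mainTheorem1:
  fixes Gs :: "classical list" and Ls :: "heavy list"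
    and F :: "(nat \<Rightarrow> nat qmat) \<Rightarrow> nat \<times> nat \<Rightarrow> nat qmat"
    and \<rho> :: "(nat \<Rightarrow> (nat + nat) qmat) \<Rightarrow> 'h::complex_hilbert_space \<Rightarrow> 'h"
  assumes "GL_pair Gs Ls F"
  shows "(\<forall>\<alpha> \<beta> \<gamma>. \<forall>\<gg> \<in> dcosets Gs Ls F \<gamma> \<beta>. \<forall>\<hh> \<in> dcosets Gs Ls F \<beta> \<alpha>.
            dcoset_mult Gs Ls F \<gamma> \<beta> \<alpha> \<gg> \<hh> \<in> dcosets Gs Ls F \<gamma> \<alpha> \<and>
            (\<forall>g \<in> \<gg>. \<forall>h \<in> \<hh>.
               eventual_dcoset Gs Ls F \<gamma> \<beta> \<alpha> g h (dcoset_mult Gs Ls F \<gamma> \<beta> \<alpha> \<gg> \<hh>))) \<and>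
         (unitary_rep Gs Ls F \<rho> \<longrightarrow>
            (\<forall>\<alpha> \<beta>. \<forall>\<gg> \<in> dcosets Gs Ls F \<beta> \<alpha>. \<forall>g \<in> \<gg>.
               rho_bar Gs Ls F \<rho> \<alpha> \<beta> \<gg> = rho_bar_elt Gs Ls F \<rho> \<alpha> \<beta> g) \<and>
            (\<forall>\<alpha> \<beta> \<gamma>. \<forall>\<gg> \<in> dcosets Gs Ls F \<gamma> \<beta>. \<forall>\<hh> \<in> dcosets Gs Ls F \<beta> \<alpha>.
               \<forall>v \<in> fixed_space Gs Ls F \<rho> \<alpha>.
                 rho_bar Gs Ls F \<rho> \<beta> \<gamma> \<gg> (rho_bar Gs Ls F \<rho> \<alpha> \<beta> \<hh> v) =
                 rho_bar Gs Ls F \<rho> \<alpha> \<gamma> (dcoset_mult Gs Ls F \<gamma> \<beta> \<alpha> \<gg> \<hh>) v))"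
proof (intro conjI impI)
  interpret GL_pair_embedding Gs Ls F
    by unfold_locales (rule assms)
  show "\<forall>\<alpha> \<beta> \<gamma>. \<forall>\<gg> \<in> dcosets Gs Ls F \<gamma> \<beta>. \<forall>\<hh> \<in> dcosets Gs Ls F \<beta> \<alpha>.
      dcoset_mult Gs Ls F \<gamma> \<beta> \<alpha> \<gg> \<hh> \<in> dcosets Gs Ls F \<gamma> \<alpha> \<and>
      (\<forall>g \<in> \<gg>. \<forall>h \<in> \<hh>.
         eventual_dcoset Gs Ls F \<gamma> \<beta> \<alpha> g h (dcoset_mult Gs Ls F \<gamma> \<beta> \<alpha> \<gg> \<hh>))"
    using dcoset_mult_eventual by simp
  assume "unitary_rep Gs Ls F \<rho>"
  then interpret GL_pair_rep Gs Ls F \<rho>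
    by unfold_locales
  show "\<forall>\<alpha> \<beta>. \<forall>\<gg> \<in> dcosets Gs Ls F \<beta> \<alpha>. \<forall>g \<in> \<gg>.
      rho_bar Gs Ls F \<rho> \<alpha> \<beta> \<gg> = rho_bar_elt Gs Ls F \<rho> \<alpha> \<beta> g"
    using rho_bar_eq by simp
  show "\<forall>\<alpha> \<beta> \<gamma>. \<forall>\<gg> \<in> dcosets Gs Ls F \<gamma> \<beta>. \<forall>\<hh> \<in> dcosets Gs Ls F \<beta> \<alpha>.
      \<forall>v \<in> fixed_space Gs Ls F \<rho> \<alpha>.
        rho_bar Gs Ls F \<rho> \<beta> \<gamma> \<gg> (rho_bar Gs Ls F \<rho> \<alpha> \<beta> \<hh> v) =
        rho_bar Gs Ls F \<rho> \<alpha> \<gamma> (dcoset_mult Gs Ls F \<gamma> \<beta> \<alpha> \<gg> \<hh>) v"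
    using rho_bar_mult by simp
qed

end
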